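(* Let $n\ge3$, $2<p\le2^*=\frac{2n}{n-2}$ and $\gamma\in[0,n/2)$. There exist $r_{n,\gamma}$ and $\alpha^*_{n,\gamma}$ in $(0,1)$, depending only on $n$ and $\gamma$, such that the following holds. Let $\Omega\subset\mathbb{R}^n$ be a bounded domain with $0\in\partial\Omega$, let $D=\sup_{x\in\Omega}|x|$, and assume that $\Omega$ satisfies an exterior ball condition at zero with exterior ball $B_\rho(-\rho e_n)\subset\mathbb{R}^n\setminus\overline{\Omega}$. If the radius $\rho$ of the exterior ball satisfies $\rho\ge D/r_{n,\gamma}$, then for all $0<\alpha\le\alpha^*_{n,\gamma}$ and all $u\in C_c^\infty(\Omega)$ there holds $$\int_\Omega|\nabla u|^2dx\ \ge\ \frac{n^2}{4}\int_\Omega\frac{u^2}{|x|^2}dx+(n-2\gamma)^{-\frac{p+2}{p}}S^*_{n,p,\gamma}\bigg(\int_\Omega|x|^{\frac{p(n-2)}{2}-n}\Big(\frac{|x+2\rho e_n|}{2\rho}\Big)^{\frac{p(n-2)}{2}-n}X^{\frac{p+2}{2}}\big(\alpha|x|/D\big)|u|^pdx\bigg)^{\frac2p}.$$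
   Context: $X(t)=\frac{1}{1-\ln t}$ for $t\in(0,1)$, and $X^{q}(t)=(X(t))^q$. $e_n=(0,\dots,0,1)\in\mathbb{R}^n$; $B_\rho(-\rho e_n)$ is the open ball of radius $\rho$ centered at $-\rho e_n$. Functions are real-valued. $\mathbb{R}^n_+=\{x\in\mathbb{R}^n:x_n>0\}$. For $n\ge3$, $0\le\gamma<n/2$ and $2<p\le2^*$, $$S^*_{n,p,\gamma}=\inf_{0\ne u\in C_c^\infty(\mathbb{R}^n_+)}\frac{\int_{\mathbb{R}^n_+}|\nabla u|^2dx-\gamma(n-\gamma)\int_{\mathbb{R}^n_+}\frac{u^2}{|x|^2}dx}{\Big(\int_{\mathbb{R}^n_+}|x|^{\frac{p(n-2)}{2}-n}|u|^pdx\Big)^{2/p}}.$$ *)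

theory Defs
  imports "HOL-Analysis.Analysis"
begin

definition partial_deriv :: "'n::finite \<Rightarrow> (real ^ 'n \<Rightarrow> real) \<Rightarrow> real ^ 'n \<Rightarrow> real" where
  "partial_deriv i f x = frechet_derivative f (at x) (axis i 1)"

definition grad :: "(real ^ 'n::finite \<Rightarrow> real) \<Rightarrow> real ^ 'n \<Rightarrow> real ^ 'n" where
  "grad f x = (\<chi> i. partial_deriv i f x)"

fun Ck :: "nat \<Rightarrow> (real ^ 'n::finite \<Rightarrow> real) \<Rightarrow> bool" where
  "Ck 0 f \<longleftrightarrow> continuous_on UNIV f"
| "Ck (Suc m) f \<longleftrightarrow> (\<forall>x. f differentiable (at x)) \<and> (\<forall>i. Ck m (partial_deriv i f))"

definition smooth :: "(real ^ 'n::finite \<Rightarrow> real) \<Rightarrow> bool" where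
  "smooth f \<longleftrightarrow> (\<forall>m. Ck m f)"

(* A function with compact support in the open set U is identified with its
   extension by zero to the whole space, which is smooth there. *)
definition Cc_infinity :: "(real ^ 'n::finite) set \<Rightarrow> (real ^ 'n \<Rightarrow> real) set" where
  "Cc_infinity U = {u. smooth u \<and> compact (closure (support_on UNIV u))
                         \<and> closure (support_on UNIV u) \<subseteq> U}"

(* The distinguished n-th coordinate is an arbitrary index k of the coordinate
   type, which carries no order; the vector e_n is then axis k 1. *)
definition half_space :: "'n::finite \<Rightarrow> (real ^ 'n) set" where
  "half_space k = {x. x $ k > 0}"

(* Only used for 0 < t < 1. *)
definition X :: "real \<Rightarrow> real" where
  "X t = 1 / (1 - ln t)"

(* For u in C_c^infinity of the half-space, the integrands are continuous with compact
   support away from the origin, so the integrals are finite.  The quotients are bounded below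
   by 0 (Hardy's inequality on the half-space, with constant n^2/4), so this real
   infimum is the ordinary one. *)
definition S_star :: "'n::finite \<Rightarrow> real \<Rightarrow> real \<Rightarrow> real" where
  "S_star k p \<gamma> =
     (let n = real CARD('n) in
      INF u \<in> {u \<in> Cc_infinity (half_space k). u \<noteq> (\<lambda>x. 0)}.
        ((LINT x:half_space k|lborel. (norm (grad u x))\<^sup>2)
           - \<gamma> * (n - \<gamma>) * (LINT x:half_space k|lborel. (u x)\<^sup>2 / (norm x)\<^sup>2))
        / (LINT x:half_space k|lborel.
             norm x powr (p * (n - 2) / 2 - n) * \<bar>u x\<bar> powr p) powr (2 / p))"

end

theory Submission
  imports Defs
begin

text \<open>
  Let $n$ be the dimension, $\delta = n - 2\gamma$ and $Q = 2\rho e_n$.  An inversion centred at $-Q$,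
  followed by a reflection, fixes the origin and maps the exterior of the ball conformally into the
  half-space.  The Kelvin transform turns $\int u^2/|x|^2$ into an integral with an additional factor
  $1 + O(|y|/\rho)$, which costs an error $O(|y|/\rho)\, v^2/|y|^2$ in the Hardy inequality.

  Let $P = \ln (M/|y|)$ with $M = D/\alpha^*$.  The radial change of variables
  $P = \cosh(-\delta \ln |\xi|)$ together with the substitution $v = \sqrt{g}\, h$,
  $g = \sqrt{P^2 - 1}$, maps the critical Hardy functional to $1/\delta$ times the functional of
  $S^*$, weights the $L^p$ norm by $g^{-(p+2)/2}$, and produces in addition the positive term
  $\frac{3}{4} g^{-4}\, v^2/|y|^2$.  (The choice $P = e^{-\delta \ln|\xi|}$, $g = P$, would give no
  such term.)  As $g \le P$ grows only logarithmically, that term absorbs the error of the Kelvin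
  transform once $D/\rho$ is small, and $X(\alpha|x|/D) \le 1/g$.

  Both maps are composed, and all gradients are compared after factoring out the positive
  ground states $x_n |x|^{-n/2}$ in the half-space and its counterpart in the domain; only first
  order terms then have to be transformed, and the angular part has the right sign as soon as
  $\delta g \ge 1$.
\<close>

section \<open>Functions of class $C^k$ on open sets\<close>

text \<open>The exponent \<delta> comes from n^2/4 - \<gamma>(n - \<gamma>) = \<delta>^2/4, the
  Hardy remainder left in the functional of \<open>S_star\<close> after its ground state is split
  off. With \<tau> = -\<delta> ln |\<xi>| and g = dP/d\<tau>, the critical term v^2/(4 g^2 |y|^2)
  becomes exactly this remainder. The potential produced by the factor sqrt g is -(sqrt g)''/sqrt g,
  differentiated in P; for P = cosh \<tau> it equals 1/(4 g^2) + 3/(4 g^4), and the second summand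
  is the surplus.

  The power -(p+2)/p of \<delta> has two sources: 1/\<delta> from the functional, and \<delta> to
  the power -2/p from the Jacobian in the L^p integral.

  The constants do not depend on p, because the L^p weights are compared pointwise and every
  smallness condition concerns the quadratic part. With A = 2 + 1/\<delta> and M = D exp A one gets
  P \<ge> 1 + 1/\<delta> on the domain, hence \<delta> g \<ge> 1. The number r has to give M \<le>
  2\<rho> and to let 3/(4 g^4) absorb the defect of the Kelvin transform; the latter reduces to the
  boundedness of t (A + 1 - ln t)^4 on (0,1].\<close>

fun Ck_on :: "nat \<Rightarrow> (real ^ 'n::finite) set \<Rightarrow> (real ^ 'n \<Rightarrow> real) \<Rightarrow> bool" where
  "Ck_on 0 S f \<longleftrightarrow> continuous_on S f"
| "Ck_on (Suc m) S f \<longleftrightarrow> (\<forall>x\<in>S. f differentiable (at x)) \<and> (\<forall>i. Ck_on m S (partial_deriv i f))"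

lemma Ck_eq_Ck_on: "Ck m f \<longleftrightarrow> Ck_on m UNIV f"
  by (induction m arbitrary: f) auto

lemma partial_deriv_eq:
  assumes "(f has_derivative f') (at x)"
  shows "partial_deriv i f x = f' (axis i 1)"
  using assms frechet_derivative_at[OF assms] by (simp add: partial_deriv_def)

lemma has_derivative_transform_open:
  assumes "open S" "x \<in> S" "\<And>y. y \<in> S \<Longrightarrow> f y = g y" "(f has_derivative f') (at x)"
  shows "(g has_derivative f') (at x)"
  using has_derivative_transform_within_open[OF assms(4,1,2)] assms(3) by blast

lemma partial_deriv_cong_open:
  assumes S: "open S" "x \<in> S" and eq: "\<And>y. y \<in> S \<Longrightarrow> f y = g y" and f: "f differentiable (at x)"
  shows "partial_deriv i f x = partial_deriv i g x"
proof -
  obtain f' where f': "(f has_derivative f') (at x)"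
    using f by (auto simp: differentiable_def)
  from has_derivative_transform_open[OF S eq f'] f' show ?thesis
    by (simp add: partial_deriv_eq)
qed

lemma Ck_on_cong:
  assumes "open S" "\<And>x. x \<in> S \<Longrightarrow> f x = g x" "Ck_on m S f"
  shows "Ck_on m S g"
  using assms(2,3)
proof (induction m arbitrary: f g)
  case 0
  show ?case
    unfolding Ck_on.simps
    by (rule continuous_on_eq[OF 0(2)[unfolded Ck_on.simps] 0(1)])
next
  case (Suc m)
  have d: "g differentiable (at x)" if x: "x \<in> S" for x
  proof -
    obtain f' where "(f has_derivative f') (at x)"
      using Suc.prems(2) x unfolding Ck_on.simps differentiable_def by blast
    from has_derivative_transform_open[OF assms(1) x Suc.prems(1) this]
    show ?thesis unfolding differentiable_def by blast
  qed
  have "Ck_on m S (partial_deriv i g)" for i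
  proof (rule Suc.IH)
    show "Ck_on m S (partial_deriv i f)" using Suc.prems(2) by simp
    show "partial_deriv i f x = partial_deriv i g x" if "x \<in> S" for x
      by (rule partial_deriv_cong_open[OF assms(1) that Suc.prems(1)]) (use Suc.prems(2) that in simp_all)
  qed
  with d show ?case by simp
qed

lemma Ck_on_subset: "Ck_on m S f \<Longrightarrow> T \<subseteq> S \<Longrightarrow> Ck_on m T f"
  by (induction m arbitrary: f) (auto intro: continuous_on_subset)

text \<open>This glues extensions by zero: one open set contains the support, the other is the
  complement of the compact support, where the function is 0.\<close>

lemma Ck_on_Un:
  assumes "open S" "open T" "Ck_on m S f" "Ck_on m T f"
  shows "Ck_on m (S \<union> T) f"
  using assms(3,4) by (induction m arbitrary: f) (auto intro: continuous_on_open_Un assms(1,2))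

lemma Ck_on_imp_continuous: "Ck_on m S f \<Longrightarrow> continuous_on S f"
proof (cases m)
  case (Suc k)
  assume "Ck_on m S f"
  then have "\<forall>x\<in>S. isCont f x" using differentiable_imp_continuous_within by (auto simp: Suc)
  then show ?thesis by (rule continuous_at_imp_continuous_on)
qed simp

text \<open>The recursion records continuity only at its bottom, so it is recovered from
  differentiability. The product and chain rules use this to lower the order of the undifferentiated
  factor.\<close>

lemma Ck_on_Suc_imp: "Ck_on (Suc m) S f \<Longrightarrow> Ck_on m S f"
proof (induction m arbitrary: f)
  case 0 then show ?case using Ck_on_imp_continuous[of "Suc 0" S f] by (simp only: Ck_on.simps(1))
next
  case (Suc m)
  then have "Ck_on m S (partial_deriv i f)" for i by (metis Ck_on.simps(2))
  with Suc.prems show ?case by simp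
qed

lemma Ck_on_const: "Ck_on m S (\<lambda>x. c)"
proof (induction m arbitrary: c)
  case (Suc m)
  have "partial_deriv i (\<lambda>x. c) = (\<lambda>x::real^'a. 0)" for i
    by (rule ext) (simp add: partial_deriv_eq[OF has_derivative_const])
  with Suc show ?case by (auto simp: Suc[of 0])
qed auto

lemma Ck_on_component: "Ck_on m S (\<lambda>x::real^'n::finite. x $ j)"
proof (cases m)
  case (Suc k)
  have d: "((\<lambda>x::real^'n. x $ j) has_derivative (\<lambda>h. h $ j)) (at x)" for x
    by (simp add: bounded_linear_imp_has_derivative bounded_linear_vec_nth)
  have "partial_deriv i (\<lambda>x::real^'n. x $ j) = (\<lambda>x. axis i 1 $ j)" for i
    by (rule ext) (simp add: partial_deriv_eq[OF d])
  with d show ?thesis unfolding Suc by (auto simp: differentiable_def intro: Ck_on_const)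
qed (auto intro!: continuous_intros)

lemma Ck_on_add:
  assumes "open S" "Ck_on m S f" "Ck_on m S g"
  shows "Ck_on m S (\<lambda>x. f x + g x)"
  using assms(2,3)
proof (induction m arbitrary: f g)
  case (Suc m)
  have pd: "partial_deriv i (\<lambda>x. f x + g x) x = partial_deriv i f x + partial_deriv i g x"
    if x: "x \<in> S" for i x
  proof -
    obtain f' g' where "(f has_derivative f') (at x)" "(g has_derivative g') (at x)"
      using x Suc.prems unfolding Ck_on.simps differentiable_def by meson
    from partial_deriv_eq[OF has_derivative_add[OF this]] partial_deriv_eq[OF this(1)] partial_deriv_eq[OF this(2)]
    show ?thesis by simp
  qed
  have "Ck_on m S (partial_deriv i (\<lambda>x. f x + g x))" for i
    by (rule Ck_on_cong[OF assms(1) pd[symmetric] Suc.IH]) (use Suc.prems in simp_all)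
  with Suc.prems show ?case by simp
qed (auto intro: continuous_on_add)

lemma Ck_on_mult:
  assumes "open S" "Ck_on m S f" "Ck_on m S g"
  shows "Ck_on m S (\<lambda>x. f x * g x)"
  using assms(2,3)
proof (induction m arbitrary: f g)
  case (Suc m)
  have pd: "partial_deriv i (\<lambda>x. f x * g x) x = f x * partial_deriv i g x + partial_deriv i f x * g x"
    if x: "x \<in> S" for i x
  proof -
    obtain f' g' where "(f has_derivative f') (at x)" "(g has_derivative g') (at x)"
      using x Suc.prems unfolding Ck_on.simps differentiable_def by meson
    from partial_deriv_eq[OF has_derivative_mult[OF this]] partial_deriv_eq[OF this(1)] partial_deriv_eq[OF this(2)]
    show ?thesis by simp
  qed
  have "Ck_on m S (partial_deriv i (\<lambda>x. f x * g x))" for i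
    by (rule Ck_on_cong[OF assms(1) pd[symmetric] Ck_on_add[OF assms(1) Suc.IH Suc.IH]])
       (use Suc.prems Ck_on_Suc_imp[OF Suc.prems(1)] Ck_on_Suc_imp[OF Suc.prems(2)] in simp_all)
  with Suc.prems show ?case by simp
qed (auto intro: continuous_on_mult)

lemma Ck_on_sum:
  assumes "open S" "\<And>j. j \<in> I \<Longrightarrow> Ck_on m S (f j)"
  shows "Ck_on m S (\<lambda>x. \<Sum>j\<in>I. f j x)"
  using assms(2)
  by (induction I rule: infinite_finite_induct) (auto intro: Ck_on_const Ck_on_add[OF assms(1)])

lemma Ck_on_minus:
  assumes "open S" "Ck_on m S f" shows "Ck_on m S (\<lambda>x. - f x)"
  using Ck_on_mult[OF assms(1) Ck_on_const[of m S "-1"] assms(2)] by simp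

lemma Ck_on_diff:
  assumes "open S" "Ck_on m S f" "Ck_on m S g" shows "Ck_on m S (\<lambda>x. f x - g x)"
  using Ck_on_add[OF assms(1,2) Ck_on_minus[OF assms(1,3)]] by simp

lemma partial_deriv_chain:
  assumes "f differentiable (at x)" "(\<phi> has_field_derivative c) (at (f x))"
  shows "(\<lambda>x. \<phi> (f x)) differentiable (at x)"
    and "partial_deriv i (\<lambda>x. \<phi> (f x)) x = c * partial_deriv i f x"
proof -
  obtain f' where f': "(f has_derivative f') (at x)"
    using assms(1) by (auto simp: differentiable_def)
  have "((\<lambda>x. \<phi> (f x)) has_derivative (\<lambda>h. c * f' h)) (at x)"
    using has_derivative_compose[OF f' assms(2)[unfolded has_field_derivative_def]] by simp
  with f' show "(\<lambda>x. \<phi> (f x)) differentiable (at x)"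
    "partial_deriv i (\<lambda>x. \<phi> (f x)) x = c * partial_deriv i f x"
    by (auto simp: differentiable_def partial_deriv_eq)
qed

lemma Ck_on_exp:
  assumes "open S" "Ck_on m S f" shows "Ck_on m S (\<lambda>x. exp (f x))"
  using assms(2)
proof (induction m arbitrary: f)
  case (Suc m)
  have d: "f differentiable (at x)" if "x \<in> S" for x using Suc.prems that by simp
  note pd = partial_deriv_chain[OF d DERIV_exp]
  have "Ck_on m S (partial_deriv i (\<lambda>x. exp (f x)))" for i
  proof (rule Ck_on_cong[OF assms(1) pd(2)[symmetric]])
    show "Ck_on m S (\<lambda>x. exp (f x) * partial_deriv i f x)"
      using Ck_on_mult[OF assms(1) Suc.IH[OF Ck_on_Suc_imp[OF Suc.prems]]] Suc.prems by simp
  qed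
  with pd(1) show ?case by simp
qed (auto intro: continuous_on_exp)

text \<open>The derivative of 1/f is -(1/f)^2 times that of f, so the induction hypothesis is
  applied to the same f, one order lower.\<close>

lemma Ck_on_inverse:
  assumes "open S" "Ck_on m S f" "\<And>x. x \<in> S \<Longrightarrow> f x \<noteq> 0" shows "Ck_on m S (\<lambda>x. inverse (f x))"
  using assms(2,3)
proof (induction m arbitrary: f)
  case 0
  then have "continuous_on S (\<lambda>x. inverse (f x))"
    by (intro continuous_on_inverse ballI) (simp_all only: Ck_on.simps not_False_eq_True)
  then show ?case by (simp only: Ck_on.simps)
next
  case (Suc m)
  have d: "f differentiable (at x)" if "x \<in> S" for x using Suc.prems(1) that by (simp only: Ck_on.simps)
  note pd = partial_deriv_chain[OF d DERIV_inverse[OF Suc.prems(2)]]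
  have c: "Ck_on m S (\<lambda>x. inverse (f x))"
    using Suc.IH[OF Ck_on_Suc_imp[OF Suc.prems(1)] Suc.prems(2)] .
  have "Ck_on m S (partial_deriv i (\<lambda>x. inverse (f x)))" for i
  proof (rule Ck_on_cong[OF assms(1) pd(2)[symmetric]])
    have "Ck_on m S (partial_deriv i f)" using Suc.prems(1) by simp
    from Ck_on_mult[OF assms(1) Ck_on_minus[OF assms(1) Ck_on_mult[OF assms(1) c c]] this]
    show "Ck_on m S (\<lambda>x. - (inverse (f x) ^ Suc (Suc 0)) * partial_deriv i f x)"
      by (simp only: power_Suc power_0 mult_1_right)
  qed
  with pd(1) show ?case by (simp only: Ck_on.simps) blast
qed

lemma Ck_on_ln:
  assumes "open S" "Ck_on m S f" "\<And>x. x \<in> S \<Longrightarrow> f x > 0" shows "Ck_on m S (\<lambda>x. ln (f x))"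
proof (cases m)
  case 0
  have "f x \<noteq> 0" if "x \<in> S" for x using assms(3)[OF that] by simp
  then show ?thesis using assms by (simp add: continuous_on_ln 0)
next
  case (Suc k)
  have d: "f differentiable (at x)" if "x \<in> S" for x using assms(2) that by (simp add: Suc)
  have nz: "f x \<noteq> 0" if "x \<in> S" for x using assms(3)[OF that] by simp
  have inv: "Ck_on k S (\<lambda>x. inverse (f x))"
    by (rule Ck_on_inverse[OF assms(1) Ck_on_Suc_imp nz]) (use assms(2) in \<open>simp_all only: Suc\<close>)
  note pd = partial_deriv_chain[OF d DERIV_ln[OF assms(3)]]
  have "Ck_on k S (partial_deriv i (\<lambda>x. ln (f x)))" for i
  proof (rule Ck_on_cong[OF assms(1) pd(2)[symmetric]])
    show "Ck_on k S (\<lambda>x. inverse (f x) * partial_deriv i f x)"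
      using assms(2) by (intro Ck_on_mult[OF assms(1)] inv) (simp add: Suc)
  qed
  with pd(1) show ?thesis unfolding Suc by (simp only: Ck_on.simps) blast
qed

lemmas Ck_on_intros = Ck_on_const Ck_on_component Ck_on_add Ck_on_mult Ck_on_sum Ck_on_minus
  Ck_on_diff Ck_on_exp Ck_on_inverse Ck_on_ln

lemma Ck_on_norm_power2:
  assumes "open S" "\<And>j. Ck_on m S (\<lambda>x. f x $ j)"
  shows "Ck_on m S (\<lambda>x. (norm (f x :: real^'n::finite))\<^sup>2)"
  unfolding power2_norm_eq_inner inner_vec_def
  by (auto intro!: Ck_on_intros assms)

text \<open>By the chain rule a partial derivative of the composition is a finite sum of products;
  the factors of the form (partial derivative of f) composed with G fall under the induction
  hypothesis because f is arbitrary there.\<close>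

lemma Ck_on_compose:
  fixes G :: "real^'n::finite \<Rightarrow> real^'m::finite"
  assumes S: "open S" and U: "open U" and GU: "\<And>x. x \<in> S \<Longrightarrow> G x \<in> U"
    and "Ck_on m U f" "\<And>j. Ck_on m S (\<lambda>x. G x $ j)"
  shows "Ck_on m S (\<lambda>x. f (G x))"
  using assms(4,5)
proof (induction m arbitrary: f)
  case 0
  have "continuous_on S G"
    using 0 continuous_on_vec_lambda[of S "\<lambda>j x. G x $ j"] by (simp add: vec_lambda_beta)
  then show ?case
    using continuous_on_compose2[of U f S G] 0 GU by auto
next
  case (Suc m)
  have pd: "(\<lambda>x. f (G x)) differentiable (at x) \<and>
    partial_deriv i (\<lambda>x. f (G x)) x = (\<Sum>j\<in>UNIV. partial_deriv j f (G x) * partial_deriv i (\<lambda>x. G x $ j) x)"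
    if x: "x \<in> S" for x i
  proof -
    have "\<exists>G'. ((\<lambda>x. G x $ j) has_derivative G') (at x)" for j
      using Suc.prems(2)[of j] x by (auto simp: differentiable_def)
    then obtain G' where G': "\<And>j. ((\<lambda>x. G x $ j) has_derivative G' j) (at x)" by metis
    have dG: "(G has_derivative (\<lambda>h. \<chi> j. G' j h)) (at x)"
      unfolding has_derivative_componentwise_within[of G] 
      using G' by (simp add: Basis_vec_def inner_axis)
    obtain f' where f': "(f has_derivative f') (at (G x))"
      using Suc.prems(1) GU[OF x] by (auto simp: differentiable_def)
    interpret f': linear f' using f' has_derivative_linear by blast
    have d: "((\<lambda>x. f (G x)) has_derivative (\<lambda>h. f' (\<chi> j. G' j h))) (at x)"
      using has_derivative_compose[OF dG f'] .
    have "f' (\<chi> j. G' j h) = (\<Sum>j\<in>UNIV. f' (axis j 1) * G' j h)" for h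
    proof -
      have "f' (\<chi> j. G' j h) = f' (\<Sum>j\<in>UNIV. G' j h *\<^sub>R axis j 1)"
        by (rule arg_cong[where f=f']) (simp add: vec_eq_iff axis_def mult_delta_right)
      then show ?thesis by (simp add: f'.sum f'.scale mult.commute)
    qed
    with d show ?thesis
      by (simp add: differentiable_def partial_deriv_eq[OF f'] partial_deriv_eq[OF G'] partial_deriv_eq[OF d]) blast
  qed
  have "Ck_on m S (partial_deriv i (\<lambda>x. f (G x)))" for i
  proof (rule Ck_on_cong[OF S])
    show "(\<Sum>j\<in>UNIV. partial_deriv j f (G x) * partial_deriv i (\<lambda>x. G x $ j) x) = partial_deriv i (\<lambda>x. f (G x)) x"
      if "x \<in> S" for x using pd[OF that] by simp
    show "Ck_on m S (\<lambda>x. \<Sum>j\<in>UNIV. partial_deriv j f (G x) * partial_deriv i (\<lambda>x. G x $ j) x)"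
    proof (rule Ck_on_sum[OF S], rule Ck_on_mult[OF S])
      show "Ck_on m S (\<lambda>x. partial_deriv j f (G x))" for j
        by (rule Suc.IH[OF _ Ck_on_Suc_imp[OF Suc.prems(2)]]) (use Suc.prems(1) in simp)
      show "Ck_on m S (partial_deriv i (\<lambda>x. G x $ j))" for j
        using Suc.prems(2)[of j] by simp
    qed
  qed
  with pd show ?case by simp
qed

section \<open>Integration by parts and ground states\<close>

lemma partial_deriv_eq_0:
  assumes "open S" "x \<in> S" "\<And>y. y \<in> S \<Longrightarrow> f y = 0"
  shows "partial_deriv i f x = 0"
proof -
  have "((\<lambda>y. 0) has_derivative (\<lambda>h. 0)) (at x)" by simp
  from has_derivative_transform_open[OF assms(1,2) _ this, of f] assms(3)
  have "(f has_derivative (\<lambda>h. 0)) (at x)" by simp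
  then show ?thesis by (simp add: partial_deriv_eq)
qed

lemma integrable_compact_support:
  fixes f :: "real^'n::finite \<Rightarrow> real"
  assumes "compact K" "continuous_on K f" "\<And>x. x \<notin> K \<Longrightarrow> f x = 0"
  shows "integrable lborel f"
proof -
  have "f = (\<lambda>x. indicator K x *\<^sub>R f x)"
    using assms(3) by (auto simp: indicator_def fun_eq_iff)
  then show ?thesis using borel_integrable_compact[OF assms(1,2)] by simp
qed

lemma has_real_derivative_along_axis:
  fixes f :: "real^'n::finite \<Rightarrow> real"
  assumes "f differentiable (at (x + t *\<^sub>R axis i 1))"
  shows "((\<lambda>t. f (x + t *\<^sub>R axis i 1)) has_real_derivative partial_deriv i f (x + t *\<^sub>R axis i 1)) (at t)"
proof -
  obtain f' where f': "(f has_derivative f') (at (x + t *\<^sub>R axis i 1))"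
    using assms by (auto simp: differentiable_def)
  have "((\<lambda>t. x + t *\<^sub>R axis i 1) has_derivative (\<lambda>h. h *\<^sub>R axis i 1)) (at t)"
    by (auto intro!: derivative_eq_intros)
  from has_derivative_compose[OF this f']
  have "((\<lambda>t. f (x + t *\<^sub>R axis i 1)) has_derivative (\<lambda>h. f' (h *\<^sub>R axis i 1))) (at t)" .
  moreover have "(\<lambda>h. f' (h *\<^sub>R axis i 1)) = (*) (partial_deriv i f (x + t *\<^sub>R axis i 1))"
    using linear_scale[OF has_derivative_linear[OF f']] partial_deriv_eq[OF f']
    by (intro ext) (simp add: mult.commute)
  ultimately show ?thesis by (simp add: has_field_derivative_def)
qed

lemma lborel_integral_translate:
  fixes f :: "real^'n::finite \<Rightarrow> real"
  assumes "f \<in> borel_measurable borel"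
  shows "(LINT x|lborel. f (x + a)) = (LINT x|lborel. f x)"
proof -
  have "(LINT x|lborel. f x) = (LINT x|distr lborel borel (\<lambda>x. a + x). f x)"
    by (simp add: lborel_distr_plus)
  also have "\<dots> = (LINT x|lborel. f (a + x))"
    by (rule integral_distr) (use assms in auto)
  finally show ?thesis by (simp add: add.commute)
qed

text \<open>Every difference quotient integrates to 0 by translation invariance, and dominated
  convergence passes to the derivative.\<close>

lemma integral_partial_deriv_eq_0:
  fixes f :: "real^'n::finite \<Rightarrow> real"
  assumes f: "Ck (Suc 0) f" and K: "compact K" "\<And>x. x \<notin> K \<Longrightarrow> f x = 0"
  shows "(LINT x|lborel. partial_deriv i f x) = 0"
proof -
  let ?e = "axis i 1 :: real^'n"
  have d: "f differentiable (at x)" for x using f by simp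
  have cd: "continuous_on UNIV (partial_deriv i f)" using f by simp
  have cf: "continuous_on UNIV f"
    using Ck_on_imp_continuous[of "Suc 0" UNIV f] f Ck_eq_Ck_on by blast
  have fm: "f \<in> borel_measurable borel" by (rule borel_measurable_continuous_onI[OF cf])
  have fi: "integrable lborel f"
    by (rule integrable_compact_support[OF K(1) _ K(2)]) (use cf continuous_on_subset in blast)
  have pd0: "partial_deriv i f x = 0" if "x \<notin> K" for x
    by (rule partial_deriv_eq_0[of "- K"]) (use that K compact_imp_closed in auto)
  obtain B where B: "\<And>x. \<bar>partial_deriv i f x\<bar> \<le> B" "B \<ge> 0"
  proof -
    have "compact (partial_deriv i f ` K)"
      using K(1) cd continuous_on_subset by (blast intro: compact_continuous_image)
    then obtain B where B: "\<And>x. x \<in> K \<Longrightarrow> \<bar>partial_deriv i f x\<bar> \<le> B"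
      using compact_imp_bounded[of "partial_deriv i f ` K"] by (auto simp: bounded_iff)
    have "\<bar>partial_deriv i f x\<bar> \<le> max B 0" for x
      using B[of x] pd0[of x] by (cases "x \<in> K") auto
    then show ?thesis using that[of "max B 0"] by auto
  qed
  obtain R where R: "\<And>x. x \<in> K \<Longrightarrow> norm x \<le> R"
    using compact_imp_bounded[OF K(1)] by (auto simp: bounded_iff)
  \<comment> \<open>Steps in (0,1] keep the shifted supports inside the ball of radius R + 1, and
    the mean value theorem bounds the quotients by B there; this gives the dominating
    function.\<close>
  define h where "h = (\<lambda>m. inverse (real (Suc m)))"
  have h: "0 < h m" "h m \<le> 1" for m by (auto simp: h_def field_simps)
  define q where "q = (\<lambda>m x. (f (x + h m *\<^sub>R ?e) - f x) / h m)"
  have qm: "q m \<in> borel_measurable lborel" for m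
  proof -
    have "continuous_on UNIV (q m)" unfolding q_def
      using h(1)[of m] by (intro continuous_intros continuous_on_compose2[OF cf]) auto
    then show ?thesis using borel_measurable_continuous_onI by auto
  qed
  have qi: "(LINT x|lborel. q m x) = 0" for m
  proof -
    have "integrable lborel (\<lambda>x. f (x + h m *\<^sub>R ?e))"
    proof (rule integrable_compact_support)
      show "compact ((\<lambda>x. x - h m *\<^sub>R ?e) ` K)"
        by (intro compact_continuous_image K continuous_intros)
      show "f (x + h m *\<^sub>R ?e) = 0" if "x \<notin> (\<lambda>x. x - h m *\<^sub>R ?e) ` K" for x
        by (rule K(2)) (use that in \<open>auto simp: image_iff\<close>)
    qed (intro continuous_intros continuous_on_compose2[OF cf], auto)
    then show ?thesis
      using fi lborel_integral_translate[OF fm, of "h m *\<^sub>R ?e"] by (simp add: q_def)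
  qed
  have "(\<lambda>m. LINT x|lborel. q m x) \<longlonglongrightarrow> (LINT x|lborel. partial_deriv i f x)"
  proof (rule integral_dominated_convergence[where w="\<lambda>x. B * indicator (cball 0 (R + 1)) x"])
    show "partial_deriv i f \<in> borel_measurable lborel"
      using borel_measurable_continuous_onI[OF cd] by simp
    show "integrable lborel (\<lambda>x. B * indicator (cball (0::real^'n) (R + 1)) x)"
      by (intro integrable_mult_right integrable_real_indicator emeasure_lborel_cball_finite) auto
    show "AE x in lborel. (\<lambda>m. q m x) \<longlonglongrightarrow> partial_deriv i f x"
    proof (rule AE_I2)
      fix x :: "real^'n"
      have "((\<lambda>t. f (x + t *\<^sub>R ?e)) has_real_derivative partial_deriv i f (x + 0 *\<^sub>R ?e)) (at 0)"
        by (rule has_real_derivative_along_axis[OF d])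
      then have "((\<lambda>t. (f (x + t *\<^sub>R ?e) - f x) / t) \<longlongrightarrow> partial_deriv i f x) (at 0)"
        by (simp add: DERIV_def)
      moreover have "filterlim h (at 0) sequentially"
        unfolding filterlim_at using h(1) LIMSEQ_inverse_real_of_nat
        by (auto simp: h_def intro!: always_eventually)
      ultimately show "(\<lambda>m. q m x) \<longlonglongrightarrow> partial_deriv i f x"
        unfolding q_def by (rule filterlim_compose)
    qed
    show "AE x in lborel. norm (q m x) \<le> B * indicator (cball 0 (R + 1)) x" for m
    proof (rule AE_I2)
      fix x :: "real^'n"
      show "norm (q m x) \<le> B * indicator (cball 0 (R + 1)) x"
      proof (cases "x \<in> cball 0 (R + 1)")
        case True
        obtain z where "f (x + h m *\<^sub>R ?e) - f (x + 0 *\<^sub>R ?e) = (h m - 0) * partial_deriv i f (x + z *\<^sub>R ?e)"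
          using MVT2[of 0 "h m" "\<lambda>t. f (x + t *\<^sub>R ?e)" "\<lambda>t. partial_deriv i f (x + t *\<^sub>R ?e)"]
            has_real_derivative_along_axis[OF d] h(1)[of m] by blast
        then have "q m x = partial_deriv i f (x + z *\<^sub>R ?e)"
          using h(1)[of m] by (simp add: q_def)
        with True B show ?thesis by simp
      next
        case False
        have "norm (h m *\<^sub>R ?e) \<le> 1" using h[of m] by simp
        then have "norm (x + h m *\<^sub>R ?e) > R" "norm x > R"
          using False norm_triangle_ineq2[of x "- (h m *\<^sub>R ?e)"] by auto
        then have "x + h m *\<^sub>R ?e \<notin> K" "x \<notin> K" using R by (meson not_less)+
        with False K(2) show ?thesis by (simp add: q_def)
      qed
    qed
  qed (fact qm)
  then show ?thesis using LIMSEQ_unique[OF _ tendsto_const] by (simp add: qi)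
qed

text \<open>A relation instead of a function, so that the rules below establish differentiability
  and the trace of the derivative together.\<close>

definition has_div :: "(real^'n::finite \<Rightarrow> real^'n) \<Rightarrow> real \<Rightarrow> real^'n \<Rightarrow> bool" where
  "has_div F d x \<longleftrightarrow> (\<exists>F'. (F has_derivative F') (at x) \<and> (\<Sum>i\<in>UNIV. F' (axis i 1) $ i) = d)"

lemma has_div_add: "has_div F c x \<Longrightarrow> has_div G d x \<Longrightarrow> has_div (\<lambda>x. F x + G x) (c + d) x"
  unfolding has_div_def by (force intro!: has_derivative_add simp: sum.distrib)

lemma has_div_diff: "has_div F c x \<Longrightarrow> has_div G d x \<Longrightarrow> has_div (\<lambda>x. F x - G x) (c - d) x"
  unfolding has_div_def by (force intro!: has_derivative_diff simp: sum_subtractf)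

lemma has_div_const: "has_div (\<lambda>x. c) 0 x"
  unfolding has_div_def by (force intro!: has_derivative_const)

lemma has_div_id: "has_div (\<lambda>x::real^'n::finite. x) (real CARD('n)) x"
  unfolding has_div_def by (rule exI[of _ "\<lambda>h. h"]) simp

lemma has_div_scaleR:
  assumes "(f has_derivative (\<lambda>h. a \<bullet> h)) (at x)" "has_div F d x"
  shows "has_div (\<lambda>x. f x *\<^sub>R F x) (a \<bullet> F x + f x * d) x"
proof -
  obtain F' where F': "(F has_derivative F') (at x)" "(\<Sum>i\<in>UNIV. F' (axis i 1) $ i) = d"
    using assms(2) unfolding has_div_def by blast
  have "(\<Sum>i\<in>UNIV. (f x *\<^sub>R F' (axis i 1) + (a \<bullet> axis i 1) *\<^sub>R F x) $ i) = a \<bullet> F x + f x * d"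
    by (simp add: sum.distrib F'(2)[symmetric] sum_distrib_left inner_axis inner_vec_def[of a "F x"])
  with has_derivative_scaleR[OF assms(1) F'(1)] show ?thesis
    unfolding has_div_def by (intro exI conjI)
qed

lemma has_div_component:
  assumes "has_div F d x"
  shows "(\<lambda>x. F x $ i) differentiable (at x)" "(\<Sum>i\<in>UNIV. partial_deriv i (\<lambda>x. F x $ i) x) = d"
proof -
  obtain F' where F': "(F has_derivative F') (at x)" "(\<Sum>i\<in>UNIV. F' (axis i 1) $ i) = d"
    using assms unfolding has_div_def by blast
  have c: "((\<lambda>x. F x $ i) has_derivative (\<lambda>h. F' h $ i)) (at x)" for i
    by (rule bounded_linear.has_derivative[OF bounded_linear_vec_nth F'(1)])
  then show "(\<lambda>x. F x $ i) differentiable (at x)" by (auto simp: differentiable_def)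
  show "(\<Sum>i\<in>UNIV. partial_deriv i (\<lambda>x. F x $ i) x) = d"
    by (simp add: partial_deriv_eq[OF c] F'(2))
qed

lemma grad_inner:
  assumes "(f has_derivative f') (at x)"
  shows "grad f x \<bullet> h = f' h"
proof -
  interpret f': linear f' using assms has_derivative_linear by blast
  have "f' h = f' (\<Sum>j\<in>UNIV. h $ j *\<^sub>R axis j 1)"
    by (rule arg_cong[where f=f']) (simp add: vec_eq_iff axis_def mult_delta_right)
  then show ?thesis
    by (simp add: f'.sum f'.scale inner_vec_def grad_def partial_deriv_eq[OF assms] mult.commute)
qed

text \<open>Ground state substitution: if $F = \nabla \log \Phi$ then
  $\nabla u - u F = \Phi \nabla (u / \Phi)$ and $\mathrm{div} F + |F|^2 = \Delta \Phi / \Phi$.\<close>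
lemma ground_state_identity:
  fixes u :: "real^'n::finite \<Rightarrow> real"
  assumes U: "open U" and K: "compact K" "K \<subseteq> U" and u: "Ck (Suc 0) u" "\<And>x. x \<notin> K \<Longrightarrow> u x = 0"
    and F: "\<And>j. Ck_on (Suc 0) U (\<lambda>x. F x $ j)" and d: "\<And>x. x \<in> U \<Longrightarrow> has_div F (d x) x"
  shows "integrable lborel (\<lambda>x. (norm (grad u x))\<^sup>2)"
    and "integrable lborel (\<lambda>x. (norm (grad u x - u x *\<^sub>R F x))\<^sup>2)"
    and "integrable lborel (\<lambda>x. (u x)\<^sup>2 * (d x + (norm (F x))\<^sup>2))"
    and "(LINT x|lborel. (norm (grad u x))\<^sup>2) = (LINT x|lborel. (norm (grad u x - u x *\<^sub>R F x))\<^sup>2)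
       - (LINT x|lborel. (u x)\<^sup>2 * (d x + (norm (F x))\<^sup>2))"
proof -
  have clK: "open (- K)" using K compact_imp_closed by auto
  have grad0: "grad u x = 0" if "x \<notin> K" for x
    using partial_deriv_eq_0[OF clK, of x u] that u(2) by (simp add: grad_def vec_eq_iff)
  have cu: "continuous_on K u"
    using Ck_on_imp_continuous[of "Suc 0" UNIV u] u Ck_eq_Ck_on continuous_on_subset by blast
  have "continuous_on UNIV (grad u)"
    unfolding grad_def using u by (intro continuous_on_vec_lambda) simp
  then have cg: "continuous_on K (grad u)" using continuous_on_subset by blast
  have "continuous_on U (\<lambda>x. \<chi> j. F x $ j)"
    using Ck_on_imp_continuous[OF F] by (intro continuous_on_vec_lambda)
  then have cF: "continuous_on K F" using K(2) continuous_on_subset by (simp add: vec_lambda_eta) blast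
  have cd: "continuous_on K d"
  proof (rule continuous_on_eq)
    show "continuous_on K (\<lambda>x. \<Sum>i\<in>UNIV. partial_deriv i (\<lambda>x. F x $ i) x)"
      using F K(2) continuous_on_subset by (intro continuous_on_sum) (simp, blast)
  qed (use has_div_component(2)[OF d] K(2) in auto)
  show 1: "integrable lborel (\<lambda>x. (norm (grad u x))\<^sup>2)"
    by (rule integrable_compact_support[OF K(1)]) (auto intro!: continuous_intros cg simp: grad0)
  show 2: "integrable lborel (\<lambda>x. (norm (grad u x - u x *\<^sub>R F x))\<^sup>2)"
    by (rule integrable_compact_support[OF K(1)]) (auto intro!: continuous_intros cg cu cF simp: grad0 u(2))
  show 3: "integrable lborel (\<lambda>x. (u x)\<^sup>2 * (d x + (norm (F x))\<^sup>2))"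
    by (rule integrable_compact_support[OF K(1)]) (auto intro!: continuous_intros cd cu cF simp: u(2))
  \<comment> \<open>These are the components of u^2 F, whose divergence integrates to 0. Regularity
    of F is known only on U, but u vanishes off K, so the product is of class C^1
    everywhere.\<close>
  define f where "f = (\<lambda>i x. u x * u x * F x $ i)"
  have fC: "Ck (Suc 0) (f i)" for i
  proof -
    have "Ck_on (Suc 0) U u" using u(1) Ck_on_subset unfolding Ck_eq_Ck_on by blast
    then have "Ck_on (Suc 0) U (f i)"
      unfolding f_def by (intro Ck_on_mult U F)
    moreover have "Ck_on (Suc 0) (- K) (f i)"
      by (rule Ck_on_cong[OF clK _ Ck_on_const[of _ _ 0]]) (simp add: f_def u(2))
    ultimately have "Ck_on (Suc 0) (U \<union> - K) (f i)" by (rule Ck_on_Un[OF U clK])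
    moreover have "U \<union> - K = UNIV" using K(2) by auto
    ultimately show ?thesis by (simp only: Ck_eq_Ck_on)
  qed
  have f0: "f i x = 0" if "x \<notin> K" for i x using that u(2) by (simp add: f_def)
  have pd0: "partial_deriv i (f i) x = 0" if "x \<notin> K" for i x
    using partial_deriv_eq_0[OF clK, of x "f i"] that f0 by simp
  have fi: "integrable lborel (partial_deriv i (f i))" for i
  proof (rule integrable_compact_support[OF K(1)])
    have "continuous_on UNIV (partial_deriv i (f i))" using fC[of i] unfolding Ck.simps by blast
    then show "continuous_on K (partial_deriv i (f i))" by (rule continuous_on_subset) simp
  qed (use pd0 in auto)
  have "(LINT x|lborel. (\<Sum>i\<in>UNIV. partial_deriv i (f i) x)) = 0"
    using fi integral_partial_deriv_eq_0[OF fC K(1) f0] by simp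
  \<comment> \<open>After expanding the square, its cross term and the term in d add up to minus the
    divergence of u^2 F.\<close>
  moreover have "(norm (grad u x))\<^sup>2 = (norm (grad u x - u x *\<^sub>R F x))\<^sup>2 - (u x)\<^sup>2 * (d x + (norm (F x))\<^sup>2)
      + (\<Sum>i\<in>UNIV. partial_deriv i (f i) x)" for x
  proof (cases "x \<in> K")
    case False then show ?thesis by (simp add: grad0 u(2) pd0)
  next
    case True
    then have x: "x \<in> U" using K(2) by auto
    obtain u' where u': "(u has_derivative u') (at x)"
      using u(1) by (auto simp: differentiable_def)
    have "partial_deriv i (f i) x = 2 * u x * (grad u x $ i * F x $ i) + (u x)\<^sup>2 * partial_deriv i (\<lambda>x. F x $ i) x" for i
    proof -
      obtain G where G: "((\<lambda>x. F x $ i) has_derivative G) (at x)"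
        using has_div_component(1)[OF d[OF x]] by (auto simp: differentiable_def)
      show ?thesis
        unfolding f_def partial_deriv_eq[OF has_derivative_mult[OF has_derivative_mult[OF u' u'] G]]
        by (simp add: grad_def partial_deriv_eq[OF u'] partial_deriv_eq[OF G] algebra_simps power2_eq_square)
    qed
    then have "(\<Sum>i\<in>UNIV. partial_deriv i (f i) x) = 2 * u x * (grad u x \<bullet> F x) + (u x)\<^sup>2 * d x"
      using has_div_component(2)[OF d[OF x]]
      by (simp add: sum.distrib inner_vec_def sum_distrib_left[symmetric])
    moreover have "(norm (grad u x - u x *\<^sub>R F x))\<^sup>2
        = (norm (grad u x))\<^sup>2 - 2 * u x * (grad u x \<bullet> F x) + (u x)\<^sup>2 * (norm (F x))\<^sup>2"
      unfolding power2_norm_eq_inner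
      by (simp add: inner_diff_left inner_diff_right inner_commute power2_eq_square)
    ultimately show ?thesis by (simp add: algebra_simps)
  qed
  ultimately show "(LINT x|lborel. (norm (grad u x))\<^sup>2) = (LINT x|lborel. (norm (grad u x - u x *\<^sub>R F x))\<^sup>2)
       - (LINT x|lborel. (u x)\<^sup>2 * (d x + (norm (F x))\<^sup>2))"
    using 2 3 fi by (simp add: fun_eq_iff)
qed

section \<open>Change of variables\<close>

text \<open>The library proves the change of variables formula only for well-ordered index types; every
  finite type has a well-ordered copy.\<close>

typedef 'a wo = "UNIV :: 'a set" morphisms of_wo to_wo by auto

lemma bij_of_wo: "bij of_wo" and bij_to_wo: "bij to_wo"
  by (metis bij_betw_def inj_on_inverseI surjI UNIV_I of_wo_inverse to_wo_inverse)+

instance wo :: (finite) finite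
proof
  have "finite (range (to_wo :: 'a \<Rightarrow> 'a wo))" by simp
  then show "finite (UNIV :: 'a wo set)" by (simp only: bij_is_surj[OF bij_to_wo])
qed

text \<open>An arbitrary numbering supplies the order; well-foundedness is inherited from the
  natural numbers.\<close>

definition wo_index :: "'a::finite wo \<Rightarrow> nat" where "wo_index = (SOME f. inj f)"

lemma inj_wo_index: "inj (wo_index :: 'a::finite wo \<Rightarrow> nat)"
proof -
  have "\<exists>f :: 'a wo \<Rightarrow> nat. inj f"
    using finite_imp_inj_to_nat_seg[OF finite_class.finite_UNIV] by (metis (mono_tags))
  then show ?thesis unfolding wo_index_def by (rule someI_ex)
qed

instantiation wo :: (finite) wellorder
begin

definition less_eq_wo :: "'a wo \<Rightarrow> 'a wo \<Rightarrow> bool" where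
  "less_eq_wo x y \<longleftrightarrow> wo_index x \<le> wo_index y"

definition less_wo :: "'a wo \<Rightarrow> 'a wo \<Rightarrow> bool" where
  "less_wo x y \<longleftrightarrow> wo_index x < wo_index y"

instance
proof
  fix P :: "'a wo \<Rightarrow> bool" and a
  assume *: "\<And>x. (\<And>y. y < x \<Longrightarrow> P y) \<Longrightarrow> P x"
  show "P a"
    by (induction a rule: measure_induct_rule[of wo_index]) (rule *, simp add: less_wo_def)
qed (auto simp: less_eq_wo_def less_wo_def dest: injD[OF inj_wo_index])

end

text \<open>Conjugation with f is a sign-preserving bijection between the permutations of the two
  index types, so the Leibniz sums agree term by term.\<close>

lemma det_reindex:
  fixes A :: "'a::comm_ring_1^'n::finite^'n" and f :: "'m::finite \<Rightarrow> 'n"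
  assumes "bij f"
  shows "det (\<chi> i j. A $ f i $ f j) = det A"
proof -
  define h where "h = map_permutation (UNIV::'m set) f"
  have f: "inj f" "range f = UNIV" using assms by (auto simp: bij_def)
  have happ: "h p (f i) = f (p i)" for p i
    unfolding h_def by (rule map_permutation_apply) (use f in auto)
  have perm: "h p permutes UNIV \<longleftrightarrow> p permutes UNIV" for p
    unfolding h_def using map_permutation_permutes_iff[of f UNIV UNIV p] assms by auto
  have "bij_betw h {p. p permutes UNIV} {p. p permutes UNIV}"
  proof (rule bij_betwI')
    show "(h p = h q) = (p = q)" for p q
      using happ[of p] happ[of q] f(1) by (metis ext injD)
    show "\<exists>p\<in>{p. p permutes UNIV}. q = h p" if "q \<in> {p. p permutes UNIV}" for q
    proof
      have "h (inv f \<circ> q \<circ> f) (f i) = q (f i)" for i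
        using happ f by (simp add: surj_f_inv_f)
      then show q: "q = h (inv f \<circ> q \<circ> f)"
        using f(2) by (metis ext rangeE UNIV_I)
      show "inv f \<circ> q \<circ> f \<in> {p. p permutes UNIV}"
        using that q perm[of "inv f \<circ> q \<circ> f"] by simp
    qed
  qed (use perm in auto)
  then have "det A = (\<Sum>p | p permutes (UNIV::'m set). of_int (sign (h p)) * (\<Prod>i\<in>UNIV. A $ i $ h p i))"
    unfolding det_def by (rule sum.reindex_bij_betw[symmetric])
  also have "\<dots> = (\<Sum>p | p permutes (UNIV::'m set). of_int (sign p) * (\<Prod>i\<in>UNIV. A $ f i $ f (p i)))"
  proof (rule sum.cong[OF refl])
    fix p assume "p \<in> {p. p permutes (UNIV::'m set)}"
    then have "sign (h p) = sign p"
      unfolding h_def using sign_map_permutation[of f UNIV p] f by auto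
    moreover have "(\<Prod>i\<in>UNIV. A $ i $ h p i) = (\<Prod>i\<in>UNIV. A $ f i $ h p (f i))"
      by (rule prod.reindex_bij_betw[OF assms, symmetric])
    ultimately show "of_int (sign (h p)) * (\<Prod>i\<in>UNIV. A $ i $ h p i) = of_int (sign p) * (\<Prod>i\<in>UNIV. A $ f i $ f (p i))"
      by (simp add: happ)
  qed
  also have "\<dots> = det (\<chi> i j. A $ f i $ f j)" unfolding det_def by simp
  finally show ?thesis by simp
qed

text \<open>Naming the transformed integrand E and requiring it to be Borel lets the statement,
  which first arises for the completed measure, descend to \<open>lborel\<close>.\<close>

lemma lborel_integral_change_of_variables_wellorder:
  fixes F E :: "real^'n::{finite,wellorder} \<Rightarrow> real" and g :: "real^'n::_ \<Rightarrow> real^'n::_"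
  assumes S: "S \<in> sets lebesgue"
    and g: "\<And>x. x \<in> S \<Longrightarrow> (g has_derivative g' x) (at x)" and inj: "inj_on g S"
    and F: "integrable lborel F" "\<And>y. y \<notin> g ` S \<Longrightarrow> F y = 0"
    and E: "E \<in> borel_measurable borel" "\<And>x. x \<in> S \<Longrightarrow> E x = \<bar>det (matrix (g' x))\<bar> * F (g x)"
      "\<And>x. x \<notin> S \<Longrightarrow> E x = 0"
  shows "integrable lborel E \<and> (LINT x|lborel. E x) = (LINT y|lborel. F y)"
proof -
  have Fm: "F \<in> borel_measurable lborel" using F(1) by auto
  have Fl: "integrable lebesgue F" using F(1) Fm by (simp add: integrable_completion)
  have restr: "(\<lambda>y. indicat_real (g ` S) y *\<^sub>R F y) = F" 
    using F(2) by (auto simp: indicator_def fun_eq_iff)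
  then have Fa: "F absolutely_integrable_on (g ` S)" 
    unfolding set_integrable_def using Fl by simp
  have Fi: "integral (g ` S) F = (LINT y|lborel. F y)"
    using set_lebesgue_integral_eq_integral(2)[OF Fa] Fm restr
    by (simp add: set_lebesgue_integral_def integral_completion)
  \<comment> \<open>The formula applied below concerns vector-valued functions; real values are
    treated as vectors with one component.\<close>
  let ?F = "\<lambda>y. vec (F y) :: real^1"
  have vF: "?F absolutely_integrable_on (g ` S)" "integral (g ` S) ?F = vec (integral (g ` S) F)"
    using Fa by (simp_all add: absolutely_integrable_on_1_iff integral_on_1_eq)
  have "(\<lambda>x. \<bar>det (matrix (g' x))\<bar> *\<^sub>R ?F (g x)) absolutely_integrable_on S \<and>
      integral S (\<lambda>x. \<bar>det (matrix (g' x))\<bar> *\<^sub>R ?F (g x)) = vec (integral (g ` S) F)"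
    using has_absolute_integral_change_of_variables[OF S has_derivative_at_withinI[OF g] inj, of ?F] vF by blast
  then have "(\<lambda>x. \<bar>det (matrix (g' x))\<bar> * F (g x)) absolutely_integrable_on S"
      "integral S (\<lambda>x. \<bar>det (matrix (g' x))\<bar> * F (g x)) = integral (g ` S) F"
    by (simp_all add: absolutely_integrable_on_1_iff integral_on_1_eq)
  moreover have "(\<lambda>x. indicat_real S x *\<^sub>R (\<bar>det (matrix (g' x))\<bar> * F (g x))) = E"
    using E by (auto simp: indicator_def fun_eq_iff)
  ultimately have "integrable lebesgue E" "(LINT x|lebesgue. E x) = integral (g ` S) F"
    using set_lebesgue_integral_eq_integral(2)[of S "\<lambda>x. \<bar>det (matrix (g' x))\<bar> * F (g x)"]
    by (simp_all add: set_integrable_def set_lebesgue_integral_def)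
  with E(1) Fi show ?thesis
    by (simp add: integrable_completion integral_completion)
qed

section \<open>Invariance of Lebesgue measure under relabelling of coordinates\<close>

lemma prod_Basis_cart: "(\<Prod>b\<in>Basis. f b) = (\<Prod>i\<in>UNIV. f (axis i (1::real) :: real^'n::finite))"
proof -
  have B: "(Basis :: (real^'n) set) = range (\<lambda>i. axis i 1)"
    by (auto simp: Basis_vec_def)
  have "inj (\<lambda>i. axis i 1 :: real^'n)" by (auto intro!: injI simp: axis_eq_axis)
  then show ?thesis unfolding B by (subst prod.reindex) simp_all
qed

text \<open>Lebesgue measure is determined by its values on boxes, and the preimage of a box is a
  box with the same side lengths in another order.\<close>

lemma lborel_distr_reindex:
  fixes f :: "'m::finite \<Rightarrow> 'n::finite"
  assumes f: "bij f"
  shows "distr lborel borel (\<lambda>x::real^'n. \<chi> i. x $ f i :: real^'m) = lborel"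
proof (rule lborel_eqI[symmetric])
  let ?T = "\<lambda>x::real^'n. \<chi> i. x $ f i :: real^'m"
  have meas: "?T \<in> borel_measurable borel"
    by (intro borel_measurable_continuous_onI continuous_intros)
  show "sets (distr lborel borel ?T) = sets borel" by simp
  fix l u :: "real^'m"
  assume le: "\<And>b. b \<in> Basis \<Longrightarrow> l \<bullet> b \<le> u \<bullet> b"
  define T' where "T' = (\<lambda>x::real^'m. \<chi> i. x $ inv f i :: real^'n)"
  have ff: "inv f (f i) = i" "f (inv f j) = j" for i j
    using f by (simp_all add: bij_is_inj bij_is_surj surj_f_inv_f)
  have "?T -` box l u = box (T' l) (T' u)"
  proof -
    have "(\<forall>i. l $ i < x $ f i \<and> x $ f i < u $ i) \<longleftrightarrow> (\<forall>j. l $ inv f j < x $ j \<and> x $ j < u $ inv f j)" for x :: "real^'n"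
      by (metis ff)
    then show ?thesis by (auto simp: mem_box_cart T'_def)
  qed
  moreover have "T' l \<bullet> b \<le> T' u \<bullet> b" if "b \<in> Basis" for b
  proof -
    have "l $ i \<le> u $ i" for i
      using le[of "axis i 1"] by (auto simp: Basis_vec_def inner_axis)
    with that show ?thesis by (auto simp: Basis_vec_def T'_def inner_axis)
  qed
  ultimately have "emeasure (distr lborel borel ?T) (box l u) = (\<Prod>b\<in>Basis. (T' u - T' l) \<bullet> b)"
    using meas by (simp add: emeasure_distr emeasure_lborel_box)
  also have "(\<Prod>b\<in>Basis. (T' u - T' l) \<bullet> b) = (\<Prod>i\<in>UNIV. (u - l) $ inv f i)"
    by (simp add: prod_Basis_cart inner_axis T'_def)
  also have "\<dots> = (\<Prod>i\<in>UNIV. (u - l) $ i)"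
    by (rule prod.reindex_bij_betw[OF bij_imp_bij_inv[OF f]])
  also have "\<dots> = (\<Prod>b\<in>Basis. (u - l) \<bullet> b)"
    by (simp add: prod_Basis_cart inner_axis)
  finally show "emeasure (distr lborel borel ?T) (box l u) = (\<Prod>b\<in>Basis. (u - l) \<bullet> b)" .
qed

text \<open>Conjugating g with the relabelling \<open>T\<close> moves the claim to the well-ordered
  copy of the index type; neither the measure nor the determinant changes.\<close>

theorem lborel_integral_change_of_variables:
  fixes F E :: "real^'n::finite \<Rightarrow> real" and g :: "real^'n::_ \<Rightarrow> real^'n::_"
  assumes S: "open S"
    and g: "\<And>x. x \<in> S \<Longrightarrow> (g has_derivative g' x) (at x)" and inj: "inj_on g S"
    and F: "integrable lborel F" "\<And>y. y \<notin> g ` S \<Longrightarrow> F y = 0"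
    and E: "E \<in> borel_measurable borel" "\<And>x. x \<in> S \<Longrightarrow> E x = \<bar>det (matrix (g' x))\<bar> * F (g x)"
      "\<And>x. x \<notin> S \<Longrightarrow> E x = 0"
  shows "integrable lborel E" and "(LINT x|lborel. E x) = (LINT y|lborel. F y)"
proof -
  define T where "T = (\<lambda>x::real^'n. \<chi> i. x $ of_wo i :: real^'n wo)"
  define T' where "T' = (\<lambda>x::real^'n wo. \<chi> i. x $ to_wo i :: real^'n)"
  have TT [simp]: "T (T' y) = y" "T' (T x) = x" for x y
    by (simp_all add: T_def T'_def vec_eq_iff to_wo_inverse of_wo_inverse)
  have dT: "distr lborel borel T' = (lborel :: (real^'n) measure)"
    unfolding T'_def by (rule lborel_distr_reindex[OF bij_to_wo])
  have blT: "bounded_linear T" and blT': "bounded_linear T'"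
    by (auto simp: T_def T'_def vec_eq_iff intro!: linear_conv_bounded_linear[THEN iffD1] linearI)
  have cT: "continuous_on UNIV T" and cT': "continuous_on UNIV T'"
    using blT blT' linear_continuous_on by blast+
  have mT': "T' \<in> borel_measurable lborel"
    using borel_measurable_continuous_onI[OF cT'] by simp
  have int_eq: "(LINT x|lborel. f (T' x)) = (LINT x|lborel. f x)"
    "integrable lborel (\<lambda>x. f (T' x)) \<longleftrightarrow> integrable lborel f"
    if "f \<in> borel_measurable borel" for f :: "real^'n \<Rightarrow> real"
    using integral_distr[OF mT' that] integrable_distr_eq[OF mT' that] dT by simp_all
  define S' where "S' = T' -` S"
  define h where "h = (\<lambda>x. T (g (T' x)))"
  define h' where "h' = (\<lambda>x w. T (g' (T' x) (T' w)))"
  have "open S'" unfolding S'_def by (rule open_vimage[OF S cT'])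
  have hd: "(h has_derivative h' x) (at x)" if "x \<in> S'" for x
  proof -
    have "(g has_derivative g' (T' x)) (at (T' x))" using g that by (auto simp: S'_def)
    from has_derivative_compose[OF bounded_linear_imp_has_derivative[OF blT'] this]
    show ?thesis
      unfolding h_def h'_def by (rule bounded_linear.has_derivative[OF blT])
  qed
  have "inj_on h S'"
    using inj unfolding inj_on_def h_def S'_def by (metis TT vimageE)
  have det: "det (matrix (h' x)) = det (matrix (g' (T' x)))" for x
  proof -
    have ax: "T' (axis j 1) = axis (of_wo j) 1" for j
      by (auto simp: T'_def vec_eq_iff axis_def to_wo_inverse of_wo_inverse)
    have "matrix (h' x) = (\<chi> i j. matrix (g' (T' x)) $ of_wo i $ of_wo j)"
      by (simp add: matrix_def h'_def vec_eq_iff ax) (simp add: T_def)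
    then show ?thesis by (simp add: det_reindex[OF bij_of_wo])
  qed
  have Fm: "F \<in> borel_measurable borel" using F(1) by auto
  have "integrable lborel (\<lambda>x. E (T' x)) \<and> (LINT x|lborel. E (T' x)) = (LINT y|lborel. F (T' y))"
  proof (rule lborel_integral_change_of_variables_wellorder[OF _ hd \<open>inj_on h S'\<close>])
    show "S' \<in> sets lebesgue" using \<open>open S'\<close> by auto
    show "integrable lborel (\<lambda>y. F (T' y))" using int_eq(2)[OF Fm] F(1) by simp
    show "F (T' y) = 0" if "y \<notin> h ` S'" for y
    proof (rule F(2))
      show "T' y \<notin> g ` S"
      proof
        assume "T' y \<in> g ` S"
        then obtain x where "x \<in> S" "T' y = g x" by auto
        then have "y = h (T x)" "T x \<in> S'" by (auto simp: h_def S'_def) (metis TT(1))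
        with that show False by auto
      qed
    qed
    show "(\<lambda>x. E (T' x)) \<in> borel_measurable borel"
      using mT' E(1) by simp
  qed (auto simp: S'_def E(2,3) det h_def)
  with int_eq[OF E(1)] int_eq(1)[OF Fm]
  show "integrable lborel E" "(LINT x|lborel. E x) = (LINT y|lborel. F y)" by simp_all
qed

section \<open>The Hardy inequality in the half-space and the constant $S^*$\<close>

text \<open>Besides being the inversion in the unit sphere, this is the gradient of ln |x|, which is
  why it occurs in every logarithmic gradient below.\<close>

definition inversion :: "real^'n::finite \<Rightarrow> real^'n" where
  "inversion x = inverse ((norm x)\<^sup>2) *\<^sub>R x"

lemma inner_inversion_self: "inversion x \<bullet> inversion x = inverse ((norm x)\<^sup>2)"
  by (cases "x = 0") (simp_all add: inversion_def dot_square_norm power2_eq_square field_simps)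

lemma has_derivative_norm_power2:
  fixes x :: "real^'n::finite"
  shows "((\<lambda>x. (norm (x + c))\<^sup>2) has_derivative (\<lambda>h. (2 *\<^sub>R (x + c)) \<bullet> h)) (at x)"
  unfolding power2_norm_eq_inner by (auto intro!: derivative_eq_intros simp: inner_commute)

text \<open>Derivatives are kept in the form \<open>\<lambda>h. a \<bullet> h\<close>, so that the
  gradient is the vector a and can feed the divergence rules.\<close>

lemma has_derivative_compose_inner:
  assumes "(f has_derivative (\<lambda>h. a \<bullet> h)) (at x)" "(\<phi> has_field_derivative c) (at (f x))"
  shows "((\<lambda>x. \<phi> (f x)) has_derivative (\<lambda>h. (c *\<^sub>R a) \<bullet> h)) (at x)"
  using has_derivative_compose[OF assms(1) assms(2)[unfolded has_field_derivative_def]] by simp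

lemma has_derivative_component: "((\<lambda>x. x $ k) has_derivative (\<lambda>h. axis k 1 \<bullet> h)) (at (x :: real^'n::finite))"
  by (rule has_derivative_eq_rhs[OF bounded_linear_imp_has_derivative[OF bounded_linear_vec_nth]])
    (simp add: inner_axis inner_commute fun_eq_iff)

lemma has_div_inversion:
  fixes x :: "real^'n::finite"
  assumes "x + c \<noteq> 0"
  shows "has_div (\<lambda>x. inversion (x + c)) ((real CARD('n) - 2) * inverse ((norm (x + c))\<^sup>2)) x"
proof -
  define q where "q = (norm (x + c))\<^sup>2"
  have q: "q > 0" using assms by (simp add: q_def)
  have "((\<lambda>x. inverse ((norm (x + c))\<^sup>2)) has_derivative
      (\<lambda>h. (- (inverse q ^ Suc (Suc 0)) *\<^sub>R 2 *\<^sub>R (x + c)) \<bullet> h)) (at x)"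
    unfolding q_def
    by (rule has_derivative_compose_inner[OF has_derivative_norm_power2 DERIV_inverse])
      (use q in \<open>simp add: q_def\<close>)
  from has_div_scaleR[OF this has_div_add[OF has_div_id has_div_const[of c]]]
  have "has_div (\<lambda>x. inversion (x + c)) ((- (inverse q ^ Suc (Suc 0)) *\<^sub>R 2 *\<^sub>R (x + c)) \<bullet> (x + c)
     + inverse q * (real CARD('n) + 0)) x"
    by (simp add: inversion_def q_def)
  moreover have "(- (inverse q ^ Suc (Suc 0)) *\<^sub>R 2 *\<^sub>R (x + c)) \<bullet> (x + c) = - 2 * inverse q"
  proof -
    have "(x + c) \<bullet> (x + c) = q" by (simp add: q_def power2_norm_eq_inner)
    then show ?thesis using q unfolding inner_scaleR_left by (simp add: field_simps)
  qed
  ultimately show ?thesis by (simp add: q_def algebra_simps)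
qed

lemma Ck_on_inversion:
  fixes c :: "real^'n::finite"
  assumes "open S" "\<And>x. x \<in> S \<Longrightarrow> x + c \<noteq> 0"
  shows "Ck_on m S (\<lambda>x. inversion (x + c) $ j)"
proof -
  have "Ck_on m S (\<lambda>x. (x + c) $ j)" for j
    by (simp, intro Ck_on_intros assms)
  then have "Ck_on m S (\<lambda>x. inverse ((norm (x + c))\<^sup>2) * (x + c) $ j)"
    using assms(2) by (intro Ck_on_mult Ck_on_inverse Ck_on_norm_power2 assms(1)) simp_all
  then show ?thesis by (simp add: inversion_def)
qed

section \<open>Test functions and their supports\<close>

lemma set_lebesgue_integral_support:
  assumes "\<And>x. x \<notin> S \<Longrightarrow> f x = 0"
  shows "(LINT x:S|M. f x) = (LINT x|M. (f x :: real))"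
  unfolding set_lebesgue_integral_def
  by (rule Bochner_Integration.integral_cong) (use assms in \<open>auto simp: indicator_def\<close>)

lemma Cc_infinityD:
  assumes "u \<in> Cc_infinity U"
  obtains K where "compact K" "K \<subseteq> U" "\<And>x. x \<notin> K \<Longrightarrow> u x = 0" "\<And>m. Ck m u"
proof
  let ?K = "closure (support_on UNIV u)"
  show "compact ?K" "?K \<subseteq> U" "Ck m u" for m using assms by (auto simp: Cc_infinity_def smooth_def)
  show "u x = 0" if "x \<notin> ?K" for x
    using that closure_subset[of "support_on UNIV u"] by (auto simp: support_on_def)
qed

lemma grad_eq_0_outside:
  assumes "compact K" "\<And>x. x \<notin> K \<Longrightarrow> u x = 0" "x \<notin> K"
  shows "grad u x = 0"
  using partial_deriv_eq_0[of "- K" x u] assms compact_imp_closed by (auto simp: grad_def vec_eq_iff)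

lemma Cc_infinityI:
  assumes "compact K" "K \<subseteq> U" "\<And>x. x \<notin> K \<Longrightarrow> u x = 0" "\<And>m. Ck m u"
  shows "u \<in> Cc_infinity U"
proof -
  have "support_on UNIV u \<subseteq> K" using assms(3) by (auto simp: support_on_def)
  then have "closure (support_on UNIV u) \<subseteq> K"
    using assms(1) closure_minimal compact_imp_closed by blast
  then have "compact (closure (support_on UNIV u))"
    using assms(1) by (metis closed_closure closed_Int_compact inf.absorb1)
  with \<open>closure (support_on UNIV u) \<subseteq> K\<close> assms show ?thesis
    by (auto simp: Cc_infinity_def smooth_def)
qed

text \<open>The gradient of ln (x_k |x|^(-n/2)).\<close>

definition hardy_field :: "'n::finite \<Rightarrow> real^'n \<Rightarrow> real^'n" where
  "hardy_field k x = inverse (x $ k) *\<^sub>R axis k 1 - (real CARD('n) / 2) *\<^sub>R inversion x"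

lemma open_half_space: "open (half_space k)"
  unfolding half_space_def by (intro open_Collect_less continuous_intros)

lemma half_space_not_0: "x \<in> half_space k \<Longrightarrow> x \<noteq> 0"
  by (auto simp: half_space_def)

text \<open>As x_k is harmonic, its squared logarithmic gradient cancels against its divergence. The
  cross term -n/|x|^2 cancels the n/|x|^2 contained in the divergence of the power, so that -n^2/2 +
  n^2/4 = -n^2/4 remains.\<close>

lemma hardy_field_ground_state:
  fixes x :: "real^'n::finite"
  assumes x: "x \<in> half_space k"
  shows "\<exists>d. has_div (hardy_field k) d x \<and> d + (norm (hardy_field k x))\<^sup>2 = - ((real CARD('n))\<^sup>2 / 4 / (norm x)\<^sup>2)"
proof -
  define n where "n = real CARD('n)"
  define q where "q = inverse ((norm x)\<^sup>2)"
  define t where "t = inverse (x $ k)"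
  have xk: "x $ k > 0" using x by (simp add: half_space_def)
  have x0: "x \<noteq> 0" using half_space_not_0[OF x] .
  have "has_div (\<lambda>x. inverse (x $ k) *\<^sub>R axis k 1) ((- (t ^ Suc (Suc 0)) *\<^sub>R axis k 1) \<bullet> axis k (1::real) + t * 0) x"
  proof -
    have "((\<lambda>x. inverse (x $ k)) has_derivative (\<lambda>h. (- (t ^ Suc (Suc 0)) *\<^sub>R axis k 1) \<bullet> h)) (at x)"
      unfolding t_def by (rule has_derivative_compose_inner[OF has_derivative_component DERIV_inverse]) (use xk in simp)
    from has_div_scaleR[OF this has_div_const[of "axis k 1"]] show ?thesis by (simp only: t_def)
  qed
  moreover have "has_div (\<lambda>x. (n / 2) *\<^sub>R inversion x) (0 \<bullet> inversion x + n / 2 * ((n - 2) * q)) x"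
    using has_div_inversion[of x 0] x0
    by (intro has_div_scaleR) (simp_all add: n_def q_def)
  ultimately have div: "has_div (hardy_field k) (- t\<^sup>2 - n / 2 * ((n - 2) * q)) x"
    unfolding hardy_field_def n_def[symmetric]
    using has_div_diff by (fastforce simp: inner_axis power2_eq_square)
  have nrm: "(norm (hardy_field k x))\<^sup>2 = t\<^sup>2 - n * q + n\<^sup>2 / 4 * q"
  proof -
    have "inversion x \<bullet> axis k 1 = q * x $ k" by (simp add: inversion_def inner_axis q_def)
    then have "t * (inversion x \<bullet> axis k 1) = q" using xk by (simp add: t_def)
    moreover have "inversion x \<bullet> inversion x = q" by (simp add: inner_inversion_self q_def)
    ultimately show ?thesis
      unfolding power2_norm_eq_inner hardy_field_def n_def[symmetric] t_def[symmetric]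
      by (simp add: inner_diff_left inner_diff_right inner_commute inner_axis power2_eq_square algebra_simps)
  qed
  have q: "n\<^sup>2 / 4 / (norm x)\<^sup>2 = n\<^sup>2 / 4 * q" by (simp only: q_def divide_inverse)
  have "- t\<^sup>2 - n / 2 * ((n - 2) * q) + (t\<^sup>2 - n * q + n\<^sup>2 / 4 * q) = - (n\<^sup>2 / 4 * q)"
    by (simp add: power2_eq_square algebra_simps)
  then show ?thesis
    unfolding n_def[symmetric] q using div nrm by (metis (no_types))
qed

lemma hardy_identity:
  fixes v :: "real^'n::finite \<Rightarrow> real"
  assumes "v \<in> Cc_infinity (half_space k)"
  shows "integrable lborel (\<lambda>x. (norm (grad v x - v x *\<^sub>R hardy_field k x))\<^sup>2)"
    and "integrable lborel (\<lambda>x. (v x)\<^sup>2 / (norm x)\<^sup>2)"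
    and "(LINT x|lborel. (norm (grad v x))\<^sup>2) = (LINT x|lborel. (norm (grad v x - v x *\<^sub>R hardy_field k x))\<^sup>2)
       + (real CARD('n))\<^sup>2 / 4 * (LINT x|lborel. (v x)\<^sup>2 / (norm x)\<^sup>2)"
proof -
  define n where "n = real CARD('n)"
  obtain K where K: "compact K" "K \<subseteq> half_space k" "\<And>x. x \<notin> K \<Longrightarrow> v x = 0" and v: "\<And>m. Ck m v"
    using Cc_infinityD[OF assms] by metis
  obtain d where d: "\<And>x. x \<in> half_space k \<Longrightarrow> has_div (hardy_field k) (d x) x \<and>
      d x + (norm (hardy_field k x))\<^sup>2 = - (n\<^sup>2 / 4 / (norm x)\<^sup>2)"
    using hardy_field_ground_state unfolding n_def by metis
  have F: "Ck_on (Suc 0) (half_space k) (\<lambda>x. hardy_field k x $ j)" for j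
  proof -
    have i: "Ck_on (Suc 0) (half_space k) (\<lambda>x. inversion x $ j)"
      using Ck_on_inversion[OF open_half_space[of k], of 0 "Suc 0" j] half_space_not_0[of _ k]
      by (simp only: add_0_right not_False_eq_True)
    show ?thesis
      unfolding hardy_field_def vector_minus_component vector_scaleR_component real_scaleR_def
      by (intro Ck_on_diff Ck_on_mult Ck_on_const Ck_on_inverse Ck_on_component open_half_space i)
        (simp add: half_space_def)
  qed
  note gs = ground_state_identity[OF open_half_space K(1,2) v K(3) F, of d]
  have eq: "(v x)\<^sup>2 * (d x + (norm (hardy_field k x))\<^sup>2) = - (n\<^sup>2 / 4) * ((v x)\<^sup>2 / (norm x)\<^sup>2)" for x
  proof (cases "x \<in> K")
    case True
    then have "d x + (norm (hardy_field k x))\<^sup>2 = - (n\<^sup>2 / 4 / (norm x)\<^sup>2)" using d K(2) by blast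
    then show ?thesis by simp
  qed (simp add: K(3))
  show "integrable lborel (\<lambda>x. (norm (grad v x - v x *\<^sub>R hardy_field k x))\<^sup>2)"
    using gs(2) d by blast
  show "integrable lborel (\<lambda>x. (v x)\<^sup>2 / (norm x)\<^sup>2)"
  proof -
    have "n > 0" by (simp add: n_def)
    moreover have "integrable lborel (\<lambda>x. (v x)\<^sup>2 * (d x + (norm (hardy_field k x))\<^sup>2))"
      using gs(3) d by blast
    then have "integrable lborel (\<lambda>x. - (n\<^sup>2 / 4) * ((v x)\<^sup>2 / (norm x)\<^sup>2))"
      by (simp only: eq)
    ultimately show ?thesis unfolding integrable_mult_left_iff by simp
  qed
  show "(LINT x|lborel. (norm (grad v x))\<^sup>2) = (LINT x|lborel. (norm (grad v x - v x *\<^sub>R hardy_field k x))\<^sup>2)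
       + (real CARD('n))\<^sup>2 / 4 * (LINT x|lborel. (v x)\<^sup>2 / (norm x)\<^sup>2)"
  proof -
    have "(LINT x|lborel. (norm (grad v x))\<^sup>2) = (LINT x|lborel. (norm (grad v x - v x *\<^sub>R hardy_field k x))\<^sup>2)
       - (LINT x|lborel. (v x)\<^sup>2 * (d x + (norm (hardy_field k x))\<^sup>2))"
      using gs(4) d by blast
    then show ?thesis unfolding eq integral_mult_right_zero n_def by simp
  qed
qed

text \<open>This provides the lower bound without which the real infimum in \<open>S_star\<close>
  could not be compared with its elements.\<close>

lemma S_star_numerator_nonneg:
  fixes v :: "real^'n::finite \<Rightarrow> real"
  assumes "v \<in> Cc_infinity (half_space k)"
  shows "(LINT x|lborel. (norm (grad v x))\<^sup>2)
      - \<gamma> * (real CARD('n) - \<gamma>) * (LINT x|lborel. (v x)\<^sup>2 / (norm x)\<^sup>2) \<ge> 0"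
proof -
  let ?I = "LINT x|lborel. (v x)\<^sup>2 / (norm x)\<^sup>2" and ?n = "real CARD('n)"
  have "?n\<^sup>2 / 4 - \<gamma> * (?n - \<gamma>) = (?n / 2 - \<gamma>)\<^sup>2"
    by (simp add: power2_eq_square algebra_simps)
  then have "\<gamma> * (?n - \<gamma>) \<le> ?n\<^sup>2 / 4" by (smt (verit) zero_le_power2)
  then have "\<gamma> * (?n - \<gamma>) * ?I \<le> ?n\<^sup>2 / 4 * ?I"
    by (rule mult_right_mono) simp
  moreover have "(LINT x|lborel. (norm (grad v x - v x *\<^sub>R hardy_field k x))\<^sup>2) \<ge> 0" by simp
  ultimately show ?thesis using hardy_identity(3)[OF assms] by linarith
qed

lemma S_star_Cc_infinity:
  fixes v :: "real^'n::finite \<Rightarrow> real"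
  assumes v: "v \<in> Cc_infinity (half_space k)" "v \<noteq> (\<lambda>x. 0)"
  shows "S_star k p \<gamma> \<ge> 0"
    and "S_star k p \<gamma> * (LINT x|lborel. norm x powr (p * (real CARD('n) - 2) / 2 - real CARD('n)) * \<bar>v x\<bar> powr p) powr (2 / p)
      \<le> (LINT x|lborel. (norm (grad v x))\<^sup>2) - \<gamma> * (real CARD('n) - \<gamma>) * (LINT x|lborel. (v x)\<^sup>2 / (norm x)\<^sup>2)"
proof -
  let ?n = "real CARD('n)"
  define num where "num = (\<lambda>u::real^'n \<Rightarrow> real. (LINT x|lborel. (norm (grad u x))\<^sup>2)
      - \<gamma> * (?n - \<gamma>) * (LINT x|lborel. (u x)\<^sup>2 / (norm x)\<^sup>2))"
  define den where "den = (\<lambda>u::real^'n \<Rightarrow> real.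
      (LINT x|lborel. norm x powr (p * (?n - 2) / 2 - ?n) * \<bar>u x\<bar> powr p) powr (2 / p))"
  define A where "A = {u \<in> Cc_infinity (half_space k). u \<noteq> (\<lambda>x::real^'n. 0::real)}"
  have eq: "S_star k p \<gamma> = (INF u\<in>A. num u / den u)"
    unfolding S_star_def Let_def A_def[symmetric]
  proof (rule INF_cong[OF refl])
    fix u :: "real^'n \<Rightarrow> real" assume "u \<in> A"
    then obtain K where K: "compact K" "K \<subseteq> half_space k" "\<And>x. x \<notin> K \<Longrightarrow> u x = 0"
      using Cc_infinityD unfolding A_def by (metis (no_types, lifting) mem_Collect_eq)
    have z: "u x = 0" "grad u x = 0" if "x \<notin> half_space k" for x
      using that K(2,3) grad_eq_0_outside[OF K(1), of u x] by auto
    show "((LINT x:half_space k|lborel. (norm (grad u x))\<^sup>2) -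
            \<gamma> * (?n - \<gamma>) * (LINT x:half_space k|lborel. (u x)\<^sup>2 / (norm x)\<^sup>2)) /
           (LINT x:half_space k|lborel. norm x powr (p * (?n - 2) / 2 - ?n) * \<bar>u x\<bar> powr p) powr (2 / p)
         = num u / den u"
      unfolding num_def den_def by (simp add: set_lebesgue_integral_support z)
  qed
  have q0: "num u / den u \<ge> 0" if "u \<in> A" for u
    using S_star_numerator_nonneg[of u k \<gamma>] that by (auto simp: num_def den_def A_def)
  have vA: "v \<in> A" using v by (simp add: A_def)
  show "S_star k p \<gamma> \<ge> 0" unfolding eq by (rule cINF_greatest) (use vA q0 in auto)
  have "S_star k p \<gamma> \<le> num v / den v"
    unfolding eq by (rule cINF_lower[OF bdd_belowI2[OF q0] vA])
  moreover have "den v \<ge> 0" by (simp add: den_def)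
  moreover have "num v \<ge> 0" using S_star_numerator_nonneg[OF v(1)] by (simp add: num_def)
  \<comment> \<open>If \<open>den v\<close> is 0, the quotient has the default value 0 and carries
    no information; the left side is then 0 and the sign of \<open>num v\<close> decides.\<close>
  ultimately have "S_star k p \<gamma> * den v \<le> num v"
    by (cases "den v = 0") (auto simp: field_simps)
  then show "S_star k p \<gamma> * (LINT x|lborel. norm x powr (p * (?n - 2) / 2 - ?n) * \<bar>v x\<bar> powr p) powr (2 / p)
      \<le> (LINT x|lborel. (norm (grad v x))\<^sup>2) - \<gamma> * (?n - \<gamma>) * (LINT x|lborel. (v x)\<^sup>2 / (norm x)\<^sup>2)"
    by (simp add: num_def den_def)
qed

section \<open>The ground state outside the ball\<close>

lemma has_derivative_inner_add:
  "(f has_derivative (\<lambda>h. a \<bullet> h)) F \<Longrightarrow> (g has_derivative (\<lambda>h. b \<bullet> h)) F \<Longrightarrow>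
    ((\<lambda>x. f x + g x) has_derivative (\<lambda>h. (a + b) \<bullet> h)) F"
  using has_derivative_add by (force simp: inner_add_left)

lemma has_derivative_inner_diff:
  "(f has_derivative (\<lambda>h. a \<bullet> h)) F \<Longrightarrow> (g has_derivative (\<lambda>h. b \<bullet> h)) F \<Longrightarrow>
    ((\<lambda>x. f x - g x) has_derivative (\<lambda>h. (a - b) \<bullet> h)) F"
  using has_derivative_diff by (force simp: inner_diff_left)

lemma has_derivative_inner_cmult:
  "(f has_derivative (\<lambda>h. a \<bullet> h)) F \<Longrightarrow> ((\<lambda>x. c * f x) has_derivative (\<lambda>h. (c *\<^sub>R a) \<bullet> h)) F" for c :: real
  using has_derivative_mult_right by (force simp: inner_scaleR_left)

lemma has_derivative_inner_const: "((\<lambda>x. c) has_derivative (\<lambda>h. 0 \<bullet> h)) F"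
  by simp

lemma has_derivative_ln_norm_power2:
  fixes x :: "real^'n::finite"
  assumes "x + c \<noteq> 0"
  shows "((\<lambda>x. ln ((norm (x + c))\<^sup>2)) has_derivative (\<lambda>h. (2 *\<^sub>R inversion (x + c)) \<bullet> h)) (at x)"
proof -
  have "((\<lambda>x. ln ((norm (x + c))\<^sup>2)) has_derivative
      (\<lambda>h. (inverse ((norm (x + c))\<^sup>2) *\<^sub>R 2 *\<^sub>R (x + c)) \<bullet> h)) (at x)"
    by (rule has_derivative_compose_inner[OF has_derivative_norm_power2 DERIV_ln]) (use assms in simp)
  then show ?thesis by (simp add: inversion_def mult.commute)
qed

locale exterior_ball =
  fixes k :: "'n::finite" and \<rho> M :: real
  assumes rho: "\<rho> > 0" and M: "M > 0"
begin

definition Q :: "real^'n" where "Q = (2 * \<rho>) *\<^sub>R axis k 1"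

text \<open>Since |x + \<rho> e|^2 - \<rho>^2 = 2\<rho> \<theta>(x) for the unit vector e in
  direction k, positivity means lying outside the closed exterior ball. The Kelvin image has k-th
  coordinate 4\<rho>^2 \<theta>(x)/|x+Q|^2.\<close>

definition \<theta> :: "real^'n \<Rightarrow> real" where "\<theta> x = x $ k + inverse (2 * \<rho>) * (norm x)\<^sup>2"

text \<open>$P = \ln (M/|y|)$ for the Kelvin image $y$ of $x$, since $|y| = 2\rho|x|/|x+Q|$.\<close>

definition P :: "real^'n \<Rightarrow> real" where
  "P x = ln M - ln (2 * \<rho>) + 1 / 2 * (ln ((norm (x + Q))\<^sup>2) - ln ((norm x)\<^sup>2))"

text \<open>The region where the ground state is positive; P > 1 makes g = sqrt(P^2 - 1)
  positive.\<close>

definition V :: "(real^'n) set" where "V = {x. \<theta> x > 0 \<and> P x > 1}"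

text \<open>The logarithmic derivative of sqrt g = (P^2 - 1)^(1/4) with respect to P.\<close>

definition s :: "real \<Rightarrow> real" where "s p = p * inverse (2 * (p * p - 1))"

definition ground_field :: "real^'n \<Rightarrow> real^'n" where
  "ground_field x = inverse (\<theta> x) *\<^sub>R (axis k 1 + inverse \<rho> *\<^sub>R x)
     - (real CARD('n) / 2) *\<^sub>R (inversion x + inversion (x + Q))
     + s (P x) *\<^sub>R (inversion (x + Q) - inversion x)"

text \<open>The logarithm of the Kelvin transform of $y_n |y|^{-n/2} g^{1/2}$; its gradient is
  \<open>ground_field\<close>.\<close>

definition log_ground :: "real^'n \<Rightarrow> real" where
  "log_ground x = ln (\<theta> x) - real CARD('n) / 4 * (ln ((norm x)\<^sup>2) + ln ((norm (x + Q))\<^sup>2))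
     + real CARD('n) / 2 * ln (2 * \<rho>) + 1 / 4 * ln (P x * P x - 1)"

lemma norm_add_Q: "(norm (x + Q))\<^sup>2 = 4 * \<rho> * \<theta> x + 4 * \<rho>\<^sup>2 - (norm x)\<^sup>2"
proof -
  have "(norm (x + Q))\<^sup>2 = (norm x)\<^sup>2 + 4 * \<rho> * x $ k + 4 * \<rho>\<^sup>2"
    unfolding power2_norm_eq_inner Q_def
    by (simp add: inner_add_left inner_add_right inner_axis inner_commute power2_eq_square)
  then show ?thesis using rho by (simp add: \<theta>_def field_simps power2_eq_square)
qed

text \<open>Both singular points, 0 and -Q, lie on the boundary sphere of the ball, where \<theta>
  vanishes.\<close>

lemma \<theta>_pos_imp:
  assumes "\<theta> x > 0" shows "x \<noteq> 0" "x + Q \<noteq> 0"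
proof -
  show "x \<noteq> 0" using assms by (auto simp: \<theta>_def)
  show "x + Q \<noteq> 0"
  proof
    assume "x + Q = 0"
    then have "x = - Q" by (simp add: eq_neg_iff_add_eq_0)
    then show False using assms rho by (simp add: \<theta>_def Q_def power2_eq_square)
  qed
qed

lemma continuous_on_\<theta>: "continuous_on S \<theta>"
  unfolding \<theta>_def by (intro continuous_intros)

lemma open_\<theta>_pos: "open {x. \<theta> x > 0}"
  by (intro open_Collect_less continuous_intros continuous_on_\<theta>)

lemma Ck_on_\<theta>: "open S \<Longrightarrow> Ck_on m S \<theta>"
  unfolding \<theta>_def by (intro Ck_on_add Ck_on_mult Ck_on_const Ck_on_component Ck_on_norm_power2)

lemma Ck_on_P:
  assumes "open S" "\<And>x. x \<in> S \<Longrightarrow> \<theta> x > 0" shows "Ck_on m S P"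
proof -
  have comp: "Ck_on m S (\<lambda>x. (x + c) $ j)" for j and c :: "real^'n"
    unfolding vector_add_component by (intro Ck_on_add Ck_on_const Ck_on_component assms)
  show ?thesis
    unfolding P_def[abs_def]
    by (intro Ck_on_add Ck_on_mult Ck_on_diff Ck_on_const Ck_on_ln Ck_on_norm_power2 Ck_on_component comp assms(1))
      (use \<theta>_pos_imp assms(2) in auto)
qed

lemma open_V: "open V"
proof -
  have "V = {x. \<theta> x > 0} \<inter> P -` {1<..}" by (auto simp: V_def)
  moreover have "continuous_on {x. \<theta> x > 0} P"
    by (rule Ck_on_imp_continuous[OF Ck_on_P[of _ 0]]) (auto intro: open_\<theta>_pos)
  ultimately show ?thesis
    using continuous_open_preimage open_\<theta>_pos by (metis open_greaterThan)
qed

lemma P_gt_1: "x \<in> V \<Longrightarrow> P x * P x - 1 > 0"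
  unfolding V_def using mult_strict_mono[of 1 "P x" 1 "P x"] by auto

lemma Ck_on_ground_field: "Ck_on m V (\<lambda>x. ground_field x $ j)"
proof -
  have P: "Ck_on m V P" by (rule Ck_on_P[OF open_V]) (simp add: V_def)
  have \<theta>: "x + c \<noteq> 0" if "x \<in> V" "c = 0 \<or> c = Q" for x c
    using \<theta>_pos_imp[of x] that by (auto simp: V_def)
  have inv: "Ck_on m V (\<lambda>x. inversion x $ j)" 
    using Ck_on_inversion[OF open_V, of 0 m j] \<theta>[of _ 0] by (simp only: add_0_right not_False_eq_True simp_thms)
  have s: "Ck_on m V (\<lambda>x. s (P x))"
    unfolding s_def
    by (intro Ck_on_mult Ck_on_inverse Ck_on_diff Ck_on_const open_V P) (use P_gt_1 in force)
  show ?thesis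
    unfolding ground_field_def vector_minus_component vector_add_component vector_scaleR_component real_scaleR_def
    by (intro Ck_on_add Ck_on_mult Ck_on_diff Ck_on_const Ck_on_inverse Ck_on_component Ck_on_\<theta> open_V inv s
        Ck_on_inversion \<theta>) (auto simp: V_def)
qed

lemma has_derivative_\<theta>: "(\<theta> has_derivative (\<lambda>h. (axis k 1 + inverse \<rho> *\<^sub>R x) \<bullet> h)) (at x)"
proof -
  have "(\<theta> has_derivative (\<lambda>h. (axis k 1 + inverse (2 * \<rho>) *\<^sub>R 2 *\<^sub>R (x + 0)) \<bullet> h)) (at x)"
    unfolding \<theta>_def using has_derivative_norm_power2[of 0 x]
    by (intro has_derivative_inner_add has_derivative_inner_cmult has_derivative_component) simp
  then show ?thesis using rho by (simp add: field_simps)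
qed

lemma has_derivative_P:
  assumes "\<theta> x > 0"
  shows "(P has_derivative (\<lambda>h. (inversion (x + Q) - inversion x) \<bullet> h)) (at x)"
proof -
  have "(P has_derivative (\<lambda>h. (0 - 0 + (1 / 2) *\<^sub>R (2 *\<^sub>R inversion (x + Q) - 2 *\<^sub>R inversion x)) \<bullet> h)) (at x)"
    unfolding P_def[abs_def] using has_derivative_ln_norm_power2[of x 0] \<theta>_pos_imp[OF assms]
    by (intro has_derivative_inner_add has_derivative_inner_diff has_derivative_inner_cmult
        has_derivative_inner_const has_derivative_ln_norm_power2) simp_all
  then show ?thesis by (simp add: scaleR_right_diff_distrib)
qed

lemma has_derivative_log_ground:
  assumes "x \<in> V"
  shows "(log_ground has_derivative (\<lambda>h. ground_field x \<bullet> h)) (at x)"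
proof -
  have \<theta>: "\<theta> x > 0" using assms by (simp add: V_def)
  have p: "P x * P x - 1 > 0" using P_gt_1[OF assms] .
  have "((\<lambda>x. ln (\<theta> x)) has_derivative (\<lambda>h. (inverse (\<theta> x) *\<^sub>R (axis k 1 + inverse \<rho> *\<^sub>R x)) \<bullet> h)) (at x)"
    by (rule has_derivative_compose_inner[OF has_derivative_\<theta> DERIV_ln[OF \<theta>]])
  moreover have "((\<lambda>x. ln (P x * P x - 1)) has_derivative
      (\<lambda>h. ((inverse (P x * P x - 1) * (2 * P x)) *\<^sub>R (inversion (x + Q) - inversion x)) \<bullet> h)) (at x)"
    by (rule has_derivative_compose_inner[OF has_derivative_P[OF \<theta>], of "\<lambda>p. ln (p * p - 1)"])
      (use p in \<open>auto intro!: derivative_eq_intros simp: divide_inverse\<close>)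
  ultimately have "(log_ground has_derivative (\<lambda>h. (inverse (\<theta> x) *\<^sub>R (axis k 1 + inverse \<rho> *\<^sub>R x)
      - (real CARD('n) / 4) *\<^sub>R (2 *\<^sub>R inversion x + 2 *\<^sub>R inversion (x + Q)) + 0
      + (1 / 4) *\<^sub>R (inverse (P x * P x - 1) * (2 * P x)) *\<^sub>R (inversion (x + Q) - inversion x)) \<bullet> h)) (at x)"
    unfolding log_ground_def using has_derivative_ln_norm_power2[of x 0] \<theta>_pos_imp[OF \<theta>]
    by (intro has_derivative_inner_add has_derivative_inner_diff has_derivative_inner_cmult
        has_derivative_inner_const has_derivative_ln_norm_power2) simp_all
  moreover have "inverse (\<theta> x) *\<^sub>R (axis k 1 + inverse \<rho> *\<^sub>R x)
      - (real CARD('n) / 4) *\<^sub>R (2 *\<^sub>R inversion x + 2 *\<^sub>R inversion (x + Q)) + 0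
      + (1 / 4) *\<^sub>R (inverse (P x * P x - 1) * (2 * P x)) *\<^sub>R (inversion (x + Q) - inversion x)
     = ground_field x"
  proof -
    have "(real CARD('n) / 4) *\<^sub>R (2 *\<^sub>R inversion x + 2 *\<^sub>R inversion (x + Q))
      = (real CARD('n) / 2) *\<^sub>R (inversion x + inversion (x + Q))"
      by (simp add: scaleR_add_right)
    moreover have "(1 / 4) *\<^sub>R (inverse (P x * P x - 1) * (2 * P x)) *\<^sub>R (inversion (x + Q) - inversion x)
      = s (P x) *\<^sub>R (inversion (x + Q) - inversion x)"
    proof -
      have "s (P x) = 1 / 4 * (inverse (P x * P x - 1) * (2 * P x))"
        unfolding s_def inverse_mult_distrib by simp
      then show ?thesis by (simp only: scaleR_scaleR)
    qed
    ultimately show ?thesis by (simp add: ground_field_def)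
  qed
  ultimately show ?thesis by simp
qed

text \<open>The terms in 1/\<theta>^2, in 1/(\<rho> \<theta>) and those linear in \<open>s\<close>
  cancel. What survives is |grad P|^2 times -n^2/4 + s^2 + s', and s^2 + s' is the second derivative
  of sqrt g in P divided by sqrt g.\<close>

lemma ground_field_ground_state:
  assumes x: "x \<in> V"
  shows "\<exists>d. has_div ground_field d x \<and> d + (norm (ground_field x))\<^sup>2 =
    - (4 * \<rho>\<^sup>2 * inverse ((norm x)\<^sup>2) * inverse ((norm (x + Q))\<^sup>2) *
       ((real CARD('n))\<^sup>2 / 4 + ((P x)\<^sup>2 + 2) / (4 * ((P x)\<^sup>2 - 1)\<^sup>2)))"
proof -
  define n where "n = real CARD('n)"
  define t where "t = inverse (\<theta> x)"
  define A where "A = inverse ((norm x)\<^sup>2)"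
  define B where "B = inverse ((norm (x + Q))\<^sup>2)"
  define \<kappa> where "\<kappa> = 4 * \<rho>\<^sup>2 * A * B"
  define X where "X = inversion x"
  define Y where "Y = inversion (x + Q)"
  define E where "E = axis k 1 + inverse \<rho> *\<^sub>R x"
  define c where "c = s (P x)"
  define c' where "c' = - ((P x)\<^sup>2 + 1) / (2 * ((P x)\<^sup>2 - 1)\<^sup>2)"
  have \<theta>: "\<theta> x > 0" using x by (simp add: V_def)
  note nz = \<theta>_pos_imp[OF \<theta>]
  have p: "(P x)\<^sup>2 - 1 > 0" using P_gt_1[OF x] by (simp add: power2_eq_square)
  have Aa: "A * (norm x)\<^sup>2 = 1" and Bb: "B * (norm (x + Q))\<^sup>2 = 1" and t: "t * \<theta> x = 1"
    using nz \<theta> by (simp_all add: A_def B_def t_def)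
  have XX: "X \<bullet> X = A" and YY: "Y \<bullet> Y = B"
    by (simp_all add: X_def Y_def A_def B_def inner_inversion_self)
  \<comment> \<open>Polarization: x and x + Q differ by Q, which has length 2\<rho>. It yields |Y -
    X|^2 = \<kappa>, where Y - X is the gradient of P.\<close>
  have XY: "X \<bullet> Y = (A + B - \<kappa>) / 2"
  proof -
    have "2 * (x \<bullet> (x + Q)) = (norm x)\<^sup>2 + (norm (x + Q))\<^sup>2 - (norm Q)\<^sup>2"
      unfolding power2_norm_eq_inner by (simp add: inner_add_left inner_add_right inner_commute)
    moreover have "(norm Q)\<^sup>2 = 4 * \<rho>\<^sup>2" by (simp add: Q_def power2_eq_square)
    ultimately have xq: "x \<bullet> (x + Q) = ((norm x)\<^sup>2 + (norm (x + Q))\<^sup>2 - 4 * \<rho>\<^sup>2) / 2" by simp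
    have "X \<bullet> Y = A * B * (x \<bullet> (x + Q))"
      unfolding X_def Y_def inversion_def A_def B_def inner_scaleR_left inner_scaleR_right by simp
    also have "\<dots> = (B * (A * (norm x)\<^sup>2) + A * (B * (norm (x + Q))\<^sup>2) - \<kappa>) / 2"
      unfolding xq \<kappa>_def by (simp add: algebra_simps)
    finally show ?thesis using Aa Bb by simp
  qed
  have EE: "E \<bullet> E = 1 + 2 * \<theta> x / \<rho>"
  proof -
    have "E \<bullet> E = 1 + 2 * (inverse \<rho> * x $ k) + inverse \<rho> * (inverse \<rho> * (x \<bullet> x))"
      unfolding E_def by (simp add: inner_add_left inner_add_right inner_axis inner_commute)
    then show ?thesis
      using rho by (simp add: \<theta>_def dot_square_norm field_simps power2_eq_square)
  qed
  have Ex: "E \<bullet> x = \<theta> x + (norm x)\<^sup>2 / (2 * \<rho>)"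
  proof -
    have "E \<bullet> x = x $ k + inverse \<rho> * (x \<bullet> x)"
      unfolding E_def inner_add_left by (simp add: inner_axis')
    then show ?thesis using rho by (simp add: \<theta>_def dot_square_norm field_simps)
  qed
  have ExQ: "E \<bullet> (x + Q) = \<theta> x + (norm (x + Q))\<^sup>2 / (2 * \<rho>)"
  proof -
    have "E \<bullet> Q = 2 * \<rho> + 2 * x $ k"
      using rho unfolding E_def Q_def inner_add_left
      by (simp add: inner_axis inner_axis' distrib_left)
    then show ?thesis
      using rho unfolding inner_add_right Ex norm_add_Q by (simp add: \<theta>_def field_simps power2_eq_square)
  qed
  \<comment> \<open>The vector t E is the gradient of ln \<theta>. Its products with X and Y contain
    the same t/(2\<rho>), so its product with Y - X is just B - A; this makes the terms linear in c
    cancel.\<close>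
  have TX: "t * (E \<bullet> X) = A + t / (2 * \<rho>)"
  proof -
    have "t * (E \<bullet> X) = A * (t * \<theta> x) + t * (A * (norm x)\<^sup>2) / (2 * \<rho>)"
      unfolding X_def inversion_def A_def[symmetric] inner_scaleR_right Ex by (simp add: algebra_simps)
    then show ?thesis using Aa t by simp
  qed
  have TY: "t * (E \<bullet> Y) = B + t / (2 * \<rho>)"
  proof -
    have "t * (E \<bullet> Y) = B * (t * \<theta> x) + t * (B * (norm (x + Q))\<^sup>2) / (2 * \<rho>)"
      unfolding Y_def inversion_def B_def[symmetric] inner_scaleR_right ExQ by (simp add: algebra_simps)
    then show ?thesis using Bb t by simp
  qed
  have dE: "has_div (\<lambda>x. axis k 1 + inverse \<rho> *\<^sub>R x) (n / \<rho>) x"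
    using has_div_add[OF has_div_const[of "axis k 1"] has_div_scaleR[OF has_derivative_inner_const[of "inverse \<rho>"] has_div_id]]
    by (simp add: n_def divide_inverse mult.commute)
  have dt: "((\<lambda>x. inverse (\<theta> x)) has_derivative (\<lambda>h. (- (t ^ Suc (Suc 0)) *\<^sub>R E) \<bullet> h)) (at x)"
    unfolding t_def E_def
    by (rule has_derivative_compose_inner[OF has_derivative_\<theta> DERIV_inverse]) (use \<theta> in simp)
  have div1: "has_div (\<lambda>x. inverse (\<theta> x) *\<^sub>R (axis k 1 + inverse \<rho> *\<^sub>R x)) (- (t\<^sup>2 * (E \<bullet> E)) + t * n / \<rho>) x"
    using has_div_scaleR[OF dt dE] by (simp add: E_def[symmetric] t_def[symmetric] power2_eq_square)
  have dX: "has_div (\<lambda>x. inversion x) ((n - 2) * A) x" and dY: "has_div (\<lambda>x. inversion (x + Q)) ((n - 2) * B) x"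
    using has_div_inversion[of x 0] has_div_inversion[of x Q] nz by (simp_all add: n_def A_def B_def)
  have div2: "has_div (\<lambda>x. (n / 2) *\<^sub>R (inversion x + inversion (x + Q))) (n / 2 * ((n - 2) * (A + B))) x"
    using has_div_scaleR[OF has_derivative_inner_const[of "n / 2"] has_div_add[OF dX dY]]
    by (simp add: algebra_simps)
  have ds: "(s has_field_derivative c') (at (P x))"
  proof -
    define z where "z = P x"
    define w where "w = z * z - 1"
    have w: "w \<noteq> 0" using p by (simp add: w_def z_def power2_eq_square)
    have d: "((\<lambda>p. p / (2 * (p * p - 1))) has_field_derivative
        (1 * (2 * (z * z - 1)) - z * (2 * (1 * z + 1 * z))) / ((2 * (z * z - 1)) * (2 * (z * z - 1)))) (at z)"
      by (rule DERIV_divide) (use w in \<open>auto intro!: derivative_eq_intros simp: w_def\<close>)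
    have "z * z = w + 1" by (simp add: w_def)
    then have eq: "(1 * (2 * (z * z - 1)) - z * (2 * (1 * z + 1 * z))) / ((2 * (z * z - 1)) * (2 * (z * z - 1)))
        = (2 * w - 4 * (w + 1)) / (4 * w\<^sup>2)" and c': "c' = - (w + 2) / (2 * w\<^sup>2)"
      unfolding c'_def z_def[symmetric] by (simp_all add: power2_eq_square algebra_simps)
    have eq': "(2 * w - 4 * (w + 1)) / (4 * w\<^sup>2) = - (w + 2) / (2 * w\<^sup>2)"
      using w by (simp add: divide_simps)
    show ?thesis
      using d unfolding eq eq' c' s_def[abs_def] z_def[symmetric] divide_inverse[symmetric] .
  qed
  have div3: "has_div (\<lambda>x. s (P x) *\<^sub>R (inversion (x + Q) - inversion x)) (c' * ((Y - X) \<bullet> (Y - X)) + c * ((n - 2) * (B - A))) x"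
    using has_div_scaleR[OF has_derivative_compose_inner[OF has_derivative_P[OF \<theta>] ds] has_div_diff[OF dY dX]]
    by (simp add: X_def Y_def c_def algebra_simps)
  have YX: "(Y - X) \<bullet> (Y - X) = \<kappa>"
    by (simp add: inner_diff_left inner_diff_right inner_commute[of Y X] XX YY XY)
  let ?d = "- (t\<^sup>2 * (E \<bullet> E)) + t * n / \<rho> - n / 2 * ((n - 2) * (A + B)) + (c' * \<kappa> + c * ((n - 2) * (B - A)))"
  have div: "has_div ground_field ?d x"
    unfolding ground_field_def[abs_def] n_def[symmetric]
    using has_div_add[OF has_div_diff[OF div1 div2] div3] by (simp only: YX)
  have "(norm (ground_field x))\<^sup>2 = t\<^sup>2 * (E \<bullet> E) + n\<^sup>2 / 4 * (X \<bullet> X + 2 * (X \<bullet> Y) + Y \<bullet> Y) + c\<^sup>2 * \<kappa>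
      - n * (t * (E \<bullet> X) + t * (E \<bullet> Y)) + 2 * c * (t * (E \<bullet> Y) - t * (E \<bullet> X)) - n * c * (Y \<bullet> Y - X \<bullet> X)"
    unfolding power2_norm_eq_inner ground_field_def n_def[symmetric] X_def[symmetric] Y_def[symmetric]
      E_def[symmetric] t_def[symmetric] c_def[symmetric] YX[symmetric]
    by (simp add: inner_diff_left inner_diff_right inner_add_left inner_add_right inner_commute
        power2_eq_square algebra_simps)
  also have "\<dots> = t\<^sup>2 * (E \<bullet> E) + n\<^sup>2 / 4 * (2 * (A + B) - \<kappa>) + c\<^sup>2 * \<kappa>
      - n * (A + B + t / \<rho>) + 2 * c * (B - A) - n * c * (B - A)"
    unfolding XX YY XY TX TY using rho by (simp add: field_simps)
  finally have "?d + (norm (ground_field x))\<^sup>2 = - (\<kappa> * (n\<^sup>2 / 4 - (c\<^sup>2 + c')))"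
    by (simp add: power2_eq_square algebra_simps)
  \<comment> \<open>In terms of g the right side is -1/(4 g^2) - 3/(4 g^4): the critical Hardy term
    and the surplus.\<close>
  moreover have "c\<^sup>2 + c' = - (((P x)\<^sup>2 + 2) / (4 * ((P x)\<^sup>2 - 1)\<^sup>2))"
  proof -
    define z where "z = (P x)\<^sup>2"
    have "z - 1 > 0" using p by (simp add: z_def)
    have "c = P x / (2 * (z - 1))" by (simp add: c_def s_def z_def power2_eq_square divide_inverse)
    then have "c\<^sup>2 = z / (2\<^sup>2 * (z - 1)\<^sup>2)" by (simp only: power_divide power_mult_distrib z_def)
    then have "c\<^sup>2 = z / (4 * (z - 1)\<^sup>2)" by simp
    moreover have "c' = - (z + 1) / (2 * (z - 1)\<^sup>2)" by (simp only: c'_def z_def)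
    moreover have "z / (4 * W) + - (z + 1) / (2 * W) = - ((z + 2) / (4 * W))" if "W > 0" for W :: real
      using that by (simp add: field_simps)
    ultimately have "c\<^sup>2 + c' = - ((z + 2) / (4 * (z - 1)\<^sup>2))" using \<open>z - 1 > 0\<close> by simp
    then show ?thesis by (simp add: z_def)
  qed
  ultimately have "?d + (norm (ground_field x))\<^sup>2 =
      - (\<kappa> * (n\<^sup>2 / 4 + ((P x)\<^sup>2 + 2) / (4 * ((P x)\<^sup>2 - 1)\<^sup>2)))" by simp
  with div show ?thesis unfolding \<kappa>_def A_def B_def n_def by blast
qed

end

section \<open>The map from the half-ball to the domain\<close>

lemma Ck_on_cosh: "open S \<Longrightarrow> Ck_on m S f \<Longrightarrow> Ck_on m S (\<lambda>x. cosh (f x))"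
  unfolding cosh_field_def divide_inverse by (intro Ck_on_mult Ck_on_add Ck_on_exp Ck_on_minus Ck_on_const)

lemma Ck_on_sinh: "open S \<Longrightarrow> Ck_on m S f \<Longrightarrow> Ck_on m S (\<lambda>x. sinh (f x))"
  unfolding sinh_field_def divide_inverse by (intro Ck_on_mult Ck_on_diff Ck_on_exp Ck_on_minus Ck_on_const)

text \<open>The reflection in the hyperplane orthogonal to z, which is the orthogonal part of the
  derivative of the inversion at z. For z = 0 the convention inverse 0 = 0 makes it the identity, so
  it is orthogonal for every z.\<close>

definition householder :: "real^'n::finite \<Rightarrow> real^'n \<Rightarrow> real^'n" where
  "householder z w = w - (2 * inverse ((norm z)\<^sup>2) * (z \<bullet> w)) *\<^sub>R z"

lemma orthogonal_transformation_householder: "orthogonal_transformation (householder z)"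
  unfolding orthogonal_transformation
proof (intro conjI allI)
  show "linear (householder z)"
    by (intro linearI) (simp_all add: householder_def inner_add_right algebra_simps)
  show "norm (householder z v) = norm v" for v
  proof -
    have "householder z v \<bullet> householder z v = v \<bullet> v"
    proof (cases "z = 0")
      case False
      then have "inverse ((norm z)\<^sup>2) * (z \<bullet> z) = 1" by (simp add: dot_square_norm)
      then have *: "a * inverse ((norm z)\<^sup>2) * (z \<bullet> z) = a" for a by (simp add: mult.assoc)
      have "householder z v \<bullet> householder z v = v \<bullet> v - 4 * inverse ((norm z)\<^sup>2) * (z \<bullet> v)\<^sup>2
          + 4 * (inverse ((norm z)\<^sup>2) * (z \<bullet> v)\<^sup>2) * inverse ((norm z)\<^sup>2) * (z \<bullet> z)"
        unfolding householder_def
        by (simp add: inner_diff_left inner_diff_right inner_commute power2_eq_square algebra_simps)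
      then show ?thesis unfolding * by simp
    qed (simp add: householder_def)
    then show ?thesis by (simp add: norm_eq_sqrt_inner)
  qed
qed

lemma has_derivative_inversion:
  fixes z :: "real^'n::finite"
  assumes "z \<noteq> 0"
  shows "(inversion has_derivative (\<lambda>w. inverse ((norm z)\<^sup>2) *\<^sub>R householder z w)) (at z)"
proof -
  define q where "q = (norm z)\<^sup>2"
  have q: "q > 0" using assms by (simp add: q_def)
  have d: "((\<lambda>x. inverse ((norm x)\<^sup>2)) has_derivative (\<lambda>h. (- (inverse q ^ Suc (Suc 0)) *\<^sub>R 2 *\<^sub>R z) \<bullet> h)) (at z)"
    unfolding q_def
    using has_derivative_norm_power2[of 0 z] q
    by (intro has_derivative_compose_inner[OF _ DERIV_inverse]) (simp_all add: q_def)
  show ?thesis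
    unfolding inversion_def[abs_def]
    by (rule has_derivative_eq_rhs[OF has_derivative_scaleR[OF d has_derivative_ident]])
      (use q in \<open>auto simp: householder_def q_def[symmetric] fun_eq_iff algebra_simps\<close>)
qed

lemma inversion_inversion:
  assumes "z \<noteq> 0" "c > 0"
  shows "c *\<^sub>R inversion (c *\<^sub>R inversion z) = z"
proof -
  have "(norm (c *\<^sub>R inversion z))\<^sup>2 = c\<^sup>2 * inverse ((norm z)\<^sup>2)"
    using inner_inversion_self[of z] by (simp add: power_mult_distrib dot_square_norm)
  then have "c *\<^sub>R inversion (c *\<^sub>R inversion z)
      = (c * (inverse (c\<^sup>2 * inverse ((norm z)\<^sup>2)) * (c * inverse ((norm z)\<^sup>2)))) *\<^sub>R z"
    by (simp only: inversion_def[of "c *\<^sub>R inversion z"]) (simp add: inversion_def)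
  moreover have "c * (inverse (c\<^sup>2 * inverse q) * (c * inverse q)) = 1" if "q \<noteq> 0" for q
    using that assms(2) by (simp add: field_simps power2_eq_square)
  ultimately show ?thesis using assms(1) by simp
qed

text \<open>An orthogonal map taking |\<xi>| times a unit coordinate vector to \<xi> conjugates the
  update to a diagonal matrix with a single entry different from 1.\<close>

lemma det_rank_one_update:
  fixes \<xi> :: "real^'n::finite"
  shows "det (matrix (\<lambda>w. w + (b * (\<xi> \<bullet> w)) *\<^sub>R \<xi>)) = 1 + b * (norm \<xi>)\<^sup>2"
proof -
  fix k :: 'n
  define e where "e = norm \<xi> *\<^sub>R (axis k 1 :: real^'n)"
  define S where "S = (\<lambda>\<xi> w :: real^'n. w + (b * (\<xi> \<bullet> w)) *\<^sub>R \<xi>)"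
  have lS: "linear (S \<xi>)" for \<xi>
    by (intro linearI) (simp_all add: S_def inner_add_right algebra_simps)
  obtain T where T: "orthogonal_transformation T" "T e = \<xi>"
    using orthogonal_transformation_exists[of e \<xi>] by (auto simp: e_def)
  have lT: "linear T" using T(1) orthogonal_transformation_linear by blast
  have "S \<xi> \<circ> T = T \<circ> S e"
  proof
    fix w
    have "\<xi> \<bullet> T w = e \<bullet> w" using T by (metis orthogonal_transformation_def)
    then show "(S \<xi> \<circ> T) w = (T \<circ> S e) w"
      using linear_add[OF lT] linear_scale[OF lT] T(2) by (simp add: S_def)
  qed
  then have "det (matrix (S \<xi>)) * det (matrix T) = det (matrix T) * det (matrix (S e))"
    by (metis det_mul matrix_compose lS lT)
  moreover have "det (matrix T) \<noteq> 0" using orthogonal_transformation_det[OF T(1)] by auto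
  moreover have "det (matrix (S e)) = 1 + b * (norm \<xi>)\<^sup>2"
  proof -
    have m: "matrix (S e) $ i $ j = (if i = j then if i = k then 1 + b * (norm \<xi>)\<^sup>2 else 1 else 0)" for i j
      by (simp add: matrix_def S_def e_def inner_axis_axis) (simp add: axis_def power2_eq_square)
    then have "det (matrix (S e)) = (\<Prod>i\<in>UNIV. matrix (S e) $ i $ i)"
      by (intro det_diagonal) simp
    then show ?thesis by (simp add: m prod.delta)
  qed
  ultimately show ?thesis by (simp add: S_def)
qed

lemma abs_det_scaled_reflected_rank_one_update:
  fixes \<xi> :: "real^'n::finite"
  shows "\<bar>det (matrix (\<lambda>w. c *\<^sub>R householder z (w + (b * (\<xi> \<bullet> w)) *\<^sub>R \<xi>)))\<bar>
    = \<bar>c\<bar> ^ CARD('n) * \<bar>1 + b * (norm \<xi>)\<^sup>2\<bar>"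
proof -
  let ?S = "\<lambda>w. w + (b * (\<xi> \<bullet> w)) *\<^sub>R \<xi>" and ?H = "householder z"
  have lS: "linear ?S"
    by (intro linearI) (simp_all add: inner_add_right algebra_simps)
  have lH: "linear ?H" using orthogonal_transformation_householder orthogonal_transformation_linear by blast
  have lc: "linear ((*\<^sub>R) c :: real^'n \<Rightarrow> real^'n)" by (simp add: linear_scale_self)
  have "matrix (\<lambda>w. c *\<^sub>R ?H (?S w)) = matrix ((*\<^sub>R) c \<circ> (?H \<circ> ?S))" by (simp add: o_def)
  also have "\<dots> = matrix ((*\<^sub>R) c) ** (matrix ?H ** matrix ?S)"
    using matrix_compose[OF linear_compose[OF lS lH] lc] matrix_compose[OF lS lH] by simp
  finally show ?thesis
    using orthogonal_transformation_det[OF orthogonal_transformation_householder[of z]]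
    by (simp add: det_mul det_rank_one_update abs_mult power_abs)
qed

text \<open>The map stretches by \<mu> along \<xi> and fixes the orthogonal complement, so its
  operator norm is \<mu> once \<mu> \<ge> 1. The condition \<delta> g \<ge> 1 enters the proof
  through this hypothesis.\<close>

lemma norm_rank_one_update_le:
  fixes \<xi> :: "real^'n::finite"
  assumes "\<xi> \<noteq> 0" "\<mu> \<ge> 1"
  shows "norm (w + ((\<mu> - 1) * inverse ((norm \<xi>)\<^sup>2) * (\<xi> \<bullet> w)) *\<^sub>R \<xi>) \<le> \<mu> * norm w"
proof -
  define q where "q = (norm \<xi>)\<^sup>2"
  define b where "b = (\<mu> - 1) * inverse q"
  have q: "q > 0" using assms by (simp add: q_def)
  have bq: "b * q = \<mu> - 1" using q by (simp add: b_def)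
  have "(norm (w + (b * (\<xi> \<bullet> w)) *\<^sub>R \<xi>))\<^sup>2 = (norm w)\<^sup>2 + b * (2 + b * q) * (\<xi> \<bullet> w)\<^sup>2"
  proof -
    have "(norm (w + (b * (\<xi> \<bullet> w)) *\<^sub>R \<xi>))\<^sup>2 = w \<bullet> w + 2 * b * (\<xi> \<bullet> w)\<^sup>2 + b\<^sup>2 * (\<xi> \<bullet> w)\<^sup>2 * (\<xi> \<bullet> \<xi>)"
      unfolding power2_norm_eq_inner
      by (simp add: inner_add_left inner_add_right inner_commute power2_eq_square algebra_simps)
    then show ?thesis
      by (simp add: q_def dot_square_norm) (simp add: power2_eq_square algebra_simps)
  qed
  also have "b * (2 + b * q) * (\<xi> \<bullet> w)\<^sup>2 \<le> b * (2 + b * q) * (q * (norm w)\<^sup>2)"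
  proof (rule mult_left_mono)
    have "\<bar>\<xi> \<bullet> w\<bar>\<^sup>2 \<le> (norm \<xi> * norm w)\<^sup>2" by (rule power_mono[OF Cauchy_Schwarz_ineq2]) simp
    then show "(\<xi> \<bullet> w)\<^sup>2 \<le> q * (norm w)\<^sup>2" by (simp add: q_def power_mult_distrib)
    show "0 \<le> b * (2 + b * q)" unfolding bq using assms q by (simp add: b_def)
  qed
  also have "(norm w)\<^sup>2 + b * (2 + b * q) * (q * (norm w)\<^sup>2) = (norm w)\<^sup>2 + (b * q) * (2 + b * q) * (norm w)\<^sup>2"
    by (simp add: algebra_simps)
  also have "\<dots> = (\<mu> * norm w)\<^sup>2" unfolding bq by (simp add: power2_eq_square algebra_simps)
  finally have "(norm (w + (b * (\<xi> \<bullet> w)) *\<^sub>R \<xi>))\<^sup>2 \<le> (\<mu> * norm w)\<^sup>2" by simp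
  then have "norm (w + (b * (\<xi> \<bullet> w)) *\<^sub>R \<xi>) \<le> \<mu> * norm w"
    by (rule power2_le_imp_le) (use assms(2) in simp)
  then show ?thesis unfolding b_def q_def .
qed

locale exterior_ball_map = exterior_ball k \<rho> M for k :: "'n::finite" and \<rho> M :: real +
  fixes \<delta> :: real
  assumes delta: "\<delta> > 0" and M_le: "M \<le> 2 * \<rho>"
begin

text \<open>\<open>mfac\<close> is the factor of the radial map $y = m(\xi)\,\xi$ determined by
  $\ln (M/|y|) = \cosh (-\delta \ln |\xi|)$, and \<open>conf\<close> is $|x||x+Q|/(2\rho|\xi|)$.  The bound
  $M \le 2\rho$ keeps $y$ away from the centre $Q$ of the inversion.\<close>

definition half_ball :: "(real^'n) set" where "half_ball = half_space k \<inter> ball 0 1"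

text \<open>This is -\<delta> ln |\<xi>|, so that P = cosh \<tau> and g = sinh \<tau>. As cosh is
  even, only the unit ball, where \<tau> > 0, can be used if the map is to be injective.\<close>

definition tau :: "real^'n \<Rightarrow> real" where "tau \<xi> = - (\<delta> / 2) * ln ((norm \<xi>)\<^sup>2)"

definition mfac :: "real^'n \<Rightarrow> real" where
  "mfac \<xi> = exp (ln M - 1 / 2 * ln ((norm \<xi>)\<^sup>2) - cosh (tau \<xi>))"

definition zmap :: "real^'n \<Rightarrow> real^'n" where "zmap \<xi> = Q - mfac \<xi> *\<^sub>R \<xi>"

definition conf :: "real^'n \<Rightarrow> real" where
  "conf \<xi> = 4 * \<rho>\<^sup>2 * mfac \<xi> * inverse ((norm (zmap \<xi>))\<^sup>2)"

text \<open>With y = m(\<xi>)\<xi> this is the inversion in the sphere of radius 2\<rho> about -Q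
  applied to -y; the argument of \<open>inversion\<close> is the difference of -y and the
  centre.\<close>

definition Gmap :: "real^'n \<Rightarrow> real^'n" where "Gmap \<xi> = (4 * \<rho>\<^sup>2) *\<^sub>R inversion (zmap \<xi>) - Q"

text \<open>The inverse of \<open>Gmap\<close>: the direction is that of the Kelvin image of x, and
  the radius is recovered from P by solving cosh \<tau> = P for \<tau> > 0.\<close>

definition Hmap :: "real^'n \<Rightarrow> real^'n" where
  "Hmap x = (exp (- arcosh (P x) / \<delta>) * inverse (norm (Q - (4 * \<rho>\<^sup>2) *\<^sub>R inversion (x + Q))))
     *\<^sub>R (Q - (4 * \<rho>\<^sup>2) *\<^sub>R inversion (x + Q))"

section \<open>Bijectivity of the map and the values of \<theta> and P along it\<close>

lemma open_half_ball: "open half_ball"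
  unfolding half_ball_def by (intro open_Int open_half_space open_ball)

lemma norm_Q: "norm Q = 2 * \<rho>" "Q $ k = 2 * \<rho>"
  using rho by (simp_all add: Q_def)

lemma ln_norm_power2: "x \<noteq> 0 \<Longrightarrow> ln ((norm x)\<^sup>2) = 2 * ln (norm x)"
  by (simp add: ln_realpow)

lemma half_ballD:
  assumes "\<xi> \<in> half_ball"
  shows "\<xi> $ k > 0" "\<xi> \<noteq> 0" "norm \<xi> < 1" "norm \<xi> > 0" "tau \<xi> > 0" "sinh (tau \<xi>) > 0"
proof -
  show "\<xi> $ k > 0" "\<xi> \<noteq> 0" "norm \<xi> < 1" "norm \<xi> > 0"
    using assms half_space_not_0 by (auto simp: half_ball_def half_space_def)
  then have "ln ((norm \<xi>)\<^sup>2) < 0" by (simp add: ln_norm_power2)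
  then show "tau \<xi> > 0" using delta by (simp add: tau_def mult_pos_neg)
  then show "sinh (tau \<xi>) > 0" by simp
qed

lemma mfac_pos: "mfac \<xi> > 0" by (simp add: mfac_def)

lemma mfac_norm:
  assumes "\<xi> \<noteq> 0"
  shows "mfac \<xi> * norm \<xi> = M * exp (- cosh (tau \<xi>))"
proof -
  have "mfac \<xi> = exp (ln M) * exp (- ln (norm \<xi>)) * exp (- cosh (tau \<xi>))"
    using assms by (simp add: mfac_def ln_norm_power2 exp_add[symmetric] del: exp_ln)
  also have "\<dots> = M * inverse (norm \<xi>) * exp (- cosh (tau \<xi>))"
    using M assms by (simp add: exp_minus)
  finally show ?thesis using assms by simp
qed

text \<open>The image radius is M exp(-cosh \<tau>) < M \<le> 2\<rho> = |Q|.\<close>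

lemma zmap_nonzero:
  assumes "\<xi> \<noteq> 0"
  shows "zmap \<xi> \<noteq> 0"
proof -
  have "norm (mfac \<xi> *\<^sub>R \<xi>) = M * exp (- cosh (tau \<xi>))"
    using mfac_norm[OF assms] mfac_pos[of \<xi>] by simp
  also have "\<dots> < M * 1" using M cosh_real_pos[of "tau \<xi>"] by (intro mult_strict_left_mono) auto
  finally have "norm (mfac \<xi> *\<^sub>R \<xi>) < norm Q" using M_le by (simp add: norm_Q)
  then show ?thesis by (auto simp: zmap_def)
qed

lemma conf_pos: "\<xi> \<noteq> 0 \<Longrightarrow> conf \<xi> > 0"
  using zmap_nonzero mfac_pos rho by (simp add: conf_def)

lemma norm_inversion_power2: "(norm (inversion w))\<^sup>2 = inverse ((norm w)\<^sup>2)"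
  using inner_inversion_self[of w] by (simp add: dot_square_norm)

text \<open>The distance formula for inversions, applied to w and to Q, which lies on the sphere of
  inversion and is therefore fixed.\<close>

lemma norm_reflected_sphere:
  assumes "w \<noteq> 0"
  shows "(norm ((4 * \<rho>\<^sup>2) *\<^sub>R inversion w - Q))\<^sup>2 = 4 * \<rho>\<^sup>2 * (norm (Q - w))\<^sup>2 * inverse ((norm w)\<^sup>2)"
proof -
  define q where "q = (norm w)\<^sup>2"
  have q: "inverse q * q = 1" using assms by (simp add: q_def)
  have QQ: "Q \<bullet> Q = 4 * \<rho>\<^sup>2" by (simp add: dot_square_norm norm_Q power_mult_distrib)
  have wQ: "w \<bullet> Q = (q + 4 * \<rho>\<^sup>2 - (norm (Q - w))\<^sup>2) / 2"
    unfolding q_def power2_norm_eq_inner by (simp add: inner_diff_left inner_diff_right inner_commute QQ)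
  have "(norm ((4 * \<rho>\<^sup>2) *\<^sub>R inversion w - Q))\<^sup>2
      = (4 * \<rho>\<^sup>2)\<^sup>2 * (inversion w \<bullet> inversion w) - 2 * (4 * \<rho>\<^sup>2) * (inversion w \<bullet> Q) + Q \<bullet> Q"
    unfolding power2_norm_eq_inner
    by (simp add: inner_diff_left inner_diff_right inner_commute power2_eq_square)
  also have "\<dots> = (4 * \<rho>\<^sup>2)\<^sup>2 * inverse q - 2 * (4 * \<rho>\<^sup>2) * (inverse q * (w \<bullet> Q)) + 4 * \<rho>\<^sup>2"
    unfolding inner_inversion_self QQ by (simp add: inversion_def q_def)
  also have "\<dots> = (4 * \<rho>\<^sup>2)\<^sup>2 * inverse q - 4 * \<rho>\<^sup>2 * (inverse q * q) - 4 * \<rho>\<^sup>2 * inverse q * (4 * \<rho>\<^sup>2)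
      + 4 * \<rho>\<^sup>2 * (norm (Q - w))\<^sup>2 * inverse q + 4 * \<rho>\<^sup>2"
    unfolding wQ by (simp add: diff_divide_distrib add_divide_distrib algebra_simps)
  finally show ?thesis unfolding q by (simp add: power2_eq_square q_def)
qed

lemma Gmap_add_Q: "Gmap \<xi> + Q = (4 * \<rho>\<^sup>2) *\<^sub>R inversion (zmap \<xi>)"
  by (simp add: Gmap_def)

lemma norm_Gmap_add_Q: "(norm (Gmap \<xi> + Q))\<^sup>2 = (4 * \<rho>\<^sup>2)\<^sup>2 * inverse ((norm (zmap \<xi>))\<^sup>2)"
  unfolding Gmap_add_Q by (simp add: power_mult_distrib norm_inversion_power2)

lemma norm_Gmap:
  assumes "\<xi> \<noteq> 0"
  shows "(norm (Gmap \<xi>))\<^sup>2 = 4 * \<rho>\<^sup>2 * (mfac \<xi> * norm \<xi>)\<^sup>2 * inverse ((norm (zmap \<xi>))\<^sup>2)"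
  unfolding Gmap_def norm_reflected_sphere[OF zmap_nonzero[OF assms]]
  by (simp add: zmap_def[of \<xi>] power_mult_distrib)

text \<open>The product |x||x+Q| is what occurs both in the weight |grad P|^2 and in the L^p weight
  of the theorem, so this one identity transforms both.\<close>

lemma norm_Gmap_times:
  assumes "\<xi> \<noteq> 0"
  shows "(norm (Gmap \<xi>))\<^sup>2 * (norm (Gmap \<xi> + Q))\<^sup>2 = (4 * \<rho>\<^sup>2) * (conf \<xi> * norm \<xi>)\<^sup>2"
  unfolding norm_Gmap[OF assms] norm_Gmap_add_Q conf_def by (simp add: power_mult_distrib power2_eq_square)

lemma \<theta>_Gmap:
  assumes "\<xi> \<noteq> 0"
  shows "\<theta> (Gmap \<xi>) = conf \<xi> * \<xi> $ k"
proof -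
  define q where "q = (norm (zmap \<xi>))\<^sup>2"
  define y where "y = mfac \<xi> *\<^sub>R \<xi>"
  have q: "inverse q * q = 1" using zmap_nonzero[OF assms] by (simp add: q_def)
  have qy: "q = 4 * \<rho>\<^sup>2 - 4 * \<rho> * y $ k + (norm y)\<^sup>2"
  proof -
    have "(norm (Q - y))\<^sup>2 = Q \<bullet> Q - 2 * (Q \<bullet> y) + (norm y)\<^sup>2"
      unfolding power2_norm_eq_inner by (simp add: inner_diff_left inner_diff_right inner_commute)
    moreover have "Q \<bullet> Q = 4 * \<rho>\<^sup>2" by (simp add: dot_square_norm norm_Q power_mult_distrib)
    moreover have "Q \<bullet> y = 2 * \<rho> * y $ k" by (simp add: Q_def inner_axis')
    ultimately show ?thesis by (simp add: q_def zmap_def y_def)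
  qed
  have ny: "(norm y)\<^sup>2 = (mfac \<xi> * norm \<xi>)\<^sup>2" by (simp add: y_def power_mult_distrib)
  have "4 * \<rho> * \<theta> (Gmap \<xi>) = (4 * \<rho>\<^sup>2)\<^sup>2 * inverse q - 4 * \<rho>\<^sup>2 * (inverse q * q) + 4 * \<rho>\<^sup>2 * (norm y)\<^sup>2 * inverse q"
    using norm_add_Q[of "Gmap \<xi>"] unfolding norm_Gmap_add_Q norm_Gmap[OF assms] q_def[symmetric] ny[symmetric] q by simp
  also have "\<dots> = 4 * \<rho>\<^sup>2 * inverse q * (4 * \<rho> * y $ k)"
    unfolding qy by (simp add: power2_eq_square algebra_simps)
  also have "\<dots> = 4 * \<rho> * (4 * \<rho>\<^sup>2 * y $ k * inverse q)" by simp
  finally show ?thesis using rho by (simp add: conf_def q_def y_def)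
qed

lemma P_Gmap:
  assumes "\<xi> \<noteq> 0"
  shows "P (Gmap \<xi>) = cosh (tau \<xi>)"
proof -
  define q where "q = (norm (zmap \<xi>))\<^sup>2"
  define y where "y = mfac \<xi> * norm \<xi>"
  have q: "q > 0" using zmap_nonzero[OF assms] by (simp add: q_def)
  have y: "y > 0" using mfac_pos assms by (simp add: y_def)
  have ln_y: "ln y = ln M - cosh (tau \<xi>)"
    unfolding y_def mfac_norm[OF assms] using M by (simp add: ln_mult_pos)
  have "ln ((norm (Gmap \<xi> + Q))\<^sup>2) - ln ((norm (Gmap \<xi>))\<^sup>2) = ln ((2 * \<rho> / y)\<^sup>2)"
    unfolding norm_Gmap_add_Q norm_Gmap[OF assms] q_def[symmetric] y_def[symmetric]
    using q y rho by (subst ln_divide_pos[symmetric]) (simp_all add: field_simps power2_eq_square)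
  also have "\<dots> = 2 * (ln (2 * \<rho>) - ln y)"
    using y rho by (simp add: ln_realpow ln_divide_pos)
  finally show ?thesis by (simp add: P_def ln_y diff_divide_distrib)
qed

lemma Gmap_in_V:
  assumes "\<xi> \<in> half_ball"
  shows "Gmap \<xi> \<in> V"
proof -
  note h = half_ballD[OF assms]
  have "cosh (tau \<xi>) > 1" using cosh_real_strict_mono[of 0 "tau \<xi>"] h(5) by simp
  moreover have "conf \<xi> * \<xi> $ k > 0" using conf_pos h by simp
  ultimately show ?thesis using h by (simp add: V_def \<theta>_Gmap P_Gmap)
qed

lemma Hmap_Gmap:
  assumes "\<xi> \<in> half_ball"
  shows "Hmap (Gmap \<xi>) = \<xi>"
proof -
  note h = half_ballD[OF assms]
  have "(4 * \<rho>\<^sup>2) *\<^sub>R inversion (Gmap \<xi> + Q) = zmap \<xi>"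
    unfolding Gmap_add_Q using inversion_inversion[OF zmap_nonzero[OF h(2)], of "4 * \<rho>\<^sup>2"] rho by simp
  then have y: "Q - (4 * \<rho>\<^sup>2) *\<^sub>R inversion (Gmap \<xi> + Q) = mfac \<xi> *\<^sub>R \<xi>" by (simp add: zmap_def)
  have "exp (- arcosh (P (Gmap \<xi>)) / \<delta>) = norm \<xi>"
  proof -
    have "arcosh (P (Gmap \<xi>)) = tau \<xi>" using h(2,5) by (simp add: P_Gmap arcosh_cosh_real)
    moreover have "- tau \<xi> / \<delta> = ln (norm \<xi>)" using h(2) delta by (simp add: tau_def ln_norm_power2)
    ultimately show ?thesis using h(2) by simp
  qed
  moreover have "norm \<xi> * inverse (norm (mfac \<xi> *\<^sub>R \<xi>)) * mfac \<xi> = 1"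
    using h(2) mfac_pos[of \<xi>] by (simp add: field_simps)
  ultimately show ?thesis unfolding Hmap_def y by simp
qed

lemma inj_on_Gmap: "inj_on Gmap half_ball"
  by (rule inj_on_inverseI[of _ Hmap]) (rule Hmap_Gmap)

lemma Hmap_facts:
  assumes "x \<in> V"
  shows "Hmap x \<in> half_ball" "Gmap (Hmap x) = x"
    "Q - (4 * \<rho>\<^sup>2) *\<^sub>R inversion (x + Q) \<noteq> 0"
proof -
  define y where "y = Q - (4 * \<rho>\<^sup>2) *\<^sub>R inversion (x + Q)"
  define b where "b = (norm (x + Q))\<^sup>2"
  define r where "r = exp (- arcosh (P x) / \<delta>)"
  have \<theta>: "\<theta> x > 0" and P1: "P x > 1" using assms by (auto simp: V_def)
  note nz = \<theta>_pos_imp[OF \<theta>]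
  have b: "b > 0" using nz by (simp add: b_def)
  have yk: "y $ k = 4 * \<rho>\<^sup>2 * \<theta> x * inverse b"
  proof -
    have "y $ k * b = 2 * \<rho> * b - 4 * \<rho>\<^sup>2 * (x $ k + 2 * \<rho>) * (inverse b * b)"
      by (simp add: y_def inversion_def norm_Q b_def algebra_simps)
    also have "\<dots> = 2 * \<rho> * b - 4 * \<rho>\<^sup>2 * (x $ k + 2 * \<rho>)" using b by simp
    also have "\<dots> = 4 * \<rho>\<^sup>2 * \<theta> x"
      unfolding b_def norm_add_Q using rho by (simp add: \<theta>_def field_simps power2_eq_square)
    finally show ?thesis using b by (simp add: field_simps)
  qed
  then have yk0: "y $ k > 0" using \<theta> b rho by simp
  then show "Q - (4 * \<rho>\<^sup>2) *\<^sub>R inversion (x + Q) \<noteq> 0" by (auto simp: y_def[symmetric])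
  have y0: "y \<noteq> 0" using yk0 by auto
  have "(norm y)\<^sup>2 = 4 * \<rho>\<^sup>2 * (norm x)\<^sup>2 * inverse b"
    using norm_reflected_sphere[OF nz(2)] by (simp add: y_def norm_minus_commute b_def)
  then have "b / (norm x)\<^sup>2 = (2 * \<rho> / norm y)\<^sup>2"
    using b y0 nz rho by (simp add: field_simps)
  then have "ln b - ln ((norm x)\<^sup>2) = ln ((2 * \<rho> / norm y)\<^sup>2)"
    using b nz by (subst ln_divide_pos[symmetric]) simp_all
  also have "\<dots> = 2 * (ln (2 * \<rho>) - ln (norm y))"
    using y0 rho by (simp add: ln_realpow ln_divide_pos)
  finally have Py: "P x = ln M - ln (norm y)" by (simp add: P_def b_def diff_divide_distrib)
  have H: "Hmap x = (r * inverse (norm y)) *\<^sub>R y" by (simp add: Hmap_def r_def y_def)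
  have r0: "r > 0" by (simp add: r_def)
  have nH: "norm (Hmap x) = r" using y0 r0 by (simp add: H)
  have a0: "arcosh (P x) > 0" using arcosh_real_strict_mono[of 1 "P x"] P1 by simp
  then have r1: "r < 1" using delta by (simp add: r_def)
  have "Hmap x $ k > 0" using yk0 r0 y0 by (simp add: H)
  then show HB: "Hmap x \<in> half_ball" using nH r1 by (simp add: half_ball_def half_space_def)
  note h = half_ballD[OF HB]
  have tau: "tau (Hmap x) = arcosh (P x)"
    unfolding tau_def ln_norm_power2[OF h(2)] unfolding nH using delta by (simp add: r_def)
  \<comment> \<open>The radial map sends radius r to M exp(-P), and the formula for P just obtained
    identifies this number with the length of y.\<close>
  have "mfac (Hmap x) * r = M * exp (- P x)"
    using mfac_norm[OF h(2)] P1 by (simp add: nH tau)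
  also have "\<dots> = norm y" using M y0 by (simp add: Py exp_diff)
  finally have my: "mfac (Hmap x) * r = norm y" .
  have "mfac (Hmap x) *\<^sub>R Hmap x = (mfac (Hmap x) * r * inverse (norm y)) *\<^sub>R y" by (simp add: H)
  then have "mfac (Hmap x) *\<^sub>R Hmap x = y" using my y0 by simp
  then have "zmap (Hmap x) = (4 * \<rho>\<^sup>2) *\<^sub>R inversion (x + Q)" by (simp add: zmap_def y_def)
  then show "Gmap (Hmap x) = x"
    using inversion_inversion[OF nz(2), of "4 * \<rho>\<^sup>2"] rho by (simp add: Gmap_def)
qed

lemma Gmap_image: "Gmap ` half_ball = V"
  using Gmap_in_V Hmap_facts by (auto simp: image_iff) metis

lemma continuous_on_Hmap: "continuous_on V Hmap"
proof -
  have P: "continuous_on V P"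
    by (rule Ck_on_imp_continuous[OF Ck_on_P[OF open_V, of 0]]) (simp add: V_def)
  have "continuous_on V (\<lambda>x. inversion (x + Q))"
    unfolding inversion_def using \<theta>_pos_imp
    by (intro continuous_intros) (auto simp: V_def)
  moreover have "continuous_on V (\<lambda>x. arcosh (P x))"
    by (rule continuous_on_compose2[OF continuous_on_arcosh[of "{1..}"] P]) (auto simp: V_def)
  ultimately show ?thesis
    unfolding Hmap_def using Hmap_facts(3) delta by (intro continuous_intros) auto
qed

section \<open>Smoothness, derivative and Jacobian of the map\<close>

lemma Ck_on_ln_norm: "Ck_on m half_ball (\<lambda>\<xi>. ln ((norm \<xi>)\<^sup>2))"
  by (intro Ck_on_ln Ck_on_norm_power2 Ck_on_component open_half_ball) (use half_ballD in force)

lemma Ck_on_tau: "Ck_on m half_ball tau"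
  unfolding tau_def[abs_def] by (intro Ck_on_mult Ck_on_const Ck_on_ln_norm open_half_ball)

lemma Ck_on_mfac: "Ck_on m half_ball mfac"
  unfolding mfac_def[abs_def]
  by (intro Ck_on_exp Ck_on_diff Ck_on_mult Ck_on_const Ck_on_ln_norm Ck_on_cosh Ck_on_tau open_half_ball)

lemma Ck_on_zmap: "Ck_on m half_ball (\<lambda>\<xi>. zmap \<xi> $ j)"
  unfolding zmap_def vector_minus_component vector_scaleR_component real_scaleR_def
  by (intro Ck_on_diff Ck_on_mult Ck_on_const Ck_on_mfac Ck_on_component open_half_ball)

lemma Ck_on_inverse_zmap: "Ck_on m half_ball (\<lambda>\<xi>. inverse ((norm (zmap \<xi>))\<^sup>2))"
  by (intro Ck_on_inverse Ck_on_norm_power2 Ck_on_zmap open_half_ball)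
    (use zmap_nonzero half_ballD in force)

lemma Ck_on_conf: "Ck_on m half_ball conf"
  unfolding conf_def[abs_def]
  by (intro Ck_on_mult Ck_on_const Ck_on_mfac Ck_on_inverse_zmap open_half_ball)

lemma Ck_on_Gmap: "Ck_on m half_ball (\<lambda>\<xi>. Gmap \<xi> $ j)"
  unfolding Gmap_def inversion_def vector_minus_component vector_scaleR_component real_scaleR_def
  by (intro Ck_on_mult Ck_on_diff Ck_on_const Ck_on_zmap Ck_on_inverse_zmap open_half_ball)

lemma continuous_on_Gmap: "continuous_on half_ball Gmap"
  using continuous_on_vec_lambda[of half_ball "\<lambda>j \<xi>. Gmap \<xi> $ j"] Ck_on_imp_continuous[OF Ck_on_Gmap[of 0]]
  by (simp add: vec_lambda_eta)

text \<open>The radial direction is stretched by \<delta> sinh \<tau> relative to the tangential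
  ones; then follows an orthogonal map times the conformal factor.\<close>

definition Gmap' :: "real^'n \<Rightarrow> real^'n \<Rightarrow> real^'n" where
  "Gmap' \<xi> w = (- conf \<xi>) *\<^sub>R householder (zmap \<xi>)
     (w + ((\<delta> * sinh (tau \<xi>) - 1) * inverse ((norm \<xi>)\<^sup>2) * (\<xi> \<bullet> w)) *\<^sub>R \<xi>)"

lemma has_derivative_Gmap:
  assumes "\<xi> \<in> half_ball"
  shows "(Gmap has_derivative Gmap' \<xi>) (at \<xi>)"
proof -
  note h = half_ballD[OF assms]
  define a where "a = mfac \<xi> * (\<delta> * sinh (tau \<xi>) - 1) * inverse ((norm \<xi>)\<^sup>2)"
  have dl: "((\<lambda>\<xi>. ln ((norm \<xi>)\<^sup>2)) has_derivative (\<lambda>w. (2 *\<^sub>R inversion \<xi>) \<bullet> w)) (at \<xi>)"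
    using has_derivative_ln_norm_power2[of \<xi> 0] h(2) by simp
  have dtau: "(tau has_derivative (\<lambda>w. ((- (\<delta> / 2)) *\<^sub>R 2 *\<^sub>R inversion \<xi>) \<bullet> w)) (at \<xi>)"
    unfolding tau_def[abs_def] by (rule has_derivative_inner_cmult[OF dl])
  have dcosh: "(cosh has_field_derivative sinh t) (at t)" for t :: real
    by (auto intro!: derivative_eq_intros)
  have "(mfac has_derivative (\<lambda>w. (mfac \<xi> *\<^sub>R (0 - (1 / 2) *\<^sub>R 2 *\<^sub>R inversion \<xi>
      - sinh (tau \<xi>) *\<^sub>R (- (\<delta> / 2)) *\<^sub>R 2 *\<^sub>R inversion \<xi>)) \<bullet> w)) (at \<xi>)"
    unfolding mfac_def[abs_def]
    by (rule has_derivative_compose_inner[OF _ DERIV_exp],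
        intro has_derivative_inner_diff has_derivative_inner_const has_derivative_inner_cmult dl,
        rule has_derivative_compose_inner[OF dtau dcosh])
  moreover have eq: "mfac \<xi> *\<^sub>R (0 - (1 / 2) *\<^sub>R 2 *\<^sub>R inversion \<xi>
      - sinh (tau \<xi>) *\<^sub>R (- (\<delta> / 2)) *\<^sub>R 2 *\<^sub>R inversion \<xi>) = a *\<^sub>R \<xi>"
    by (simp add: a_def inversion_def algebra_simps)
  ultimately have dm: "(mfac has_derivative (\<lambda>w. (a *\<^sub>R \<xi>) \<bullet> w)) (at \<xi>)" by (simp only: eq)
  have dz: "(zmap has_derivative (\<lambda>w. 0 - (mfac \<xi> *\<^sub>R w + ((a *\<^sub>R \<xi>) \<bullet> w) *\<^sub>R \<xi>))) (at \<xi>)"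
    unfolding zmap_def[abs_def]
    by (rule has_derivative_diff[OF has_derivative_const has_derivative_scaleR[OF dm has_derivative_ident]])
  let ?b = "\<lambda>w. ((\<delta> * sinh (tau \<xi>) - 1) * inverse ((norm \<xi>)\<^sup>2) * (\<xi> \<bullet> w))"
  have *: "0 - (mfac \<xi> *\<^sub>R w + ((a *\<^sub>R \<xi>) \<bullet> w) *\<^sub>R \<xi>) = (- mfac \<xi>) *\<^sub>R (w + ?b w *\<^sub>R \<xi>)" for w
    by (simp add: a_def algebra_simps)
  have lin: "linear (householder (zmap \<xi>))"
    using orthogonal_transformation_householder orthogonal_transformation_linear by blast
  have "((\<lambda>\<xi>. inversion (zmap \<xi>)) has_derivative (\<lambda>w. inverse ((norm (zmap \<xi>))\<^sup>2) *\<^sub>R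
      householder (zmap \<xi>) ((- mfac \<xi>) *\<^sub>R (w + ?b w *\<^sub>R \<xi>)))) (at \<xi>)"
    using has_derivative_compose[OF dz has_derivative_inversion[OF zmap_nonzero[OF h(2)]]] unfolding * .
  then have "(Gmap has_derivative (\<lambda>w. (4 * \<rho>\<^sup>2) *\<^sub>R (inverse ((norm (zmap \<xi>))\<^sup>2) *\<^sub>R
      householder (zmap \<xi>) ((- mfac \<xi>) *\<^sub>R (w + ?b w *\<^sub>R \<xi>))) - 0)) (at \<xi>)"
    unfolding Gmap_def[abs_def]
    by (intro has_derivative_diff has_derivative_const has_derivative_scaleR_right)
  moreover have "(4 * \<rho>\<^sup>2) *\<^sub>R (inverse ((norm (zmap \<xi>))\<^sup>2) *\<^sub>R
      householder (zmap \<xi>) ((- mfac \<xi>) *\<^sub>R (w + ?b w *\<^sub>R \<xi>))) - 0 = Gmap' \<xi> w" for w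
    unfolding linear_scale[OF lin] by (simp add: Gmap'_def conf_def)
  ultimately show ?thesis by simp
qed

lemma abs_det_Gmap':
  assumes "\<xi> \<in> half_ball"
  shows "\<bar>det (matrix (Gmap' \<xi>))\<bar> = conf \<xi> ^ CARD('n) * (\<delta> * sinh (tau \<xi>))"
proof -
  note h = half_ballD[OF assms]
  have cancel: "a * inverse ((norm \<xi>)\<^sup>2) * (norm \<xi>)\<^sup>2 = a" for a using h(2) by simp
  have "matrix (Gmap' \<xi>) = matrix (\<lambda>w. (- conf \<xi>) *\<^sub>R householder (zmap \<xi>)
     (w + ((\<delta> * sinh (tau \<xi>) - 1) * inverse ((norm \<xi>)\<^sup>2) * (\<xi> \<bullet> w)) *\<^sub>R \<xi>))"
    by (simp add: Gmap'_def[abs_def])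
  then show ?thesis
    using h delta conf_pos[OF h(2)]
    by (simp only: abs_det_scaled_reflected_rank_one_update cancel) (simp add: abs_mult)
qed

lemma norm_Gmap'_le:
  assumes "\<xi> \<in> half_ball" "\<delta> * sinh (tau \<xi>) \<ge> 1"
  shows "norm (Gmap' \<xi> w) \<le> conf \<xi> * (\<delta> * sinh (tau \<xi>)) * norm w"
proof -
  note h = half_ballD[OF assms(1)]
  have "norm (householder (zmap \<xi>) v) = norm v" for v
    using orthogonal_transformation_householder orthogonal_transformation by blast
  then have "norm (Gmap' \<xi> w) = conf \<xi> *
      norm (w + ((\<delta> * sinh (tau \<xi>) - 1) * inverse ((norm \<xi>)\<^sup>2) * (\<xi> \<bullet> w)) *\<^sub>R \<xi>)"
    using conf_pos[OF h(2)] by (simp add: Gmap'_def)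
  also have "\<dots> \<le> conf \<xi> * (\<delta> * sinh (tau \<xi>) * norm w)"
    using norm_rank_one_update_le[OF h(2) assms(2)] conf_pos[OF h(2)] by (intro mult_left_mono) auto
  finally show ?thesis by (simp add: mult.assoc)
qed

end

section \<open>Transplanting functions to the half-space\<close>

lemma has_grad:
  assumes "f differentiable (at x)"
  shows "(f has_derivative (\<lambda>h. grad f x \<bullet> h)) (at x)"
proof -
  obtain f' where f': "(f has_derivative f') (at x)"
    using assms by (auto simp: differentiable_def)
  moreover have "f' = (\<lambda>h. grad f x \<bullet> h)" using grad_inner[OF f'] by auto
  ultimately show ?thesis by simp
qed

context exterior_ball_map
begin

text \<open>The weight conf^(n/2 - 1) g^(-1/2): the first power belongs to the Kelvin transform, the
  second to the substitution v = sqrt(g) h.\<close>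

definition omega :: "real^'n \<Rightarrow> real" where
  "omega \<xi> = exp ((real CARD('n) / 2 - 1) * ln (conf \<xi>) - 1 / 2 * ln (sinh (tau \<xi>)))"

definition pull :: "(real^'n \<Rightarrow> real) \<Rightarrow> real^'n \<Rightarrow> real" where
  "pull u \<xi> = (if \<xi> \<in> half_ball then omega \<xi> * u (Gmap \<xi>) else 0)"

lemma omega_pos: "omega \<xi> > 0" by (simp add: omega_def)

lemma omega_power2:
  assumes "\<xi> \<in> half_ball"
  shows "(omega \<xi>)\<^sup>2 * (conf \<xi>)\<^sup>2 * sinh (tau \<xi>) = conf \<xi> ^ CARD('n)"
proof -
  note h = half_ballD[OF assms]
  have c: "conf \<xi> > 0" using conf_pos[OF h(2)] .
  have "(omega \<xi>)\<^sup>2 = exp ((real CARD('n) - 2) * ln (conf \<xi>) - ln (sinh (tau \<xi>)))"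
    unfolding omega_def exp_double[symmetric] by (simp add: algebra_simps)
  also have "\<dots> = exp (real CARD('n) * ln (conf \<xi>)) * exp (- (2 * ln (conf \<xi>))) * exp (- ln (sinh (tau \<xi>)))"
    unfolding exp_add[symmetric] by (simp add: algebra_simps)
  also have "exp (real CARD('n) * ln (conf \<xi>)) = conf \<xi> ^ CARD('n)"
    using c by (simp add: exp_of_nat_mult)
  also have "exp (- (2 * ln (conf \<xi>))) = inverse ((conf \<xi>)\<^sup>2)"
    using c by (simp add: exp_minus exp_double)
  also have "exp (- ln (sinh (tau \<xi>))) = inverse (sinh (tau \<xi>))"
    using h(6) by (simp only: exp_minus exp_ln)
  finally show ?thesis using c less_imp_neq[OF h(6)] by (simp add: field_simps)
qed

lemma Ck_on_omega: "Ck_on m half_ball omega"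
  unfolding omega_def[abs_def]
  by (intro Ck_on_exp Ck_on_diff Ck_on_mult Ck_on_const Ck_on_ln Ck_on_conf Ck_on_sinh Ck_on_tau open_half_ball)
    (use conf_pos half_ballD in auto)

lemma pull_eq_0:
  assumes "\<And>x. x \<notin> K \<Longrightarrow> u x = 0" "\<xi> \<notin> Hmap ` K"
  shows "pull u \<xi> = 0"
proof (cases "\<xi> \<in> half_ball")
  case True
  then have "Gmap \<xi> \<notin> K" using assms(2) Hmap_Gmap by (metis image_eqI)
  then show ?thesis using assms(1) by (simp add: pull_def)
qed (simp add: pull_def)

lemma Hmap_image_compact:
  assumes "compact K" "K \<subseteq> V"
  shows "compact (Hmap ` K)" "Hmap ` K \<subseteq> half_ball"
  using assms compact_continuous_image continuous_on_subset continuous_on_Hmap Hmap_facts(1) by blast+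

lemma pull_Cc_infinity:
  assumes K: "compact K" "K \<subseteq> V" and u: "\<And>x. x \<notin> K \<Longrightarrow> u x = 0" "\<And>m. Ck m u"
  shows "pull u \<in> Cc_infinity (half_space k)"
proof (rule Cc_infinityI)
  note K' = Hmap_image_compact[OF K]
  show "compact (Hmap ` K)" by fact
  show "Hmap ` K \<subseteq> half_space k" using K'(2) by (auto simp: half_ball_def)
  show "pull u \<xi> = 0" if "\<xi> \<notin> Hmap ` K" for \<xi>
    by (rule pull_eq_0[OF _ that]) (rule u(1))
  show "Ck m (pull u)" for m
  proof -
    have op: "open (- (Hmap ` K))" using K'(1) compact_imp_closed by auto
    have "Ck_on m half_ball (\<lambda>\<xi>. omega \<xi> * u (Gmap \<xi>))"
      by (rule Ck_on_mult[OF open_half_ball Ck_on_omega Ck_on_compose[OF open_half_ball open_UNIV]])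
        (use u(2) in \<open>simp_all add: Ck_on_Gmap Ck_eq_Ck_on[symmetric]\<close>)
    then have "Ck_on m half_ball (pull u)"
      by (rule Ck_on_cong[OF open_half_ball, rotated]) (simp add: pull_def)
    moreover have "Ck_on m (- (Hmap ` K)) (pull u)"
      by (rule Ck_on_cong[OF op _ Ck_on_const[of _ _ 0]]) (use pull_eq_0[OF u(1)] in auto)
    ultimately have "Ck_on m (half_ball \<union> - (Hmap ` K)) (pull u)"
      by (rule Ck_on_Un[OF open_half_ball op])
    moreover have "half_ball \<union> - (Hmap ` K) = UNIV" using K'(2) by auto
    ultimately show ?thesis by (simp only: Ck_eq_Ck_on)
  qed
qed

lemma pull_nonzero:
  assumes "\<And>x. x \<notin> V \<Longrightarrow> u x = 0" "u \<noteq> (\<lambda>x. 0)"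
  shows "pull u \<noteq> (\<lambda>x. 0)"
proof -
  obtain x where x: "u x \<noteq> 0" using assms(2) by auto
  then have "x \<in> V" using assms(1) by auto
  note H = Hmap_facts[OF this]
  have "pull u (Hmap x) \<noteq> 0" using H x omega_pos[of "Hmap x"] by (simp add: pull_def)
  then show ?thesis by auto
qed

lemma integral_Gmap:
  fixes F :: "real^'n \<Rightarrow> real"
  assumes K: "compact K" "K \<subseteq> V" and F: "continuous_on K F" "\<And>x. x \<notin> K \<Longrightarrow> F x = 0"
    and E: "\<And>\<xi>. \<xi> \<in> half_ball \<Longrightarrow> E \<xi> = conf \<xi> ^ CARD('n) * (\<delta> * sinh (tau \<xi>)) * F (Gmap \<xi>)"
      "\<And>\<xi>. \<xi> \<notin> half_ball \<Longrightarrow> E \<xi> = 0"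
  shows "integrable lborel E" "(LINT \<xi>|lborel. E \<xi>) = (LINT x|lborel. F x)"
proof -
  note K' = Hmap_image_compact[OF K]
  have E0: "E \<xi> = 0" if "\<xi> \<notin> Hmap ` K" for \<xi>
  proof (cases "\<xi> \<in> half_ball")
    case True
    then have "Gmap \<xi> \<notin> K" using that Hmap_Gmap by (metis image_eqI)
    then show ?thesis using E(1)[OF True] F(2) by simp
  qed (rule E(2))
  have "continuous_on (Hmap ` K) (\<lambda>\<xi>. conf \<xi> ^ CARD('n) * (\<delta> * sinh (tau \<xi>)) * F (Gmap \<xi>))"
  proof (intro continuous_intros)
    show "continuous_on (Hmap ` K) conf" "continuous_on (Hmap ` K) tau"
      using Ck_on_imp_continuous[OF Ck_on_conf[of 0]] Ck_on_imp_continuous[OF Ck_on_tau[of 0]]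
        continuous_on_subset K'(2) by blast+
    show "continuous_on (Hmap ` K) (\<lambda>\<xi>. F (Gmap \<xi>))"
      by (rule continuous_on_compose2[OF F(1) continuous_on_subset[OF continuous_on_Gmap K'(2)]])
        (use Hmap_facts(2) K(2) in auto)
  qed
  then have "continuous_on (Hmap ` K) E"
    by (rule continuous_on_eq) (use E(1) K'(2) in auto)
  then have Ei: "integrable lborel E"
    by (rule integrable_compact_support[OF K'(1)]) (rule E0)
  then have Em: "E \<in> borel_measurable borel" by auto
  have Fi: "integrable lborel F" by (rule integrable_compact_support[OF K(1) F])
  have F0: "F y = 0" if "y \<notin> Gmap ` half_ball" for y
    using that F(2) K(2) unfolding Gmap_image by blast
  show "integrable lborel E" by fact
  show "(LINT \<xi>|lborel. E \<xi>) = (LINT x|lborel. F x)"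
    by (rule lborel_integral_change_of_variables(2)[OF open_half_ball has_derivative_Gmap inj_on_Gmap Fi F0 Em])
      (use E abs_det_Gmap' in auto)
qed

text \<open>The weight is the quotient of the two ground states. Hence \<open>pull u\<close> divided
  by the ground state of the half-space is u divided by its own ground state, composed with
  \<open>Gmap\<close>.\<close>

lemma omega_eq_log_ground:
  assumes "\<xi> \<in> half_ball"
  shows "omega \<xi> = exp (ln (\<xi> $ k) - real CARD('n) / 4 * ln ((norm \<xi>)\<^sup>2) - log_ground (Gmap \<xi>))"
proof -
  define n where "n = real CARD('n)"
  note h = half_ballD[OF assms]
  have c: "conf \<xi> > 0" using conf_pos[OF h(2)] .
  note nz = \<theta>_pos_imp[of "Gmap \<xi>"]
  have \<theta>: "\<theta> (Gmap \<xi>) > 0" using Gmap_in_V[OF assms] by (simp add: V_def)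
  have "ln ((norm (Gmap \<xi>))\<^sup>2) + ln ((norm (Gmap \<xi> + Q))\<^sup>2) = ln ((2 * \<rho> * (conf \<xi> * norm \<xi>))\<^sup>2)"
    using nz[OF \<theta>] norm_Gmap_times[OF h(2)]
    by (subst ln_mult_pos[symmetric]) (simp_all add: power_mult_distrib)
  also have "\<dots> = 2 * ln (2 * \<rho>) + 2 * ln (conf \<xi>) + ln ((norm \<xi>)\<^sup>2)"
  proof -
    have "ln ((2 * \<rho> * (conf \<xi> * norm \<xi>))\<^sup>2) = 2 * ln (2 * \<rho> * (conf \<xi> * norm \<xi>))"
      using rho c h(4) by (simp add: ln_realpow)
    also have "ln (2 * \<rho> * (conf \<xi> * norm \<xi>)) = ln (2 * \<rho>) + (ln (conf \<xi>) + ln (norm \<xi>))"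
      using rho c h(4) by (simp only: ln_mult_pos mult_pos_pos zero_less_numeral)
    finally show ?thesis using h(2) by (simp add: ln_norm_power2)
  qed
  finally have ab: "ln ((norm (Gmap \<xi>))\<^sup>2) + ln ((norm (Gmap \<xi> + Q))\<^sup>2)
      = 2 * ln (2 * \<rho>) + 2 * ln (conf \<xi>) + ln ((norm \<xi>)\<^sup>2)" .
  have "P (Gmap \<xi>) * P (Gmap \<xi>) - 1 = (sinh (tau \<xi>))\<^sup>2"
    unfolding P_Gmap[OF h(2)] using cosh_square_eq[of "tau \<xi>"] by (simp add: power2_eq_square)
  then have g: "ln (P (Gmap \<xi>) * P (Gmap \<xi>) - 1) = 2 * ln (sinh (tau \<xi>))"
    using h(6) by (simp add: ln_realpow)
  have t: "ln (\<theta> (Gmap \<xi>)) = ln (conf \<xi>) + ln (\<xi> $ k)"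
    unfolding \<theta>_Gmap[OF h(2)] using c h(1) by (simp add: ln_mult_pos)
  show ?thesis
    unfolding omega_def log_ground_def ab g t n_def[symmetric]
    by (rule arg_cong[where f=exp]) (simp add: field_simps)
qed

lemma has_derivative_hardy_log:
  assumes "\<xi> \<in> half_ball"
  shows "((\<lambda>\<xi>. ln (\<xi> $ k) - real CARD('n) / 4 * ln ((norm \<xi>)\<^sup>2)) has_derivative (\<lambda>w. hardy_field k \<xi> \<bullet> w)) (at \<xi>)"
proof -
  note h = half_ballD[OF assms]
  have "((\<lambda>\<xi>. ln (\<xi> $ k) - real CARD('n) / 4 * ln ((norm \<xi>)\<^sup>2)) has_derivative
      (\<lambda>w. (inverse (\<xi> $ k) *\<^sub>R axis k 1 - (real CARD('n) / 4) *\<^sub>R 2 *\<^sub>R inversion \<xi>) \<bullet> w)) (at \<xi>)"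
    using has_derivative_ln_norm_power2[of \<xi> 0] h
    by (intro has_derivative_inner_diff has_derivative_inner_cmult
        has_derivative_compose_inner[OF has_derivative_component DERIV_ln]) simp_all
  then show ?thesis by (simp add: hardy_field_def)
qed

text \<open>The chain rule for the quotients by the ground states. Pairing with an arbitrary w
  avoids naming the adjoint of the derivative.\<close>

lemma grad_pull:
  assumes \<xi>: "\<xi> \<in> half_ball" and u: "\<And>x. u differentiable (at x)"
  shows "(grad (pull u) \<xi> - pull u \<xi> *\<^sub>R hardy_field k \<xi>) \<bullet> w =
    omega \<xi> * ((grad u (Gmap \<xi>) - u (Gmap \<xi>) *\<^sub>R ground_field (Gmap \<xi>)) \<bullet> Gmap' \<xi> w)"
proof -
  let ?L = "\<lambda>\<xi>. ln (\<xi> $ k) - real CARD('n) / 4 * ln ((norm \<xi>)\<^sup>2) - log_ground (Gmap \<xi>)"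
  have dG: "(Gmap has_derivative Gmap' \<xi>) (at \<xi>)" by (rule has_derivative_Gmap[OF \<xi>])
  have "(?L has_derivative (\<lambda>w. hardy_field k \<xi> \<bullet> w - ground_field (Gmap \<xi>) \<bullet> Gmap' \<xi> w)) (at \<xi>)"
    by (intro has_derivative_diff[OF has_derivative_hardy_log[OF \<xi>]]
        has_derivative_compose[OF dG has_derivative_log_ground[OF Gmap_in_V[OF \<xi>]]])
  from has_derivative_mult[OF has_derivative_exp[OF this] has_derivative_compose[OF dG has_grad[OF u]]]
  have "((\<lambda>\<xi>. exp (?L \<xi>) * u (Gmap \<xi>)) has_derivative (\<lambda>w. exp (?L \<xi>) * (grad u (Gmap \<xi>) \<bullet> Gmap' \<xi> w)
      + exp (?L \<xi>) * (hardy_field k \<xi> \<bullet> w - ground_field (Gmap \<xi>) \<bullet> Gmap' \<xi> w) * u (Gmap \<xi>))) (at \<xi>)"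
    by (simp add: mult.commute mult.left_commute)
  then have "(pull u has_derivative (\<lambda>w. exp (?L \<xi>) * (grad u (Gmap \<xi>) \<bullet> Gmap' \<xi> w)
      + exp (?L \<xi>) * (hardy_field k \<xi> \<bullet> w - ground_field (Gmap \<xi>) \<bullet> Gmap' \<xi> w) * u (Gmap \<xi>))) (at \<xi>)"
    by (rule has_derivative_transform_open[OF open_half_ball \<xi>, rotated])
      (simp add: pull_def omega_eq_log_ground)
  from grad_inner[OF this, of w] show ?thesis
    unfolding omega_eq_log_ground[OF \<xi>, symmetric]
    using \<xi> by (simp add: pull_def inner_diff_left algebra_simps)
qed

lemma norm_grad_pull_le:
  assumes \<xi>: "\<xi> \<in> half_ball" "\<delta> * sinh (tau \<xi>) \<ge> 1" and u: "\<And>x. u differentiable (at x)"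
  shows "(norm (grad (pull u) \<xi> - pull u \<xi> *\<^sub>R hardy_field k \<xi>))\<^sup>2 \<le>
    \<delta> * (conf \<xi> ^ CARD('n) * (\<delta> * sinh (tau \<xi>)) * (norm (grad u (Gmap \<xi>) - u (Gmap \<xi>) *\<^sub>R ground_field (Gmap \<xi>)))\<^sup>2)"
proof -
  define e where "e = grad (pull u) \<xi> - pull u \<xi> *\<^sub>R hardy_field k \<xi>"
  define b where "b = grad u (Gmap \<xi>) - u (Gmap \<xi>) *\<^sub>R ground_field (Gmap \<xi>)"
  define c where "c = conf \<xi> * (\<delta> * sinh (tau \<xi>))"
  have "norm e * norm e = e \<bullet> e" by (simp add: dot_square_norm power2_eq_square)
  \<comment> \<open>Testing with w = e turns the bound on the derivative into one on its
    adjoint.\<close>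
  also have "\<dots> = omega \<xi> * (b \<bullet> Gmap' \<xi> e)"
    using grad_pull[OF \<xi>(1) u] by (simp add: e_def b_def)
  also have "\<dots> \<le> omega \<xi> * (norm b * (c * norm e))"
  proof (rule mult_left_mono)
    have "b \<bullet> Gmap' \<xi> e \<le> norm b * norm (Gmap' \<xi> e)" by (rule norm_cauchy_schwarz)
    also have "\<dots> \<le> norm b * (c * norm e)"
      using norm_Gmap'_le[OF \<xi>] by (intro mult_left_mono) (simp_all add: c_def)
    finally show "b \<bullet> Gmap' \<xi> e \<le> norm b * (c * norm e)" .
  qed (use omega_pos[of \<xi>] in simp)
  finally have "norm e * norm e \<le> (omega \<xi> * norm b * c) * norm e" by (simp add: mult.assoc)
  moreover have "c \<ge> 0" using conf_pos half_ballD[OF \<xi>(1)] delta by (simp add: c_def less_imp_le)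
  ultimately have "norm e \<le> omega \<xi> * norm b * c"
    using omega_pos[of \<xi>] by (cases "norm e = 0") (simp_all add: mult_le_cancel_right)
  then have "(norm e)\<^sup>2 \<le> (omega \<xi> * norm b * c)\<^sup>2" by (rule power_mono) simp
  also have "\<dots> = ((omega \<xi>)\<^sup>2 * (conf \<xi>)\<^sup>2 * sinh (tau \<xi>)) * \<delta>\<^sup>2 * sinh (tau \<xi>) * (norm b)\<^sup>2"
    by (simp add: c_def power_mult_distrib power2_eq_square)
  \<comment> \<open>The weight turns one factor \<delta> sinh \<tau> into the full Jacobian; the
    other \<delta> is the constant in front.\<close>
  also have "\<dots> = \<delta> * (conf \<xi> ^ CARD('n) * (\<delta> * sinh (tau \<xi>)) * (norm b)\<^sup>2)"
    unfolding omega_power2[OF \<xi>(1)] by (simp add: power2_eq_square)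
  finally show ?thesis by (simp add: e_def b_def)
qed

end

section \<open>Transformation of the L^p, Hardy and gradient integrals\<close>

context exterior_ball_map
begin

lemma continuous_on_V: 
  assumes "K \<subseteq> V"
  shows "continuous_on K P" "continuous_on K (\<lambda>x. inverse ((norm x)\<^sup>2))"
    "continuous_on K (\<lambda>x. inverse ((norm (x + Q))\<^sup>2))" "continuous_on K ground_field"
proof -
  show "continuous_on K P"
    by (rule continuous_on_subset[OF Ck_on_imp_continuous[OF Ck_on_P[OF open_V, of 0]] assms]) (simp add: V_def)
  show "continuous_on K (\<lambda>x. inverse ((norm x)\<^sup>2))" "continuous_on K (\<lambda>x. inverse ((norm (x + Q))\<^sup>2))"
    using assms \<theta>_pos_imp by (auto intro!: continuous_intros simp: V_def)
  show "continuous_on K ground_field"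
    using continuous_on_vec_lambda[of K "\<lambda>j x. ground_field x $ j"]
      continuous_on_subset[OF Ck_on_imp_continuous[OF Ck_on_ground_field[of 0]] assms]
    by (simp add: vec_lambda_eta)
qed

lemma sqrt_P_Gmap:
  assumes "\<xi> \<in> half_ball"
  shows "(P (Gmap \<xi>))\<^sup>2 - 1 = (sinh (tau \<xi>))\<^sup>2" "sqrt ((P (Gmap \<xi>))\<^sup>2 - 1) = sinh (tau \<xi>)"
proof -
  show *: "(P (Gmap \<xi>))\<^sup>2 - 1 = (sinh (tau \<xi>))\<^sup>2"
    using half_ballD[OF assms] cosh_square_eq[of "tau \<xi>"] by (simp add: P_Gmap)
  show "sqrt ((P (Gmap \<xi>))\<^sup>2 - 1) = sinh (tau \<xi>)"
    unfolding * using half_ballD(6)[OF assms] by simp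
qed

text \<open>The Jacobian contributes \<delta> g, the p-th power of the weight contributes g^(-p/2),
  and division by the resulting g^(1 - p/2) leaves the weight g^(-(p+2)/2) to be carried by
  F.\<close>

lemma integral_pull_Lp:
  assumes K: "compact K" "K \<subseteq> V" and u: "\<And>x. x \<notin> K \<Longrightarrow> u x = 0" "continuous_on K u" and p: "p > 0"
  defines "a \<equiv> p * (real CARD('n) - 2) / 2 - real CARD('n)"
  defines "F \<equiv> \<lambda>x. (norm x * (norm (x + Q) / (2 * \<rho>))) powr a * sqrt ((P x)\<^sup>2 - 1) powr (- ((p + 2) / 2)) * \<bar>u x\<bar> powr p"
  shows "integrable lborel F"
    and "\<delta> * (LINT \<xi>|lborel. norm \<xi> powr a * \<bar>pull u \<xi>\<bar> powr p) = (LINT x|lborel. F x)"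
proof -
  have cF: "continuous_on K F"
  proof -
    have "sqrt ((P x)\<^sup>2 - 1) \<noteq> 0" "norm x * (norm (x + Q) / (2 * \<rho>)) \<noteq> 0" if "x \<in> K" for x
    proof -
      have x: "x \<in> V" using that K(2) by auto
      then have "\<theta> x > 0" by (simp add: V_def)
      from \<theta>_pos_imp[OF this] show "norm x * (norm (x + Q) / (2 * \<rho>)) \<noteq> 0" using rho by simp
      show "sqrt ((P x)\<^sup>2 - 1) \<noteq> 0" using P_gt_1[OF x] by (simp add: power2_eq_square)
    qed
    moreover have "continuous_on K (\<lambda>x. \<bar>u x\<bar> powr p)"
      by (rule continuous_on_powr') (use u(2) p in \<open>auto intro!: continuous_intros\<close>)
    moreover have "continuous_on K (\<lambda>x. (norm x * (norm (x + Q) / (2 * \<rho>))) powr a)"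
      using rho calculation(2) by (intro continuous_intros) simp_all
    moreover have "continuous_on K (\<lambda>x. sqrt ((P x)\<^sup>2 - 1) powr (- ((p + 2) / 2)))"
      using calculation(1) by (intro continuous_intros continuous_on_V(1)[OF K(2)]) simp_all
    ultimately show ?thesis
      unfolding F_def by (intro continuous_on_mult)
  qed
  have F0: "F x = 0" if "x \<notin> K" for x using u(1)[OF that] by (simp add: F_def)
  show "integrable lborel F" by (rule integrable_compact_support[OF K(1) cF F0])
  have "(LINT \<xi>|lborel. \<delta> * (norm \<xi> powr a * \<bar>pull u \<xi>\<bar> powr p)) = (LINT x|lborel. F x)"
  proof (rule integral_Gmap(2)[OF K cF F0])
    fix \<xi> assume \<xi>: "\<xi> \<in> half_ball"
    note h = half_ballD[OF \<xi>]
    have c: "conf \<xi> > 0" using conf_pos[OF h(2)] .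
    define g where "g = sinh (tau \<xi>)"
    have g: "g > 0" using h(6) by (simp add: g_def)
    have "(norm (Gmap \<xi>) * (norm (Gmap \<xi> + Q) / (2 * \<rho>)))\<^sup>2 = (conf \<xi> * norm \<xi>)\<^sup>2"
      using norm_Gmap_times[OF h(2)] rho by (simp add: power_mult_distrib power_divide)
    then have N: "norm (Gmap \<xi>) * (norm (Gmap \<xi> + Q) / (2 * \<rho>)) = conf \<xi> * norm \<xi>"
      using c rho by (subst (asm) power2_eq_iff_nonneg) auto
    have "conf \<xi> ^ CARD('n) * (\<delta> * g) * F (Gmap \<xi>)
      = \<delta> * (norm \<xi> powr a * (conf \<xi> powr (real CARD('n) + a) * g powr (1 - (p + 2) / 2)) * \<bar>u (Gmap \<xi>)\<bar> powr p)"
    proof -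
      have e1: "(conf \<xi> * norm \<xi>) powr a = conf \<xi> powr a * norm \<xi> powr a"
        using c by (simp add: powr_mult)
      have e2: "conf \<xi> powr (real CARD('n) + a) = conf \<xi> ^ CARD('n) * conf \<xi> powr a"
        using c by (simp add: powr_add powr_realpow)
      have "1 - (p + 2) / 2 = 1 + (- ((p + 2) / 2))" by simp
      then have e3: "g powr (1 - (p + 2) / 2) = g * g powr (- ((p + 2) / 2))"
        using g by (simp only: powr_add powr_one less_imp_le)
      show ?thesis
        unfolding F_def N sqrt_P_Gmap(2)[OF \<xi>] g_def[symmetric] e1 e2 e3 by (simp only: mult_ac)
    qed
    \<comment> \<open>The exponents match because n + a = p (n/2 - 1) and 1 - (p+2)/2 =
      -p/2.\<close>
    also have "conf \<xi> powr (real CARD('n) + a) * g powr (1 - (p + 2) / 2) = omega \<xi> powr p"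
    proof -
      have "conf \<xi> powr (real CARD('n) + a) * g powr (1 - (p + 2) / 2)
          = exp ((real CARD('n) + a) * ln (conf \<xi>) + (1 - (p + 2) / 2) * ln g)"
        using c g by (simp add: powr_def exp_add)
      moreover have "omega \<xi> powr p = exp (p * ((real CARD('n) / 2 - 1) * ln (conf \<xi>) - 1 / 2 * ln g))"
        by (simp add: omega_def powr_def g_def)
      moreover have "(real CARD('n) + a) * ln (conf \<xi>) + (1 - (p + 2) / 2) * ln g
          = p * ((real CARD('n) / 2 - 1) * ln (conf \<xi>) - 1 / 2 * ln g)"
        by (simp add: a_def algebra_simps add_divide_distrib diff_divide_distrib)
      ultimately show ?thesis by simp
    qed
    also have "norm \<xi> powr a * omega \<xi> powr p * \<bar>u (Gmap \<xi>)\<bar> powr p = norm \<xi> powr a * \<bar>pull u \<xi>\<bar> powr p"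
      using omega_pos[of \<xi>] \<xi> by (simp add: pull_def abs_mult powr_mult)
    finally show "\<delta> * (norm \<xi> powr a * \<bar>pull u \<xi>\<bar> powr p) = conf \<xi> ^ CARD('n) * (\<delta> * sinh (tau \<xi>)) * F (Gmap \<xi>)"
      by (simp only: g_def)
  qed (simp_all add: pull_def)
  then show "\<delta> * (LINT \<xi>|lborel. norm \<xi> powr a * \<bar>pull u \<xi>\<bar> powr p) = (LINT x|lborel. F x)" by simp
qed

text \<open>The weight is |grad P|^2/g^2. Along the map it equals 1/(conf |\<xi>| g)^2, and the
  Jacobian supplies what is missing to omega^2/|\<xi>|^2, up to \<delta>.\<close>

lemma integral_pull_Hardy:
  assumes K: "compact K" "K \<subseteq> V" and u: "\<And>x. x \<notin> K \<Longrightarrow> u x = 0" "continuous_on K u"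
  defines "F \<equiv> \<lambda>x. (u x)\<^sup>2 * (4 * \<rho>\<^sup>2 * inverse ((norm x)\<^sup>2) * inverse ((norm (x + Q))\<^sup>2)) / ((P x)\<^sup>2 - 1)"
  shows "integrable lborel F"
    and "(LINT x|lborel. F x) = \<delta> * (LINT \<xi>|lborel. (pull u \<xi>)\<^sup>2 / (norm \<xi>)\<^sup>2)"
proof -
  have P1: "(P x)\<^sup>2 - 1 \<noteq> 0" if "x \<in> K" for x
    using P_gt_1[of x] that K(2) by (auto simp: power2_eq_square)
  have cF: "continuous_on K F"
    unfolding F_def by (intro continuous_intros u(2) continuous_on_V K(2) ballI P1)
  have F0: "F x = 0" if "x \<notin> K" for x using u(1)[OF that] by (simp add: F_def)
  show "integrable lborel F" by (rule integrable_compact_support[OF K(1) cF F0])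
  have "(LINT \<xi>|lborel. \<delta> * ((pull u \<xi>)\<^sup>2 / (norm \<xi>)\<^sup>2)) = (LINT x|lborel. F x)"
  proof (rule integral_Gmap(2)[OF K cF F0])
    fix \<xi> assume \<xi>: "\<xi> \<in> half_ball"
    note h = half_ballD[OF \<xi>]
    have c: "conf \<xi> > 0" using conf_pos[OF h(2)] .
    have "inverse ((norm (Gmap \<xi>))\<^sup>2) * inverse ((norm (Gmap \<xi> + Q))\<^sup>2)
        = inverse ((4 * \<rho>\<^sup>2) * (conf \<xi> * norm \<xi>)\<^sup>2)"
      using norm_Gmap_times[OF h(2)] by (simp only: inverse_mult_distrib[symmetric])
    then have "F (Gmap \<xi>) = (u (Gmap \<xi>))\<^sup>2 * (4 * \<rho>\<^sup>2 * inverse ((4 * \<rho>\<^sup>2) * (conf \<xi> * norm \<xi>)\<^sup>2)) / (sinh (tau \<xi>))\<^sup>2"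
      unfolding F_def sqrt_P_Gmap(1)[OF \<xi>] by (simp only: mult.assoc)
    also have "\<dots> = (u (Gmap \<xi>))\<^sup>2 / ((conf \<xi>)\<^sup>2 * (norm \<xi>)\<^sup>2 * (sinh (tau \<xi>))\<^sup>2)"
    proof -
      have "4 * \<rho>\<^sup>2 * inverse (4 * \<rho>\<^sup>2 * z) = inverse z" for z using rho by simp
      then show ?thesis
        using c h(2) less_imp_neq[OF h(6)] by (simp only: power_mult_distrib) (simp add: field_simps)
    qed
    finally show "\<delta> * ((pull u \<xi>)\<^sup>2 / (norm \<xi>)\<^sup>2) = conf \<xi> ^ CARD('n) * (\<delta> * sinh (tau \<xi>)) * F (Gmap \<xi>)"
      unfolding omega_power2[OF \<xi>, symmetric] using c h(2) \<xi> less_imp_neq[OF h(6)]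
      by (simp add: pull_def power_mult_distrib power2_eq_square)
  qed (simp_all add: pull_def)
  then show "(LINT x|lborel. F x) = \<delta> * (LINT \<xi>|lborel. (pull u \<xi>)\<^sup>2 / (norm \<xi>)\<^sup>2)"
    by (simp only: integral_mult_right_zero)
qed

text \<open>Only an inequality holds, since tangential derivatives are stretched less than radial
  ones. The bound on g is needed only on K; elsewhere both integrands are controlled by the
  support.\<close>

lemma integral_pull_grad:
  assumes K: "compact K" "K \<subseteq> V" and u: "\<And>x. x \<notin> K \<Longrightarrow> u x = 0" "\<And>m. Ck m u"
    and g: "\<And>x. x \<in> K \<Longrightarrow> 1 \<le> \<delta> * sqrt ((P x)\<^sup>2 - 1)"
  shows "(LINT \<xi>|lborel. (norm (grad (pull u) \<xi> - pull u \<xi> *\<^sub>R hardy_field k \<xi>))\<^sup>2)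
    \<le> \<delta> * (LINT x|lborel. (norm (grad u x - u x *\<^sub>R ground_field x))\<^sup>2)"
proof -
  define F where "F = (\<lambda>x. (norm (grad u x - u x *\<^sub>R ground_field x))\<^sup>2)"
  define E where "E = (\<lambda>\<xi>. if \<xi> \<in> half_ball then conf \<xi> ^ CARD('n) * (\<delta> * sinh (tau \<xi>)) * F (Gmap \<xi>) else 0)"
  have C1: "Ck (Suc 0) u" by (rule u(2))
  then have du: "u differentiable (at x)" for x by simp
  have "continuous_on UNIV u"
    using Ck_on_imp_continuous[of "Suc 0" UNIV u] C1 Ck_eq_Ck_on by blast
  then have cu: "continuous_on K u" by (rule continuous_on_subset) simp
  have "continuous_on UNIV (grad u)"
    unfolding grad_def using C1 by (intro continuous_on_vec_lambda) simp
  then have cg: "continuous_on K (grad u)" by (rule continuous_on_subset) simp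
  have cF: "continuous_on K F"
    unfolding F_def by (intro continuous_intros cu cg continuous_on_V K(2))
  have F0: "F x = 0" if "x \<notin> K" for x
    using grad_eq_0_outside[OF K(1), of u x] u(1) that by (simp add: F_def)
  note I = integral_Gmap[OF K cF F0, of E]
  have EI: "integrable lborel E" "(LINT \<xi>|lborel. E \<xi>) = (LINT x|lborel. F x)"
    using I by (simp_all add: E_def)
  have "(LINT \<xi>|lborel. (norm (grad (pull u) \<xi> - pull u \<xi> *\<^sub>R hardy_field k \<xi>))\<^sup>2) \<le> (LINT \<xi>|lborel. \<delta> * E \<xi>)"
  proof (rule integral_mono)
    show "integrable lborel (\<lambda>\<xi>. (norm (grad (pull u) \<xi> - pull u \<xi> *\<^sub>R hardy_field k \<xi>))\<^sup>2)"
      by (rule hardy_identity(1)[OF pull_Cc_infinity[OF K u]])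
    show "integrable lborel (\<lambda>\<xi>. \<delta> * E \<xi>)" using EI(1) by simp
    fix \<xi>
    note K' = Hmap_image_compact[OF K]
    show "(norm (grad (pull u) \<xi> - pull u \<xi> *\<^sub>R hardy_field k \<xi>))\<^sup>2 \<le> \<delta> * E \<xi>"
    proof (cases "\<xi> \<in> Hmap ` K")
      case True
      then have \<xi>: "\<xi> \<in> half_ball" and GK: "Gmap \<xi> \<in> K"
        using K' Hmap_facts(2) K(2) by auto
      have "1 \<le> \<delta> * sinh (tau \<xi>)" using g[OF GK] by (simp add: sqrt_P_Gmap(2)[OF \<xi>])
      from norm_grad_pull_le[OF \<xi> this du] show ?thesis using \<xi> by (simp add: E_def F_def)
    next
      case False
      have p0: "pull u \<xi> = 0" if "\<xi> \<notin> Hmap ` K" for \<xi> using pull_eq_0[OF u(1) that] by simp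
      have "grad (pull u) \<xi> = 0" by (rule grad_eq_0_outside[OF K'(1) p0 False])
      moreover have "E \<xi> \<ge> 0"
      proof (cases "\<xi> \<in> half_ball")
        case True
        note h = half_ballD[OF True]
        show ?thesis
          using less_imp_le[OF h(6)] less_imp_le[OF conf_pos[OF h(2)]] less_imp_le[OF delta] True
          unfolding E_def F_def by (simp del: sinh_real_nonneg_iff)
      qed (simp add: E_def)
      ultimately show ?thesis using p0[OF False] delta by simp
    qed
  qed
  also have "\<dots> = \<delta> * (LINT x|lborel. F x)" using EI(2) by simp
  finally show ?thesis by (simp add: F_def)
qed

text \<open>The hypothesis on |x+Q|/(2\<rho>) states that the surplus 3/(4 g^4) pays for replacing
  |grad P|^2 by 1/|x|^2 in the Hardy term; the critical term 1/(4 g^2) is kept for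
  \<open>S_star\<close>.\<close>

lemma Hardy_Sobolev_pull:
  assumes K: "compact K" "K \<subseteq> V" and u: "\<And>x. x \<notin> K \<Longrightarrow> u x = 0" "\<And>m. Ck m u" "u \<noteq> (\<lambda>x. 0)"
    and g: "\<And>x. x \<in> K \<Longrightarrow> 1 \<le> \<delta> * sqrt ((P x)\<^sup>2 - 1)"
    and d: "\<And>x. x \<in> K \<Longrightarrow> (real CARD('n))\<^sup>2 * ((norm (x + Q) / (2 * \<rho>))\<^sup>2 - 1) * ((P x)\<^sup>2 - 1)\<^sup>2 \<le> 3"
    and \<gamma>: "\<delta> = real CARD('n) - 2 * \<gamma>"
  shows "(real CARD('n))\<^sup>2 / 4 * (LINT x|lborel. (u x)\<^sup>2 / (norm x)\<^sup>2)
     + inverse \<delta> * (S_star k p \<gamma> * (LINT \<xi>|lborel. norm \<xi> powr (p * (real CARD('n) - 2) / 2 - real CARD('n)) * \<bar>pull u \<xi>\<bar> powr p) powr (2 / p))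
     \<le> (LINT x|lborel. (norm (grad u x))\<^sup>2)"
proof -
  define n where "n = real CARD('n)"
  define \<kappa> where "\<kappa> = (\<lambda>x. 4 * \<rho>\<^sup>2 * inverse ((norm x)\<^sup>2) * inverse ((norm (x + Q))\<^sup>2))"
  have C1: "Ck (Suc 0) u" by (rule u(2))
  have "continuous_on UNIV u"
    using Ck_on_imp_continuous[of "Suc 0" UNIV u] C1 Ck_eq_Ck_on by blast
  then have cu: "continuous_on K u" by (rule continuous_on_subset) simp
  obtain dv where dv: "\<And>x. x \<in> V \<Longrightarrow> has_div ground_field (dv x) x \<and> dv x + (norm (ground_field x))\<^sup>2 =
      - (\<kappa> x * (n\<^sup>2 / 4 + ((P x)\<^sup>2 + 2) / (4 * ((P x)\<^sup>2 - 1)\<^sup>2)))"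
    using ground_field_ground_state unfolding n_def \<kappa>_def by metis
  note gs = ground_state_identity[OF open_V K C1 _ Ck_on_ground_field, of dv]
  have gs3: "integrable lborel (\<lambda>x. (u x)\<^sup>2 * (dv x + (norm (ground_field x))\<^sup>2))"
    and gs4: "(LINT x|lborel. (norm (grad u x))\<^sup>2) = (LINT x|lborel. (norm (grad u x - u x *\<^sub>R ground_field x))\<^sup>2)
       - (LINT x|lborel. (u x)\<^sup>2 * (dv x + (norm (ground_field x))\<^sup>2))"
    using gs(3,4) u(1) dv by blast+
  let ?F = "\<lambda>x. (u x)\<^sup>2 * \<kappa> x / ((P x)\<^sup>2 - 1)"
  have HF: "integrable lborel ?F" "(LINT x|lborel. ?F x) = \<delta> * (LINT \<xi>|lborel. (pull u \<xi>)\<^sup>2 / (norm \<xi>)\<^sup>2)"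
    unfolding \<kappa>_def using integral_pull_Hardy[OF K u(1) cu] by blast+
  have Hi: "integrable lborel (\<lambda>x. (u x)\<^sup>2 / (norm x)\<^sup>2)"
  proof (rule integrable_compact_support[OF K(1)])
    show "continuous_on K (\<lambda>x. (u x)\<^sup>2 / (norm x)\<^sup>2)"
      unfolding divide_inverse by (intro continuous_intros cu continuous_on_V K(2))
  qed (simp add: u(1))
  have "n\<^sup>2 / 4 * (LINT x|lborel. (u x)\<^sup>2 / (norm x)\<^sup>2) + 1 / 4 * (LINT x|lborel. ?F x)
    = (LINT x|lborel. n\<^sup>2 / 4 * ((u x)\<^sup>2 / (norm x)\<^sup>2) + 1 / 4 * ?F x)"
    unfolding integral_mult_right_zero[symmetric]
    by (rule Bochner_Integration.integral_add[symmetric]) (intro integrable_mult_right Hi HF(1))+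
  also have "\<dots> \<le> (LINT x|lborel. - ((u x)\<^sup>2 * (dv x + (norm (ground_field x))\<^sup>2)))"
  proof (rule integral_mono)
    show "integrable lborel (\<lambda>x. n\<^sup>2 / 4 * ((u x)\<^sup>2 / (norm x)\<^sup>2) + 1 / 4 * ?F x)"
      by (intro Bochner_Integration.integrable_add integrable_mult_right Hi HF(1))
    show "integrable lborel (\<lambda>x. - ((u x)\<^sup>2 * (dv x + (norm (ground_field x))\<^sup>2)))"
      using gs3 by simp
    fix x
    show "n\<^sup>2 / 4 * ((u x)\<^sup>2 / (norm x)\<^sup>2) + 1 / 4 * ?F x \<le> - ((u x)\<^sup>2 * (dv x + (norm (ground_field x))\<^sup>2))"
    proof (cases "x \<in> K")
      case True
      then have xV: "x \<in> V" using K(2) by auto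
      then have \<theta>: "\<theta> x > 0" by (simp add: V_def)
      note nz = \<theta>_pos_imp[OF \<theta>]
      define q where "q = (P x)\<^sup>2 - 1"
      define D where "D = (norm (x + Q) / (2 * \<rho>))\<^sup>2"
      have q: "q > 0" using P_gt_1[OF xV] by (simp add: q_def power2_eq_square)
      have D: "D > 0" using nz rho by (simp add: D_def)
      have \<kappa>D: "\<kappa> x = inverse ((norm x)\<^sup>2) * inverse D"
      proof -
        have "D = (norm (x + Q))\<^sup>2 / (4 * \<rho>\<^sup>2)" by (simp add: D_def power_divide power_mult_distrib)
        then have "inverse D = 4 * \<rho>\<^sup>2 * inverse ((norm (x + Q))\<^sup>2)" using D nz(2) rho by (simp add: field_simps)
        then show ?thesis by (simp only: \<kappa>_def mult_ac)
      qed
      \<comment> \<open>Here q = g^2 and |grad P|^2 = 1/(|x|^2 D), so the goal amounts to n^2 D/4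
        \<le> n^2/4 + 3/(4 q^2).\<close>
      have "n\<^sup>2 * (D - 1) * q\<^sup>2 \<le> 3" using d[OF True] by (simp add: n_def D_def q_def)
      then have "n\<^sup>2 * (D - 1) \<le> 3 / q\<^sup>2" using q by (simp add: pos_le_divide_eq)
      then have "n\<^sup>2 / 4 * D \<le> n\<^sup>2 / 4 + 3 / (4 * q\<^sup>2)" by (simp add: algebra_simps)
      then have "n\<^sup>2 / 4 * D * inverse D \<le> (n\<^sup>2 / 4 + 3 / (4 * q\<^sup>2)) * inverse D"
        using D by (intro mult_right_mono) auto
      moreover have "n\<^sup>2 / 4 * D * inverse D = n\<^sup>2 / 4" using D by simp
      ultimately have "n\<^sup>2 / 4 \<le> (n\<^sup>2 / 4 + 3 / (4 * q\<^sup>2)) * inverse D" by linarith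
      then have "n\<^sup>2 / 4 * inverse ((norm x)\<^sup>2) \<le> (n\<^sup>2 / 4 + 3 / (4 * q\<^sup>2)) * inverse D * inverse ((norm x)\<^sup>2)"
        by (rule mult_right_mono) simp
      then have "n\<^sup>2 / 4 * inverse ((norm x)\<^sup>2) \<le> \<kappa> x * (n\<^sup>2 / 4 + 3 / (4 * q\<^sup>2))"
        by (simp add: \<kappa>D mult_ac)
      moreover have "(q + 3) / (4 * q\<^sup>2) = 1 / (4 * q) + 3 / (4 * q\<^sup>2)"
        using q by (simp add: field_simps power2_eq_square)
      ultimately have "n\<^sup>2 / 4 * inverse ((norm x)\<^sup>2) + \<kappa> x * (1 / (4 * q)) \<le> \<kappa> x * (n\<^sup>2 / 4 + (q + 3) / (4 * q\<^sup>2))"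
        by (simp add: distrib_left)
      then have "(u x)\<^sup>2 * (n\<^sup>2 / 4 * inverse ((norm x)\<^sup>2) + \<kappa> x * (1 / (4 * q))) \<le> (u x)\<^sup>2 * (\<kappa> x * (n\<^sup>2 / 4 + (q + 3) / (4 * q\<^sup>2)))"
        by (rule mult_left_mono) simp
      moreover have "dv x + (norm (ground_field x))\<^sup>2 = - (\<kappa> x * (n\<^sup>2 / 4 + (q + 3) / (4 * q\<^sup>2)))"
        using dv[OF xV] by (simp add: q_def)
      ultimately show ?thesis
        unfolding q_def[symmetric] by (simp only: divide_inverse) (simp add: algebra_simps)
    qed (simp add: u(1))
  qed
  finally have A: "n\<^sup>2 / 4 * (LINT x|lborel. (u x)\<^sup>2 / (norm x)\<^sup>2) + 1 / 4 * (LINT x|lborel. ?F x)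
     + (LINT x|lborel. (norm (grad u x - u x *\<^sub>R ground_field x))\<^sup>2) \<le> (LINT x|lborel. (norm (grad u x))\<^sup>2)"
    using gs4 by simp
  define J where "J = (LINT \<xi>|lborel. (pull u \<xi>)\<^sup>2 / (norm \<xi>)\<^sup>2)"
  define T where "T = (LINT \<xi>|lborel. (norm (grad (pull u) \<xi> - pull u \<xi> *\<^sub>R hardy_field k \<xi>))\<^sup>2)"
  have vC: "pull u \<in> Cc_infinity (half_space k)" by (rule pull_Cc_infinity[OF K u(1,2)])
  have "pull u \<noteq> (\<lambda>x. 0)" by (rule pull_nonzero) (use u K(2) in auto)
  from S_star_Cc_infinity(2)[OF vC this, of p \<gamma>]
  have "S_star k p \<gamma> * (LINT \<xi>|lborel. norm \<xi> powr (p * (n - 2) / 2 - n) * \<bar>pull u \<xi>\<bar> powr p) powr (2 / p)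
      \<le> T + n\<^sup>2 / 4 * J - \<gamma> * (n - \<gamma>) * J"
    unfolding hardy_identity(3)[OF vC] n_def[symmetric] J_def T_def .
  \<comment> \<open>The coefficient is n^2/4 - \<gamma>(n - \<gamma>) = (n/2 - \<gamma>)^2.\<close>
  also have "\<dots> = T + \<delta>\<^sup>2 / 4 * J"
    unfolding \<gamma> n_def[symmetric] by (simp add: power2_eq_square field_simps)
  finally have "inverse \<delta> * (S_star k p \<gamma> * (LINT \<xi>|lborel. norm \<xi> powr (p * (n - 2) / 2 - n) * \<bar>pull u \<xi>\<bar> powr p) powr (2 / p))
      \<le> inverse \<delta> * (T + \<delta>\<^sup>2 / 4 * J)"
    using delta by (intro mult_left_mono) auto
  also have "\<dots> = inverse \<delta> * T + \<delta> / 4 * J"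
    using delta by (simp add: distrib_left power2_eq_square)
  also have "inverse \<delta> * T \<le> (LINT x|lborel. (norm (grad u x - u x *\<^sub>R ground_field x))\<^sup>2)"
  proof -
    have "T \<le> \<delta> * (LINT x|lborel. (norm (grad u x - u x *\<^sub>R ground_field x))\<^sup>2)"
      unfolding T_def by (rule integral_pull_grad[OF K u(1,2) g])
    then show ?thesis using delta by (simp add: field_simps)
  qed
  also have "\<delta> / 4 * J = 1 / 4 * (LINT x|lborel. ?F x)"
    using HF(2) by (simp add: J_def)
  finally show ?thesis using A unfolding n_def by linarith
qed

end

section \<open>The choice of constants\<close>

text \<open>The fourth power matches g^4 in the surplus; any logarithmic power is beaten by the
  factor t.\<close>

lemma mult_log_power4_le:
  fixes t B :: real
  assumes "0 < t" "t \<le> 1" "0 \<le> B"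
  shows "t * (B - ln t) ^ 4 \<le> (B + 4) ^ 4"
proof -
  \<comment> \<open>The fourth root of t: then -ln t = -4 ln w \<le> 4/w, and the fourth power of
    1/w cancels t exactly.\<close>
  define w where "w = exp (ln t / 4)"
  have w: "0 < w" "w \<le> 1" using assms by (simp_all add: w_def)
  have "w ^ 4 = exp (of_nat 4 * (ln t / 4))" unfolding w_def by (rule exp_of_nat_mult[symmetric])
  then have w4: "w ^ 4 = t" using assms(1) by simp
  have "- ln w \<le> inverse w - 1" using ln_le_minus_one[of "inverse w"] w by (simp add: ln_inverse)
  moreover have "ln t = 4 * ln w" by (simp add: w_def)
  ultimately have "- ln t \<le> 4 * inverse w" by linarith
  moreover have "B * 1 \<le> B * inverse w"
    using assms(3) w by (intro mult_left_mono) (simp_all add: one_le_inverse)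
  ultimately have "B - ln t \<le> (B + 4) * inverse w" by (simp add: distrib_right)
  moreover have "ln t \<le> 0" using assms by simp
  then have "0 \<le> B - ln t" using assms(3) by linarith
  ultimately have "(B - ln t) ^ 4 \<le> ((B + 4) * inverse w) ^ 4" by (intro power_mono)
  also have "\<dots> = (B + 4) ^ 4 * inverse t" by (simp only: power_mult_distrib power_inverse w4)
  finally have "t * (B - ln t) ^ 4 \<le> t * ((B + 4) ^ 4 * inverse t)"
    using assms(1) by (intro mult_left_mono) auto
  also have "\<dots> = (B + 4) ^ 4" using assms(1) by simp
  finally show ?thesis .
qed

context exterior_ball
begin

lemma \<theta>_pos_outside_ball:
  assumes "open \<Omega>" "ball (- \<rho> *\<^sub>R axis k 1) \<rho> \<subseteq> - closure \<Omega>" "x \<in> \<Omega>"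
  shows "\<theta> x > 0"
proof -
  let ?e = "axis k 1 :: real^'n"
  have "\<Omega> \<inter> ball (- \<rho> *\<^sub>R ?e) \<rho> = {}" using assms(2) closure_subset by blast
  \<comment> \<open>Openness of the domain excludes the sphere as well, which makes the inequality
    for \<theta> strict.\<close>
  then have "\<Omega> \<inter> closure (ball (- \<rho> *\<^sub>R ?e) \<rho>) = {}"
    using open_Int_closure_eq_empty[OF assms(1)] by blast
  then have "x \<notin> cball (- \<rho> *\<^sub>R ?e) \<rho>" using assms(3) rho by auto
  moreover have "dist (- \<rho> *\<^sub>R ?e) x = norm (x + \<rho> *\<^sub>R ?e)"
    unfolding dist_commute[of _ x] by (simp add: dist_norm)
  ultimately have "\<rho> < norm (x + \<rho> *\<^sub>R ?e)" by simp
  then have "\<rho>\<^sup>2 < (norm (x + \<rho> *\<^sub>R ?e))\<^sup>2" using rho by (intro power_strict_mono) auto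
  also have "\<dots> = x \<bullet> x + 2 * \<rho> * x $ k + \<rho>\<^sup>2"
    unfolding power2_norm_eq_inner
    by (simp add: inner_add_left inner_add_right inner_axis inner_commute power2_eq_square)
  also have "\<dots> = 2 * \<rho> * \<theta> x + \<rho>\<^sup>2"
    using rho by (simp add: \<theta>_def dot_square_norm field_simps)
  finally show ?thesis using rho by (simp add: zero_less_mult_iff)
qed

text \<open>Here P = A + ln d - ln(|x|/D) with d = |x+Q|/(2\<rho>). Since |x| \<le> \<rho>, d lies
  between 1/2 and 3/2, so that ln d lies between -1 and 1.\<close>

lemma P_bounds:
  assumes \<theta>: "\<theta> x > 0" and x: "norm x \<le> D" "D \<le> \<rho>" and MA: "M = D * exp A"
  shows "A - 1 \<le> P x" "P x \<le> A + 1 - ln (norm x / D)"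
proof -
  define d where "d = norm (x + Q) / (2 * \<rho>)"
  note nz = \<theta>_pos_imp[OF \<theta>]
  have nx: "norm x > 0" using nz by simp
  then have D: "D > 0" using x by linarith
  have nQ: "norm Q = 2 * \<rho>" using rho by (simp add: Q_def)
  have "norm (x + Q) \<le> 3 * \<rho>" using norm_triangle_ineq[of x Q] x nQ by linarith
  then have d1: "d \<le> 3 / 2" using rho by (simp add: d_def field_simps)
  have "\<rho> \<le> norm (x + Q)" using norm_triangle_ineq2[of Q "- x"] x nQ by (simp add: add.commute)
  then have d2: "1 / 2 \<le> d" using rho by (simp add: d_def field_simps)
  have "ln d \<le> 1" using ln_le_minus_one[of d] d1 d2 by simp
  moreover have "ln (inverse d) \<le> inverse d - 1" using d2 by (intro ln_le_minus_one) simp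
  then have "- 1 \<le> ln d"
  proof -
    have "inverse d \<le> 2" using d2 by (simp add: inverse_eq_divide field_simps)
    then show ?thesis using \<open>ln (inverse d) \<le> inverse d - 1\<close> d2 by (simp add: ln_inverse)
  qed
  moreover have "P x = A + ln d - ln (norm x / D)"
  proof -
    have "ln M = ln D + A" using D by (simp add: MA ln_mult_pos)
    moreover have "ln d = ln (norm (x + Q)) - ln (2 * \<rho>)" using nz rho by (simp add: d_def ln_divide_pos)
    moreover have "ln (norm x / D) = ln (norm x) - ln D" using nx D by (simp add: ln_divide_pos)
    ultimately show ?thesis using nz by (simp add: P_def ln_realpow)
  qed
  moreover have "ln (norm x / D) \<le> 0" using nx D x by (simp add: ln_le_zero_iff)
  ultimately show "A - 1 \<le> P x" "P x \<le> A + 1 - ln (norm x / D)" by linarith+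
qed

text \<open>With t = |x|/D the defect is at most 2 r t, while P \<le> A + 1 - ln t. The product with
  P^4 is therefore bounded by a multiple of r, uniformly down to t = 0.\<close>

lemma conformal_defect_le:
  assumes \<theta>: "\<theta> x > 0" and x: "norm x \<le> D" "D \<le> r * \<rho>" "r \<le> 1" and MA: "M = D * exp A" "A \<ge> 2"
    and r: "2 * n\<^sup>2 * r * (A + 5) ^ 4 \<le> 3" "r > 0"
  shows "n\<^sup>2 * ((norm (x + Q) / (2 * \<rho>))\<^sup>2 - 1) * ((P x)\<^sup>2 - 1)\<^sup>2 \<le> 3"
proof -
  define t where "t = norm x / D"
  have nx: "norm x > 0" using \<theta>_pos_imp[OF \<theta>] by simp
  then have D: "D > 0" using x by linarith
  have "r * \<rho> \<le> 1 * \<rho>" using x(3) rho by (intro mult_right_mono) auto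
  then have D\<rho>: "D \<le> \<rho>" using x(2) by simp
  have t: "0 < t" "t \<le> 1" using nx D x by (simp_all add: t_def)
  define y where "y = norm x / \<rho>"
  have y: "0 \<le> y" "y \<le> 1" using x D\<rho> rho by (simp_all add: y_def)
  have yt: "y \<le> r * t"
  proof -
    have "D / \<rho> \<le> r" using x(2) rho by (simp add: field_simps)
    then have "D / \<rho> * t \<le> r * t" using t by (intro mult_right_mono) auto
    then show ?thesis using D by (simp add: t_def y_def)
  qed
  have "norm (x + Q) / (2 * \<rho>) \<le> 1 + y / 2"
    using norm_triangle_ineq[of x Q] rho by (simp add: Q_def y_def field_simps)
  then have "(norm (x + Q) / (2 * \<rho>))\<^sup>2 \<le> (1 + y / 2)\<^sup>2"
    using rho by (intro power_mono) auto
  also have "(1 + y / 2)\<^sup>2 = 1 + y + y * y / 4"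
    by (simp add: power2_eq_square algebra_simps)
  finally have "(norm (x + Q) / (2 * \<rho>))\<^sup>2 \<le> 1 + y + y * y / 4" .
  moreover have "y * y \<le> y * 1" using y by (intro mult_left_mono)
  ultimately have d: "(norm (x + Q) / (2 * \<rho>))\<^sup>2 - 1 \<le> 2 * (r * t)"
    using yt y(1) by linarith
  have P: "1 \<le> P x" "P x \<le> A + 1 - ln t" 
    using P_bounds[OF \<theta> x(1) D\<rho> MA(1)] MA(2) by (auto simp: t_def)
  have "((P x)\<^sup>2 - 1)\<^sup>2 \<le> ((P x)\<^sup>2)\<^sup>2" using P by (intro power_mono) auto
  also have "\<dots> = P x ^ 4" by simp
  also have "\<dots> \<le> (A + 1 - ln t) ^ 4" using P by (intro power_mono) auto
  finally have q: "((P x)\<^sup>2 - 1)\<^sup>2 \<le> (A + 1 - ln t) ^ 4" .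
  have "n\<^sup>2 * ((norm (x + Q) / (2 * \<rho>))\<^sup>2 - 1) * ((P x)\<^sup>2 - 1)\<^sup>2 \<le> n\<^sup>2 * (2 * (r * t)) * ((P x)\<^sup>2 - 1)\<^sup>2"
    using d by (intro mult_right_mono mult_left_mono) auto
  also have "\<dots> \<le> n\<^sup>2 * (2 * (r * t)) * (A + 1 - ln t) ^ 4"
    using q r t by (intro mult_left_mono) auto
  also have "\<dots> = 2 * n\<^sup>2 * r * (t * (A + 1 - ln t) ^ 4)" by simp
  also have "\<dots> \<le> 2 * n\<^sup>2 * r * ((A + 1) + 4) ^ 4"
    using mult_log_power4_le[OF t, of "A + 1"] r MA(2) by (intro mult_left_mono) auto
  also have "\<dots> \<le> 3" using r(1) by (simp add: add.assoc)
  finally show ?thesis .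
qed

end

text \<open>The reciprocal of X(\<alpha> t) is 1 - ln \<alpha> - ln t, which is at least A + 1 - ln
  t and hence at least g.\<close>

lemma X_powr_le:
  assumes "0 < \<alpha>" "\<alpha> \<le> exp (- A)" "0 < t" "t \<le> 1" "0 < g" "g \<le> A + 1 - ln t" "0 \<le> s"
  shows "X (\<alpha> * t) powr s \<le> g powr (- s)"
proof -
  have "ln \<alpha> \<le> - A" using assms(1,2) by (metis exp_gt_zero ln_exp ln_le_cancel_iff)
  then have g: "g \<le> 1 - ln (\<alpha> * t)" using assms by (simp add: ln_mult_pos)
  then have "X (\<alpha> * t) \<le> inverse g"
    unfolding X_def using assms(5) by (simp add: field_simps)
  moreover have "0 \<le> X (\<alpha> * t)" unfolding X_def using g assms(5) by simp
  ultimately have "X (\<alpha> * t) powr s \<le> inverse g powr s" using assms(7) by (intro powr_mono2)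
  then show ?thesis using assms(5) by (simp add: powr_minus inverse_powr)
qed

theorem theorem17:
  fixes n :: nat and \<gamma> :: real
  assumes "n = CARD('n::finite)" and "n \<ge> 3" and "0 \<le> \<gamma>" and "\<gamma> < n / 2"
  shows "\<exists>r \<alpha>star :: real. 0 < r \<and> r < 1 \<and> 0 < \<alpha>star \<and> \<alpha>star < 1 \<and>
    (\<forall>(p::real) (k::'n) (\<Omega> :: (real ^ 'n) set) (D::real) (\<rho>::real).
       2 < p \<longrightarrow> p \<le> 2 * real n / (real n - 2) \<longrightarrow>
       open \<Omega> \<longrightarrow> connected \<Omega> \<longrightarrow> bounded \<Omega> \<longrightarrow> 0 \<in> frontier \<Omega> \<longrightarrow>
       D = (SUP x\<in>\<Omega>. norm x) \<longrightarrow>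
       0 < \<rho> \<longrightarrow> ball (- \<rho> *\<^sub>R axis k 1) \<rho> \<subseteq> - closure \<Omega> \<longrightarrow>
       \<rho> \<ge> D / r \<longrightarrow>
       (\<forall>(\<alpha>::real) u. 0 < \<alpha> \<longrightarrow> \<alpha> \<le> \<alpha>star \<longrightarrow> u \<in> Cc_infinity \<Omega> \<longrightarrow>
          (LINT x:\<Omega>|lborel. (norm (grad u x))\<^sup>2)
            \<ge> (real n)\<^sup>2 / 4 * (LINT x:\<Omega>|lborel. (u x)\<^sup>2 / (norm x)\<^sup>2)
              + (real n - 2 * \<gamma>) powr (- ((p + 2) / p)) * S_star k p \<gamma>
                * (LINT x:\<Omega>|lborel.
                     norm x powr (p * (real n - 2) / 2 - real n)
                     * (norm (x + (2 * \<rho>) *\<^sub>R axis k 1) / (2 * \<rho>)) powr (p * (real n - 2) / 2 - real n)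
                     * X (\<alpha> * norm x / D) powr ((p + 2) / 2)
                     * \<bar>u x\<bar> powr p) powr (2 / p)))"
proof -
  define \<delta> where "\<delta> = real n - 2 * \<gamma>"
  \<comment> \<open>One unit covers the oscillation of ln d in \<open>P_bounds\<close>; what remains
    gives P \<ge> 1 + 1/\<delta>, hence P > 1 and \<delta> g \<ge> 1.\<close>
  define A where "A = 2 + inverse \<delta>"
  \<comment> \<open>The numerator gives M = D exp A \<le> \<rho>; the denominator is the bound for
    the logarithmic factor in the defect estimate, whose left side becomes 2 exp(-A).\<close>
  define r where "r = exp (- A) / ((real n)\<^sup>2 * (A + 5) ^ 4)"
  have \<delta>: "\<delta> > 0" using assms by (simp add: \<delta>_def)
  then have A: "A > 2" by (simp add: A_def)
  have "(real n)\<^sup>2 \<ge> 1" using assms(2) by simp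
  moreover have "(A + 5) ^ 4 \<ge> 1" using A by simp
  ultimately have nA: "(real n)\<^sup>2 * (A + 5) ^ 4 \<ge> 1" using mult_mono[of 1 "(real n)\<^sup>2" 1 "(A + 5) ^ 4"] by simp
  have r0: "r > 0" using nA by (simp add: r_def)
  have rA: "r \<le> exp (- A)"
    using nA by (simp add: r_def divide_le_eq mult_le_cancel_left1)
  have A1: "exp (- A) < 1" using A by simp
  have rn: "2 * (real n)\<^sup>2 * r * (A + 5) ^ 4 \<le> 3"
  proof -
    have "(real n)\<^sup>2 * (A + 5) ^ 4 \<noteq> 0" using nA by linarith
    then have "2 * (real n)\<^sup>2 * r * (A + 5) ^ 4 = 2 * exp (- A)" by (simp add: r_def)
    then show ?thesis using A1 by linarith
  qed
  have main: "(real n)\<^sup>2 / 4 * (LINT x:\<Omega>|lborel. (u x)\<^sup>2 / (norm x)\<^sup>2)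
              + (real n - 2 * \<gamma>) powr (- ((p + 2) / p)) * S_star k p \<gamma>
                * (LINT x:\<Omega>|lborel.
                     norm x powr (p * (real n - 2) / 2 - real n)
                     * (norm (x + (2 * \<rho>) *\<^sub>R axis k 1) / (2 * \<rho>)) powr (p * (real n - 2) / 2 - real n)
                     * X (\<alpha> * norm x / D) powr ((p + 2) / 2)
                     * \<bar>u x\<bar> powr p) powr (2 / p) \<le> (LINT x:\<Omega>|lborel. (norm (grad u x))\<^sup>2)"
    if p: "2 < p" and \<Omega>: "open \<Omega>" "bounded \<Omega>" and D_def: "D = (SUP x\<in>\<Omega>. norm x)"
      and \<rho>: "0 < \<rho>" and ball: "ball (- \<rho> *\<^sub>R axis k 1) \<rho> \<subseteq> - closure \<Omega>" and D\<rho>: "\<rho> \<ge> D / r"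
      and \<alpha>: "0 < \<alpha>" "\<alpha> \<le> exp (- A)" and u\<Omega>: "u \<in> Cc_infinity \<Omega>"
    for p k \<Omega> D \<rho> \<alpha> and u :: "real^'n \<Rightarrow> real"
  proof -
    define a where "a = p * (real n - 2) / 2 - real n"
    define I where "I = (\<lambda>x. norm x powr a * (norm (x + (2 * \<rho>) *\<^sub>R axis k 1) / (2 * \<rho>)) powr a
      * X (\<alpha> * norm x / D) powr ((p + 2) / 2) * \<bar>u x\<bar> powr p)"
    obtain K where K: "compact K" "K \<subseteq> \<Omega>" "\<And>x. x \<notin> K \<Longrightarrow> u x = 0" and u: "\<And>m. Ck m u"
      using Cc_infinityD[OF u\<Omega>] by metis
    have z: "u x = 0" "grad u x = 0" if "x \<notin> \<Omega>" for x
      using that K grad_eq_0_outside[OF K(1), of u x] by auto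
    have setint: "(LINT x:\<Omega>|lborel. (u x)\<^sup>2 / (norm x)\<^sup>2) = (LINT x|lborel. (u x)\<^sup>2 / (norm x)\<^sup>2)"
      "(LINT x:\<Omega>|lborel. (norm (grad u x))\<^sup>2) = (LINT x|lborel. (norm (grad u x))\<^sup>2)"
      "(LINT x:\<Omega>|lborel. I x) = (LINT x|lborel. I x)"
      by (rule set_lebesgue_integral_support, simp add: z I_def)+
    have "(real n)\<^sup>2 / 4 * (LINT x|lborel. (u x)\<^sup>2 / (norm x)\<^sup>2)
       + \<delta> powr (- ((p + 2) / p)) * S_star k p \<gamma> * (LINT x|lborel. I x) powr (2 / p)
       \<le> (LINT x|lborel. (norm (grad u x))\<^sup>2)"
    proof (cases "u = (\<lambda>x. 0)")
      \<comment> \<open>For u = 0 there is no nonzero test function to show that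
        \<open>S_star\<close> is nonnegative, but its factor is 0 powr (2 / p) = 0.\<close>
      case True
      then show ?thesis by (simp add: I_def)
    next
      case False
      have xD: "norm x \<le> D" if "x \<in> \<Omega>" for x
        unfolding D_def using \<Omega>(2) that
        by (intro cSUP_upper) (auto simp: bdd_above_norm)
      \<comment> \<open>The function \<theta> does not involve M, so these facts are taken with the
        placeholder M = 1; the actual M requires D > 0, which is proved from them.\<close>
      have \<theta>0: "exterior_ball.\<theta> k \<rho> x > 0" if "x \<in> \<Omega>" for x
        using exterior_ball.\<theta>_pos_outside_ball[of \<rho> 1, OF _ \<Omega>(1) ball that] \<rho> by (simp add: exterior_ball_def)
      obtain x0 where "u x0 \<noteq> 0" using False by auto
      then have "x0 \<in> \<Omega>" using z by auto
      moreover have "x0 \<noteq> 0"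
        using exterior_ball.\<theta>_pos_imp(1)[of \<rho> 1, OF _ \<theta>0[OF \<open>x0 \<in> \<Omega>\<close>]] \<rho> by (simp add: exterior_ball_def)
      ultimately have D0: "D > 0" using xD[of x0] by (metis less_le_trans zero_less_norm_iff)
      define M where "M = D * exp A"
      have Dr: "D \<le> r * \<rho>" using D\<rho> r0 by (simp add: field_simps)
      have "r * \<rho> \<le> exp (- A) * \<rho>" using rA \<rho> by simp
      then have "D * exp A \<le> exp (- A) * \<rho> * exp A" using Dr by (intro mult_right_mono) auto
      moreover have "exp (- A) * \<rho> * exp A = \<rho>" by (simp add: exp_minus)
      ultimately have "M \<le> \<rho>" by (simp add: M_def)
      then interpret exterior_ball_map k \<rho> M \<delta>
        using \<rho> \<delta> D0 by unfold_locales (simp_all add: M_def)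
      have "r * \<rho> \<le> 1 * \<rho>" using rA A1 \<rho> by (intro mult_right_mono) linarith+
      then have D\<rho>': "D \<le> \<rho>" using Dr by simp
      have PA: "1 + inverse \<delta> \<le> P x" "P x \<le> A + 1 - ln (norm x / D)" if "x \<in> \<Omega>" for x
        using P_bounds[OF \<theta>0[OF that] xD[OF that] D\<rho>' M_def] by (simp_all add: A_def)
      have P1: "P x > 1" if "x \<in> \<Omega>" for x
        using PA(1)[OF that] \<delta> by (smt (verit) positive_imp_inverse_positive)
      have KV: "K \<subseteq> V" using K(2) \<theta>0 P1 by (auto simp: V_def)
      have g: "1 \<le> \<delta> * sqrt ((P x)\<^sup>2 - 1)" if "x \<in> \<Omega>" for x
      proof -
        have "(1 + inverse \<delta>)\<^sup>2 \<le> (P x)\<^sup>2" using PA(1)[OF that] \<delta> by (intro power_mono) auto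
        moreover have "(1 + inverse \<delta>)\<^sup>2 = 1 + 2 * inverse \<delta> + (inverse \<delta>)\<^sup>2"
          by (simp add: power2_eq_square algebra_simps)
        ultimately have "(inverse \<delta>)\<^sup>2 \<le> (P x)\<^sup>2 - 1" using \<delta> by (smt (verit) positive_imp_inverse_positive)
        then have "inverse \<delta> \<le> sqrt ((P x)\<^sup>2 - 1)" by (rule real_le_rsqrt)
        then have "\<delta> * inverse \<delta> \<le> \<delta> * sqrt ((P x)\<^sup>2 - 1)" using \<delta> by (intro mult_left_mono) auto
        then show ?thesis using \<delta> by simp
      qed
      have d: "(real CARD('n))\<^sup>2 * ((norm (x + Q) / (2 * \<rho>))\<^sup>2 - 1) * ((P x)\<^sup>2 - 1)\<^sup>2 \<le> 3" if "x \<in> \<Omega>" for x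
        using rn r0 less_imp_le[OF order_le_less_trans[OF rA A1]] A assms(1)
        by (intro conformal_defect_le[OF \<theta>0[OF that] xD[OF that] Dr _ M_def]) auto
      define F where "F = (\<lambda>x. (norm x * (norm (x + Q) / (2 * \<rho>))) powr a
        * sqrt ((P x)\<^sup>2 - 1) powr (- ((p + 2) / 2)) * \<bar>u x\<bar> powr p)"
      define Y where "Y = (LINT \<xi>|lborel. norm \<xi> powr a * \<bar>pull u \<xi>\<bar> powr p)"
      have "continuous_on UNIV u"
        using Ck_on_imp_continuous[of 0 UNIV u] u[of 0] Ck_eq_Ck_on by blast
      then have cu: "continuous_on K u" by (rule continuous_on_subset) simp
      have p0: "p > 0" using p by simp
      have Fi: "integrable lborel F" and FY: "\<delta> * Y = (LINT x|lborel. F x)"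
        using integral_pull_Lp[OF K(1) KV K(3) cu p0] unfolding F_def Y_def a_def assms(1) by blast+
      have "(LINT x|lborel. I x) \<le> (LINT x|lborel. F x)"
      proof (rule integral_mono'[OF Fi])
        fix x
        show "0 \<le> F x" by (simp add: F_def)
        show "I x \<le> F x"
        proof (cases "x \<in> \<Omega>")
          case True
          have x0: "x \<noteq> 0" using \<theta>_pos_imp[OF \<theta>0[OF True]] by simp
          have "X (\<alpha> * (norm x / D)) powr ((p + 2) / 2) \<le> sqrt ((P x)\<^sup>2 - 1) powr (- ((p + 2) / 2))"
          proof (rule X_powr_le[OF \<alpha>])
            show "0 < norm x / D" "norm x / D \<le> 1" using x0 D0 xD[OF True] by simp_all
            have "0 < inverse \<delta>" using \<delta> by simp
            have "1 < (P x)\<^sup>2" using P1[OF True] by simp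
            then show "0 < sqrt ((P x)\<^sup>2 - 1)" by simp
            have "sqrt ((P x)\<^sup>2 - 1) \<le> P x" using P1[OF True] by (intro real_le_lsqrt) auto
            then show "sqrt ((P x)\<^sup>2 - 1) \<le> A + 1 - ln (norm x / D)" using PA(2)[OF True] by linarith
          qed (use p in simp)
          moreover have "norm x powr a * (norm (x + Q) / (2 * \<rho>)) powr a = (norm x * (norm (x + Q) / (2 * \<rho>))) powr a"
            by (rule powr_mult[symmetric])
          ultimately show ?thesis
            unfolding I_def F_def Q_def[symmetric] times_divide_eq_right[symmetric, of \<alpha>]
            by (simp add: mult_left_mono mult_right_mono)
        qed (simp add: I_def F_def z)
      qed
      \<comment> \<open>Only the upper bound of the weighted integral by \<delta> Y is used;
        multiplying it by \<open>S_star\<close> requires the sign of that constant, obtained from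
        the nonzero function \<open>pull u\<close>.\<close>
      then have "(LINT x|lborel. I x) powr (2 / p) \<le> (\<delta> * Y) powr (2 / p)"
        unfolding FY using p0 by (intro powr_mono2) (simp_all add: I_def)
      also have "\<dots> = \<delta> powr (2 / p) * Y powr (2 / p)"
        using \<delta> by (simp add: powr_mult Y_def)
      finally have "\<delta> powr (- ((p + 2) / p)) * S_star k p \<gamma> * (LINT x|lborel. I x) powr (2 / p)
        \<le> \<delta> powr (- ((p + 2) / p)) * S_star k p \<gamma> * (\<delta> powr (2 / p) * Y powr (2 / p))"
      proof (rule mult_left_mono)
        have vC: "pull u \<in> Cc_infinity (half_space k)" by (rule pull_Cc_infinity[OF K(1) KV K(3) u])
        have "pull u \<noteq> (\<lambda>x. 0)" by (rule pull_nonzero) (use K KV False in auto)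
        from S_star_Cc_infinity(1)[OF vC this] show "0 \<le> \<delta> powr (- ((p + 2) / p)) * S_star k p \<gamma>" by simp
      qed
      also have "\<dots> = inverse \<delta> * (S_star k p \<gamma> * Y powr (2 / p))"
      proof -
        \<comment> \<open>The factor \<delta> to the power 2/p from the Jacobian reduces the power
          in the theorem to the 1/\<delta> of \<open>Hardy_Sobolev_pull\<close>.\<close>
        have "- ((p + 2) / p) + 2 / p = - 1" using p0 by (simp add: field_simps)
        then have "\<delta> powr (- ((p + 2) / p)) * \<delta> powr (2 / p) = \<delta> powr (- 1)"
          by (simp only: powr_add[symmetric])
        also have "\<dots> = inverse \<delta>" using \<delta> by (simp add: powr_minus)
        finally have *: "\<delta> powr (- ((p + 2) / p)) * \<delta> powr (2 / p) = inverse \<delta>" .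
        show ?thesis unfolding *[symmetric] by (simp only: mult_ac)
      qed
      finally have "(real n)\<^sup>2 / 4 * (LINT x|lborel. (u x)\<^sup>2 / (norm x)\<^sup>2)
         + \<delta> powr (- ((p + 2) / p)) * S_star k p \<gamma> * (LINT x|lborel. I x) powr (2 / p)
         \<le> (real n)\<^sup>2 / 4 * (LINT x|lborel. (u x)\<^sup>2 / (norm x)\<^sup>2) + inverse \<delta> * (S_star k p \<gamma> * Y powr (2 / p))"
        by simp
      also have "\<dots> \<le> (LINT x|lborel. (norm (grad u x))\<^sup>2)"
      proof -
        have "\<delta> = real CARD('n) - 2 * \<gamma>" by (simp add: \<delta>_def assms(1))
        from Hardy_Sobolev_pull[OF K(1) KV K(3) u False g d this, of p] K(2)
        show ?thesis unfolding Y_def a_def assms(1) by blast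
      qed
      finally show ?thesis .
    qed
    then show ?thesis
      unfolding setint(1,2) setint(3)[unfolded I_def a_def] \<delta>_def I_def a_def .
  qed
  show ?thesis
    by (rule exI[of _ r], rule exI[of _ "exp (- A)"]) (use r0 order_le_less_trans[OF rA A1] A1 main in auto)
qed

end
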